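(* Let $L$ be an involutive link and let $L^*$ be the involutive mirror of $L$. Then $\operatorname{Kh}_\tau^{i,j,k}(L^* )\cong\operatorname{Kh}_\tau^{-i,-j,-k}(L)$ for all $i,j\in\mathbb{Z}$ and $k\in\frac12\mathbb{Z}$.
   Context: Involutive links. Let $R\colon S^2\to S^2$ be reflection in a great circle $\mathbf a\subset S^2$, and let $\tau\colon S^3\to S^3$ be the orientation-preserving involution obtained from $(p,q)\mapsto(R(p),-q)$ on $S^2\times(-\infty,\infty)$ by adding two points $\pm\infty$ (which $\tau$ exchanges). Its fixed point set is the axis $\mathbf a$. An involutive link is an (oriented) link $L\subset S^3$ with $\tau(L)=L$ as a set and $\mathbf a\not\subset L$, up to isotopy through involutive links. An involutive diagram is the projection to $S^2$, with over/under information, of a generic involutive link missing $\pm\infty$; it is symmetric under $R$. A crossing is on-axis if it lies on $\mathbf a$ and off-axis otherwise. The involutive mirror $L^*$ is the involutive link with diagram $D^*$ obtained from an involutive diagram $D$ of $L$ by changing all crossings (over to under). Khovanov complex. $\mathbb{F}=\mathbb{Z}/2\mathbb{Z}$. For a diagram $D$ with $n_+$ positive and $n_-$ negative crossings, $\operatorname{CKh}^{i,j}(D)$ has basis the decorations by $v_+$ or $v_-$ of the components of smoothings $s$ of $D$ with $i=\#\{1\text{-smoothings}\}-n_-$ and $j=\#v_+-\#v_-+\#\{1\text{-smoothings}\}+n_+-2n_-$; $d\colon \operatorname{CKh}^{i,j}\to\operatorname{CKh}^{i+1,j}$ is the Khovanov differential. Perturbed complex. If $D$ is an involutive diagram, reflection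 in $\mathbf a$ gives an involution on smoothings and bijections between components of a smoothing and of its image, inducing an involution $\tau$ on $\operatorname{CKh}(D)$ commuting with $d$. Put $d_\tau=\mathrm{id}+\tau$, $\partial=d+d_\tau$. $\operatorname{CKh}_\tau^j(D)$ is $\bigoplus_i\operatorname{CKh}^{i,j}(D)$ with differential $\partial$, and $\mathbf{H}_\tau^j(D)$ is its cohomology. Filtrations. $\mathcal F^i\operatorname{CKh}_\tau^j(D)=\bigoplus_{l\le i}\operatorname{CKh}^{l,j}(D)$. Each smoothing $s$ has a weight $w(s)\in\frac12\mathbb{Z}$, the sum over crossings $c$ of local contributions, where $o(c)$ is the oriented smoothing and $u(c)$ the other smoothing of $c$: (1) $c$ off-axis: $o(c)$ contributes $0$, and $u(c)$ contributes $\frac12$ (resp. $-\frac12$) if $c$ is positive (resp. negative); (2) $c$ on-axis and the involution reverses the orientations of $c$: $o(c)$ contributes $0$, and $u(c)$ contributes $1$ (resp. $-1$) if $c$ is positive (resp. negative); (3) $c$ on-axis and the involution preserves the orientations of $c$: if $c$ is positive, $o(c)$ contributes $-\frac12$ and $u(c)$ contributes $\frac12$; if $c$ is negative, $o(c)$ contributes $\frac12$ and $u(c)$ contributes $-\frac12$. Decorations of $s$ have $k$-grading $w(s)$, and $\mathcal G^k\operatorname{CKh}_\tau^j(D)$ is the span of those with $w(s)\ge k$. Triple grading. $\mathcal F$ and $\mathcal G$ induce filtrations on $V=\mathbf{H}_\tau^j(D)$, and $\operatorname{Kh}_\tau^{i,j,k}(L)$ is the associated graded space $(\mathcal F^iV\cap\mathcal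 G^kV)/\big((\mathcal F^iV\cap\mathcal G^{k+\frac12}V)+(\mathcal F^{i-1}V\cap\mathcal G^kV)\big)$; up to isomorphism it depends only on the involutive link $L$. *)

theory Defs
  imports "HOL-Analysis.Analysis" "HOL-Library.Z2" "HOL-Algebra.AbelCoset" "HOL-Algebra.Module"
begin

section \<open>Involutive links\<close>

text \<open>
  The three-sphere is the unit sphere of \<open>\<real>\<^sup>3 \<times> \<real>\<close>.  The product of the two-sphere and the line
  is identified with the complement of the poles \<open>(0, \<plusminus>1)\<close>, the points at infinity, by
  \<open>(p, q) \<mapsto> (p / cosh q, tanh q)\<close>; so a point \<open>(x, h)\<close> off the poles projects to \<open>x / \<bar>x\<bar>\<close>,
  and among points with the same projection a larger \<open>q\<close> means a larger \<open>h\<close>.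
  The great circle \<open>a\<close> is given by a unit normal vector \<open>\<nu>\<close>.
\<close>

definition reflect :: "real^3 \<Rightarrow> real^3 \<Rightarrow> real^3" where
  "reflect \<nu> p = p - (2 * (\<nu> \<bullet> p)) *\<^sub>R \<nu>"

definition tau :: "real^3 \<Rightarrow> (real^3) \<times> real \<Rightarrow> (real^3) \<times> real" where
  "tau \<nu> = (\<lambda>(x, h). (reflect \<nu> x, - h))"

definition axis :: "real^3 \<Rightarrow> ((real^3) \<times> real) set" where
  "axis \<nu> = {P \<in> sphere 0 1. tau \<nu> P = P}"

text \<open>
  An oriented link is given by a parametrisation, whose strands with index below \<open>ncomp\<close> are
  1-periodic.  The same oriented link has many parametrisations, see \<open>same_oriented_link\<close>.
\<close>

record olink =
  ncomp :: nat
  strand :: "nat \<Rightarrow> real \<Rightarrow> (real^3) \<times> real"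

definition params :: "nat \<Rightarrow> (nat \<times> real) set" where
  "params m = {..<m} \<times> {0..<1}"

definition smooth_curve :: "(real \<Rightarrow> 'a::real_normed_vector) \<Rightarrow> bool" where
  "smooth_curve f \<longleftrightarrow>
     (\<exists>F. F 0 = f \<and> (\<forall>(k::nat) t. (F k has_vector_derivative F (Suc k) t) (at t)))"

definition oriented_link :: "olink \<Rightarrow> bool" where
  "oriented_link L \<longleftrightarrow>
     (\<forall>c<ncomp L. smooth_curve (strand L c)
        \<and> (\<forall>t. strand L c (t + 1) = strand L c t)
        \<and> range (strand L c) \<subseteq> sphere 0 1
        \<and> (\<forall>t. vector_derivative (strand L c) (at t) \<noteq> 0))
     \<and> inj_on (\<lambda>(c, t). strand L c t) (params (ncomp L))"

definition underlying_set :: "olink \<Rightarrow> ((real^3) \<times> real) set" where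
  "underlying_set L = (\<Union>c<ncomp L. range (strand L c))"

definition involutive_link :: "real^3 \<Rightarrow> olink \<Rightarrow> bool" where
  "involutive_link \<nu> L \<longleftrightarrow>
     oriented_link L \<and> tau \<nu> ` underlying_set L = underlying_set L \<and> \<not> axis \<nu> \<subseteq> underlying_set L"

definition oriented_tangents :: "olink \<Rightarrow> (((real^3) \<times> real) \<times> ((real^3) \<times> real)) set" where
  "oriented_tangents L =
     {(strand L c t, sgn (vector_derivative (strand L c) (at t))) | c t. c < ncomp L}"

definition same_oriented_link :: "olink \<Rightarrow> olink \<Rightarrow> bool" where
  "same_oriented_link L L' \<longleftrightarrow> oriented_tangents L = oriented_tangents L'"

definition smooth_family :: "(real \<Rightarrow> real \<Rightarrow> 'a::real_normed_vector) \<Rightarrow> bool" where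
  "smooth_family H \<longleftrightarrow>
     (\<exists>F. F 0 0 = H \<and>
       (\<forall>(a::nat) (b::nat). continuous_on ({0..1} \<times> UNIV) (\<lambda>(s, t). F a b s t) \<and>
         (\<forall>s\<in>{0..1}. \<forall>t.
            ((\<lambda>s. F a b s t) has_vector_derivative F (Suc a) b s t) (at s within {0..1}) \<and>
            ((\<lambda>t. F a b s t) has_vector_derivative F a (Suc b) s t) (at t))))"

definition involutive_isotopy :: "real^3 \<Rightarrow> olink \<Rightarrow> olink \<Rightarrow> bool" where
  "involutive_isotopy \<nu> L L' \<longleftrightarrow>
     involutive_link \<nu> L \<and> involutive_link \<nu> L' \<and>
     (\<exists>m H. (\<forall>c<m. smooth_family (H c))
        \<and> (\<forall>s\<in>{0..1}. involutive_link \<nu> \<lparr>ncomp = m, strand = (\<lambda>c. H c s)\<rparr>)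
        \<and> same_oriented_link L \<lparr>ncomp = m, strand = (\<lambda>c. H c 0)\<rparr>
        \<and> same_oriented_link \<lparr>ncomp = m, strand = (\<lambda>c. H c 1)\<rparr> L')"

text \<open>Closing under composition spares us the smoothing of a concatenation of two isotopies.\<close>

definition involutively_isotopic :: "real^3 \<Rightarrow> olink \<Rightarrow> olink \<Rightarrow> bool" where
  "involutively_isotopic \<nu> = (involutive_isotopy \<nu>)\<^sup>*\<^sup>*"

section \<open>Involutive diagrams\<close>

text \<open>
  A diagram consists of the projected strands and the over/under information: \<open>(x, y) \<in> over D\<close>
  if the parameters \<open>x\<close> and \<open>y\<close> have the same projection and \<open>x\<close> lies above \<open>y\<close>.
\<close>

record diagram =
  ncurves :: nat
  curve :: "nat \<Rightarrow> real \<Rightarrow> real^3"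
  over :: "((nat \<times> real) \<times> (nat \<times> real)) set"

definition pt :: "diagram \<Rightarrow> nat \<times> real \<Rightarrow> real^3" where
  "pt D x = curve D (fst x) (snd x)"

definition tangent :: "diagram \<Rightarrow> nat \<times> real \<Rightarrow> real^3" where
  "tangent D x = vector_derivative (curve D (fst x)) (at (snd x))"

definition proj_sphere :: "(real^3) \<times> real \<Rightarrow> real^3" where
  "proj_sphere P = sgn (fst P)"

definition diagram_of :: "olink \<Rightarrow> diagram" where
  "diagram_of K =
     \<lparr>ncurves = ncomp K,
      curve = (\<lambda>c t. proj_sphere (strand K c t)),
      over = {((c, t), (c', t')) | c t c' t'.
                (c, t) \<in> params (ncomp K) \<and> (c', t') \<in> params (ncomp K) \<and>
                proj_sphere (strand K c t) = proj_sphere (strand K c' t') \<and>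
                snd (strand K c t) > snd (strand K c' t')}\<rparr>"

definition crossings :: "diagram \<Rightarrow> (real^3) set" where
  "crossings D = {pt D x | x y. (x, y) \<in> over D}"

text \<open>
  Generic: the projection is an immersion whose only multiple points are finitely many transverse
  double points.  Tangent vectors of the two strands at \<open>p\<close> lie in the tangent plane of the
  two-sphere, so that they are independent iff their triple product with \<open>p\<close> is nonzero.
\<close>

definition generic_projection :: "olink \<Rightarrow> bool" where
  "generic_projection K \<longleftrightarrow>
     (let D = diagram_of K; X = params (ncurves D) in
        (\<forall>x\<in>X. tangent D x \<noteq> 0)
        \<and> finite (crossings D)
        \<and> (\<forall>x\<in>X. \<forall>y\<in>X. \<forall>z\<in>X. pt D x = pt D y \<and> pt D y = pt D z \<longrightarrow> x = y \<or> y = z \<or> x = z)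
        \<and> (\<forall>(x, y)\<in>over D. pt D x \<bullet> cross3 (tangent D x) (tangent D y) \<noteq> 0))"

text \<open>\<open>involutive_diagram \<nu> L D\<close>: \<open>D\<close> is an involutive diagram of the involutive link \<open>L\<close>.\<close>

definition involutive_diagram :: "real^3 \<Rightarrow> olink \<Rightarrow> diagram \<Rightarrow> bool" where
  "involutive_diagram \<nu> L D \<longleftrightarrow>
     (\<exists>K. involutive_link \<nu> K \<and> involutively_isotopic \<nu> L K
        \<and> (0, 1) \<notin> underlying_set K \<and> (0, -1) \<notin> underlying_set K
        \<and> generic_projection K \<and> D = diagram_of K)"

definition change_crossings :: "diagram \<Rightarrow> diagram" where
  "change_crossings D = D\<lparr>over := (over D)\<inverse>\<rparr>"

definition over_param :: "diagram \<Rightarrow> real^3 \<Rightarrow> nat \<times> real" where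
  "over_param D p = (THE x. pt D x = p \<and> (\<exists>y. (x, y) \<in> over D))"

definition under_param :: "diagram \<Rightarrow> real^3 \<Rightarrow> nat \<times> real" where
  "under_param D p = (THE y. pt D y = p \<and> (\<exists>x. (x, y) \<in> over D))"

text \<open>
  The two-sphere is viewed from outside, that is, from large \<open>q\<close>.  A crossing is positive iff the
  direction of the over strand followed by that of the under strand is a positive basis.
\<close>

definition positive :: "diagram \<Rightarrow> real^3 \<Rightarrow> bool" where
  "positive D p \<longleftrightarrow>
     p \<bullet> cross3 (tangent D (over_param D p)) (tangent D (under_param D p)) > 0"

definition n_plus :: "diagram \<Rightarrow> nat" where
  "n_plus D = card {p \<in> crossings D. positive D p}"

definition n_minus :: "diagram \<Rightarrow> nat" where
  "n_minus D = card {p \<in> crossings D. \<not> positive D p}"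

section \<open>Smoothings\<close>

text \<open>
  Cutting the projection at the crossings leaves a finite number of arcs (and of closed curves
  without crossings).  A smoothing is given by the set \<open>s\<close> of the crossings that receive the
  1-smoothing; it reconnects the four ends of arcs at each crossing, and a component of the
  smoothing is represented by the set of arcs that it runs through.
\<close>

definition arcs :: "diagram \<Rightarrow> (real^3) set set" where
  "arcs D = components ((\<Union>c<ncurves D. range (curve D c)) - crossings D)"

definition arc_in :: "diagram \<Rightarrow> nat \<times> real \<Rightarrow> (real^3) set" where
  "arc_in D x = (THE A. A \<in> arcs D \<and> (\<forall>\<^sub>F t in at_left (snd x). curve D (fst x) t \<in> A))"

definition arc_out :: "diagram \<Rightarrow> nat \<times> real \<Rightarrow> (real^3) set" where
  "arc_out D x = (THE A. A \<in> arcs D \<and> (\<forall>\<^sub>F t in at_right (snd x). curve D (fst x) t \<in> A))"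

text \<open>
  The 0-smoothing is the oriented one at a positive crossing, and the 1-smoothing is the oriented
  one at a negative crossing.
\<close>

definition oriented_at :: "diagram \<Rightarrow> (real^3) set \<Rightarrow> real^3 \<Rightarrow> bool" where
  "oriented_at D s p \<longleftrightarrow> (p \<notin> s \<longleftrightarrow> positive D p)"

definition joins :: "diagram \<Rightarrow> (real^3) set \<Rightarrow> real^3 \<Rightarrow> ((real^3) set \<times> (real^3) set) set" where
  "joins D s p =
     (let x = over_param D p; y = under_param D p in
      if oriented_at D s p
      then {(arc_in D x, arc_out D y), (arc_in D y, arc_out D x)}
      else {(arc_in D x, arc_in D y), (arc_out D x, arc_out D y)})"

definition circles :: "diagram \<Rightarrow> (real^3) set \<Rightarrow> (real^3) set set set" where
  "circles D s =
     (let J = (\<Union>p\<in>crossings D. joins D s p) in arcs D // (J \<union> J\<inverse>)\<^sup>*)"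

section \<open>The perturbed Khovanov complex\<close>

text \<open>
  A generator \<open>(s, P)\<close> is the decoration of the smoothing \<open>s\<close> in which the circles in \<open>P\<close> are
  labelled \<open>v\<^sub>+\<close> and all others \<open>v\<^sub>-\<close>.
\<close>

type_synonym gen = "(real^3) set \<times> (real^3) set set set"

definition gens :: "diagram \<Rightarrow> gen set" where
  "gens D = {(s, P). s \<subseteq> crossings D \<and> P \<subseteq> circles D s}"

definition deg_i :: "diagram \<Rightarrow> gen \<Rightarrow> int" where
  "deg_i D = (\<lambda>(s, P). int (card s) - int (n_minus D))"

definition deg_j :: "diagram \<Rightarrow> gen \<Rightarrow> int" where
  "deg_j D = (\<lambda>(s, P). int (card P) - int (card (circles D s - P)) + int (card s)
                        + int (n_plus D) - 2 * int (n_minus D))"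

text \<open>
  \<open>khovanov_edge D g h\<close>: the generator \<open>h\<close> occurs in \<open>d g\<close>.  The two smoothings differ at one
  crossing; as the diagram is planar, two circles merge or one circle splits.  Merging \<open>a\<close> and \<open>b\<close> to \<open>e\<close> is the multiplication
  \<open>v\<^sub>+v\<^sub>+ \<mapsto> v\<^sub>+\<close>, \<open>v\<^sub>+v\<^sub>- \<mapsto> v\<^sub>-\<close>, \<open>v\<^sub>-v\<^sub>+ \<mapsto> v\<^sub>-\<close>, \<open>v\<^sub>-v\<^sub>- \<mapsto> 0\<close>;
  splitting \<open>e\<close> into \<open>a\<close> and \<open>b\<close> is the comultiplication
  \<open>v\<^sub>+ \<mapsto> v\<^sub>+v\<^sub>- + v\<^sub>-v\<^sub>+\<close>, \<open>v\<^sub>- \<mapsto> v\<^sub>-v\<^sub>-\<close>.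
\<close>

definition khovanov_edge :: "diagram \<Rightarrow> gen \<Rightarrow> gen \<Rightarrow> bool" where
  "khovanov_edge D = (\<lambda>(s, P) (s', P').
     (\<exists>p\<in>crossings D. p \<notin> s \<and> s' = insert p s) \<and>
     (let S = circles D s; S' = circles D s' in
        P \<inter> (S \<inter> S') = P' \<inter> (S \<inter> S') \<and>
        ((\<exists>a b e. a \<noteq> b \<and> S - S' = {a, b} \<and> S' - S = {e} \<and>
            (a \<in> P \<and> b \<in> P \<and> e \<in> P' \<or> (a \<in> P \<longleftrightarrow> b \<notin> P) \<and> e \<notin> P')) \<or>
         (\<exists>a b e. a \<noteq> b \<and> S - S' = {e} \<and> S' - S = {a, b} \<and>
            (e \<in> P \<and> (a \<in> P' \<longleftrightarrow> b \<notin> P') \<or> e \<notin> P \<and> a \<notin> P' \<and> b \<notin> P')))))"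

text \<open>A circle is a set of arcs and an arc is a set of points, which \<open>reflect \<nu>\<close> moves pointwise.\<close>

definition tau_gen :: "real^3 \<Rightarrow> gen \<Rightarrow> gen" where
  "tau_gen \<nu> = (\<lambda>(s, P). (reflect \<nu> ` s, (\<lambda>C. (\<lambda>A. reflect \<nu> ` A) ` C) ` P))"

text \<open>Chains are functions from the generators to the field with two elements.\<close>

type_synonym chain = "gen \<Rightarrow> bit"

definition cochains :: "diagram \<Rightarrow> int \<Rightarrow> chain set" where
  "cochains D j = {f. \<forall>g. f g \<noteq> 0 \<longrightarrow> g \<in> gens D \<and> deg_j D g = j}"

definition chain_module :: "chain set \<Rightarrow> (bit, chain) module" where
  "chain_module U =
     \<lparr>carrier = U, monoid.mult = (\<lambda>_ _. undefined), one = undefined,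
      zero = (\<lambda>_. 0), add = (\<lambda>f f' g. f g + f' g), smult = (\<lambda>a f g. a * f g)\<rparr>"

text \<open>Linear extension of the map that sends the generator \<open>g\<close> to the sum of all \<open>h\<close> with \<open>M g h\<close>.\<close>

definition linear_extension :: "diagram \<Rightarrow> (gen \<Rightarrow> gen \<Rightarrow> bool) \<Rightarrow> chain \<Rightarrow> chain" where
  "linear_extension D M f =
     (\<lambda>h. if h \<in> gens D then (\<Sum>g\<in>gens D. of_bool (M g h) * f g) else 0)"

definition khovanov_d :: "diagram \<Rightarrow> chain \<Rightarrow> chain" where
  "khovanov_d D = linear_extension D (khovanov_edge D)"

definition tau_chain :: "real^3 \<Rightarrow> diagram \<Rightarrow> chain \<Rightarrow> chain" where
  "tau_chain \<nu> D = linear_extension D (\<lambda>g h. h = tau_gen \<nu> g)"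

definition d_tau :: "real^3 \<Rightarrow> diagram \<Rightarrow> chain \<Rightarrow> chain" where
  "d_tau \<nu> D f = (\<lambda>g. f g + tau_chain \<nu> D f g)"

definition total_d :: "real^3 \<Rightarrow> diagram \<Rightarrow> chain \<Rightarrow> chain" where
  "total_d \<nu> D f = (\<lambda>g. khovanov_d D f g + d_tau \<nu> D f g)"

section \<open>Filtrations\<close>

text \<open>
  At an on-axis crossing \<open>\<tau>\<close> exchanges the two strands, and it either preserves or reverses
  the orientations of both.
\<close>

definition reverses :: "real^3 \<Rightarrow> diagram \<Rightarrow> real^3 \<Rightarrow> bool" where
  "reverses \<nu> D p \<longleftrightarrow>
     (\<exists>r>0. reflect \<nu> (tangent D (over_param D p)) = (- r) *\<^sub>R tangent D (under_param D p))"

definition local_weight :: "real^3 \<Rightarrow> diagram \<Rightarrow> (real^3) set \<Rightarrow> real^3 \<Rightarrow> rat" where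
  "local_weight \<nu> D s p =
     (let ori = oriented_at D s p; pos = positive D p in
      if \<nu> \<bullet> p \<noteq> 0 then (if ori then 0 else if pos then 1/2 else - 1/2)
      else if reverses \<nu> D p then (if ori then 0 else if pos then 1 else - 1)
      else if pos then (if ori then - 1/2 else 1/2)
      else (if ori then 1/2 else - 1/2))"

definition weight :: "real^3 \<Rightarrow> diagram \<Rightarrow> (real^3) set \<Rightarrow> rat" where
  "weight \<nu> D s = (\<Sum>p\<in>crossings D. local_weight \<nu> D s p)"

definition filt_F :: "diagram \<Rightarrow> int \<Rightarrow> int \<Rightarrow> chain set" where
  "filt_F D j i = {f \<in> cochains D j. \<forall>g. f g \<noteq> 0 \<longrightarrow> deg_i D g \<le> i}"

definition filt_G :: "real^3 \<Rightarrow> diagram \<Rightarrow> int \<Rightarrow> rat \<Rightarrow> chain set" where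
  "filt_G \<nu> D j k = {f \<in> cochains D j. \<forall>g. f g \<noteq> 0 \<longrightarrow> weight \<nu> D (fst g) \<ge> k}"

section \<open>Cohomology and its associated graded spaces\<close>

definition quotient_module :: "('r, 'a) module \<Rightarrow> 'a set \<Rightarrow> ('r, 'a set) module" where
  "quotient_module M W =
     \<lparr>carrier = a_rcosets\<^bsub>M\<^esub> W, monoid.mult = (\<lambda>_ _. undefined), one = undefined,
      zero = W, add = (\<lambda>X Y. X <+>\<^bsub>M\<^esub> Y),
      smult = (\<lambda>a X. \<Union>x\<in>X. W +>\<^bsub>M\<^esub> (a \<odot>\<^bsub>M\<^esub> x))\<rparr>"

definition linearly_isomorphic :: "('r, 'a) module \<Rightarrow> ('r, 'b) module \<Rightarrow> bool" where
  "linearly_isomorphic M N \<longleftrightarrow>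
     (\<exists>h. bij_betw h (carrier M) (carrier N)
        \<and> (\<forall>x\<in>carrier M. \<forall>y\<in>carrier M. h (x \<oplus>\<^bsub>M\<^esub> y) = h x \<oplus>\<^bsub>N\<^esub> h y)
        \<and> (\<forall>a. \<forall>x\<in>carrier M. h (a \<odot>\<^bsub>M\<^esub> x) = a \<odot>\<^bsub>N\<^esub> h x))"

definition cocycles :: "real^3 \<Rightarrow> diagram \<Rightarrow> int \<Rightarrow> chain set" where
  "cocycles \<nu> D j = {f \<in> cochains D j. total_d \<nu> D f = (\<lambda>_. 0)}"

definition coboundaries :: "real^3 \<Rightarrow> diagram \<Rightarrow> int \<Rightarrow> chain set" where
  "coboundaries \<nu> D j = total_d \<nu> D ` cochains D j"

definition H_tau :: "real^3 \<Rightarrow> diagram \<Rightarrow> int \<Rightarrow> (bit, chain set) module" where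
  "H_tau \<nu> D j = quotient_module (chain_module (cocycles \<nu> D j)) (coboundaries \<nu> D j)"

text \<open>
  The subspace of cohomology induced by a subspace \<open>S\<close> of the complex: the classes that are
  represented by a cocycle in \<open>S\<close>.  (Neither \<open>S\<close> nor a step of \<open>filt_F\<close> has to be a subcomplex.)
\<close>

definition induced :: "real^3 \<Rightarrow> diagram \<Rightarrow> int \<Rightarrow> chain set \<Rightarrow> chain set set" where
  "induced \<nu> D j S = {X \<in> carrier (H_tau \<nu> D j). X \<inter> S \<noteq> {}}"

definition Kh_tau ::
    "real^3 \<Rightarrow> diagram \<Rightarrow> int \<Rightarrow> int \<Rightarrow> rat \<Rightarrow> (bit, chain set set) module" where
  "Kh_tau \<nu> D i j k =
     (let V = H_tau \<nu> D j;
          FV = (\<lambda>i. induced \<nu> D j (filt_F D j i));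
          GV = (\<lambda>k. induced \<nu> D j (filt_G \<nu> D j k))
      in quotient_module (V\<lparr>carrier := FV i \<inter> GV k\<rparr>)
           ((FV i \<inter> GV (k + 1/2)) <+>\<^bsub>V\<^esub> (FV (i - 1) \<inter> GV k)))"

text \<open>
  \<open>involutive_mirror \<nu> L L' D\<close>: \<open>L'\<close> is the involutive link with the diagram obtained from the
  involutive diagram \<open>D\<close> of \<open>L\<close> by changing all crossings.
\<close>

definition involutive_mirror :: "real^3 \<Rightarrow> olink \<Rightarrow> olink \<Rightarrow> diagram \<Rightarrow> bool" where
  "involutive_mirror \<nu> L L' D \<longleftrightarrow>
     involutive_link \<nu> L \<and> involutive_link \<nu> L' \<and>
     involutive_diagram \<nu> L D \<and> involutive_diagram \<nu> L' (change_crossings D)"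

end

theory Submission
  imports Defs "HOL-Library.Function_Algebras"
begin

text \<open>
  The theorem is linear duality over the field with two elements.  Replacing the set of
  1-smoothings of a state by its complement and exchanging the labels \<open>v\<^sub>+\<close> and \<open>v\<^sub>-\<close> is a bijection
  \<open>complement\<close> from the generators of the mirror diagram to those of \<open>D\<close>.  A crossing and its mirror
  image have opposite signs, so the smoothed curves stay the same, every edge of the Khovanov
  differential is reversed (merging is transposed to splitting), \<open>\<tau>\<close> is preserved, and the
  \<open>i\<close>-, \<open>j\<close>- and \<open>k\<close>-gradings change sign.  Hence the differential \<open>\<partial>\<close> of the mirror is the transpose
  of that of \<open>D\<close>, and the filtration steps \<open>F\<^sup>i\<close> and \<open>G\<^sup>k\<close> of the mirror are the annihilators of the steps
  \<open>F\<close> at \<open>- i - 1\<close> and \<open>G\<close> at \<open>1/2 - k\<close> of \<open>D\<close>; the latter uses that weights are half-integers.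

  If \<open>\<partial>\<^sup>2 = 0\<close>, annihilators are compatible with passing to the filtrations induced on cohomology
  (\<open>perp_filtered\<close>), and the graded piece of the mirror is dual to a subquotient of the
  cohomology of \<open>D\<close> that is isomorphic to the graded piece at the opposite degrees.  A finite vector
  space over this field is determined by its number of elements, so no isomorphism has to be written
  down: \<open>Kh_tau_dual_isomorphic\<close> compares cardinalities, with \<open>card_times_card_perp\<close>
  (\<open>|A| |A\<^sup>\<bottom>| = |C|\<close>) and \<open>|A + B| |A \<inter> B| = |A| |B|\<close> as the only tools.

  What remains is \<open>\<partial>\<^sup>2 = 0\<close> for the complex built from an actual curve on the sphere, that is,
  \<open>d\<^sup>2 = 0\<close> and \<open>d \<tau> = \<tau> d\<close>.  For \<open>d\<^sup>2 = 0\<close> the geometry enters only through a handshake argument: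
  every set of arcs contains an even number of ends of arcs at crossings (\<open>even_arc_ends\<close>),
  because each arc leaving a crossing arrives at the next one along the curve.  It implies that at each
  crossing the four ends are connected in pairs by the rest of a smoothing (\<open>rest_pairing\<close>), so that
  a change of smoothing merges two circles, splits one, or leaves all circles unchanged and then
  contributes zero to \<open>d\<close>.  Lowering a label commutes with \<open>d\<close>, which reduces the commutation of
  squares to the generator with all labels \<open>v\<^sub>+\<close>, where it is a short case distinction
  (\<open>paths_commute_top\<close>).  For \<open>d \<tau> = \<tau> d\<close> one follows the strands under the involution of the
  three-sphere: near each point \<open>\<tau>\<close> is a reparametrisation of the link with nonzero speed
  (\<open>mirror_param_local\<close>), whose sign decides whether incoming and outgoing arcs are exchanged.  Since
  a reversal of one strand of a crossing changes both its sign and its oriented smoothing, the set of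
  1-smoothings is carried to its reflection in all cases (\<open>sym_joins_reflect\<close>).
\<close>

section \<open>Annihilators in finite abelian groups\<close>

text \<open>
  By default the simplifier turns sums and products of bits into conditions on parities, which
  destroys the sums over generators below.
\<close>

declare add_bit_eq_xor [simp del] mult_bit_eq_and [simp del]

definition add_subgroup :: "'v::ab_group_add set \<Rightarrow> bool" where
  "add_subgroup A \<longleftrightarrow> 0 \<in> A \<and> (\<forall>x\<in>A. \<forall>y\<in>A. x - y \<in> A)"

lemma add_subgroupD:
  assumes "add_subgroup A"
  shows "0 \<in> A" "x \<in> A \<Longrightarrow> y \<in> A \<Longrightarrow> x - y \<in> A" "x \<in> A \<Longrightarrow> - x \<in> A"
    "x \<in> A \<Longrightarrow> y \<in> A \<Longrightarrow> x + y \<in> A"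
proof -
  show z: "0 \<in> A" and m: "x \<in> A \<Longrightarrow> y \<in> A \<Longrightarrow> x - y \<in> A" for x y
    using assms by (auto simp: add_subgroup_def)
  show u: "x \<in> A \<Longrightarrow> - x \<in> A" for x
    using m[OF z, of x] by simp
  show "x \<in> A \<Longrightarrow> y \<in> A \<Longrightarrow> x + y \<in> A"
    using m[of x "- y"] u by simp
qed

definition sum_set :: "'v::ab_group_add set \<Rightarrow> 'v set \<Rightarrow> 'v set"  (infixl "\<oplus>\<^sub>s" 65) where
  "A \<oplus>\<^sub>s B = (\<lambda>(a, b). a + b) ` (A \<times> B)"

lemma sum_setI: "a \<in> A \<Longrightarrow> b \<in> B \<Longrightarrow> a + b \<in> A \<oplus>\<^sub>s B"
  by (auto simp: sum_set_def)

lemma sum_setE: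
  assumes "x \<in> A \<oplus>\<^sub>s B"
  obtains a b where "a \<in> A" "b \<in> B" "x = a + b"
  using assms by (auto simp: sum_set_def)

lemma add_subgroup_Int: "add_subgroup A \<Longrightarrow> add_subgroup B \<Longrightarrow> add_subgroup (A \<inter> B)"
  by (auto simp: add_subgroup_def)

lemma add_subgroup_sum_set:
  assumes "add_subgroup A" "add_subgroup B"
  shows "add_subgroup (A \<oplus>\<^sub>s B)"
  unfolding add_subgroup_def
proof (intro conjI ballI)
  show "0 \<in> A \<oplus>\<^sub>s B"
    using sum_setI[of 0 A 0 B] add_subgroupD(1) assms by auto
  fix x y assume "x \<in> A \<oplus>\<^sub>s B" "y \<in> A \<oplus>\<^sub>s B"
  then obtain a b a' b' where "a \<in> A" "b \<in> B" "a' \<in> A" "b' \<in> B" "x = a + b" "y = a' + b'"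
    by (metis sum_setE)
  then have "(a - a') + (b - b') \<in> A \<oplus>\<^sub>s B" "x - y = (a - a') + (b - b')"
    using assms by (auto intro!: sum_setI add_subgroupD(2))
  then show "x - y \<in> A \<oplus>\<^sub>s B" by simp
qed

lemma sum_set_superset:
  assumes "add_subgroup A" "add_subgroup B"
  shows "A \<subseteq> A \<oplus>\<^sub>s B" "B \<subseteq> A \<oplus>\<^sub>s B"
  using sum_setI[of _ A 0 B] sum_setI[of 0 A _ B] add_subgroupD(1) assms by force+

lemma sum_set_least: "add_subgroup C \<Longrightarrow> A \<subseteq> C \<Longrightarrow> B \<subseteq> C \<Longrightarrow> A \<oplus>\<^sub>s B \<subseteq> C"
  by (auto elim!: sum_setE intro: add_subgroupD(4))

lemma sum_set_mono: "A \<subseteq> A' \<Longrightarrow> B \<subseteq> B' \<Longrightarrow> A \<oplus>\<^sub>s B \<subseteq> A' \<oplus>\<^sub>s B'"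
  by (auto simp: sum_set_def)

lemma add_subgroup_image:
  assumes A: "add_subgroup A" and h: "\<And>x y. x \<in> A \<Longrightarrow> y \<in> A \<Longrightarrow> h (x - y) = h x - h y"
  shows "add_subgroup (h ` A)"
  unfolding add_subgroup_def
proof (intro conjI ballI)
  have "h 0 = 0" using h[OF add_subgroupD(1,1)[OF A]] by simp
  then show "0 \<in> h ` A" using add_subgroupD(1)[OF A] by (auto simp: image_iff intro!: bexI[of _ 0])
  fix x y assume "x \<in> h ` A" "y \<in> h ` A"
  then obtain a b where ab: "a \<in> A" "b \<in> A" "x = h a" "y = h b" by blast
  then have "x - y = h (a - b)" using h by simp
  with ab show "x - y \<in> h ` A" using add_subgroupD(2)[OF A] by auto
qed

text \<open>
  All nonempty fibres of an additive map are translates of its kernel.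
\<close>

lemma card_image_times_kernel:
  fixes h :: "'v::ab_group_add \<Rightarrow> 'w::ab_group_add"
  assumes "finite A" and A: "add_subgroup A"
    and add: "\<And>x y. x \<in> A \<Longrightarrow> y \<in> A \<Longrightarrow> h (x + y) = h x + h y"
  shows "card A = card (h ` A) * card {x \<in> A. h x = 0}"
proof -
  have "card {x \<in> A. h x = y} = card {x \<in> A. h x = 0}" if "y \<in> h ` A" for y
  proof -
    obtain a where a: "a \<in> A" "h a = y" using \<open>y \<in> h ` A\<close> by blast
    have "bij_betw (\<lambda>x. x + a) {x \<in> A. h x = 0} {x \<in> A. h x = y}"
    proof (rule bij_betw_byWitness[where f' = "\<lambda>x. x - a"])
      have "h (x - a) = 0" if "x \<in> A" "h x = y" for x
        using add[of "x - a" a] that a add_subgroupD(2)[OF A] by simp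
      then show "(\<lambda>x. x - a) ` {x \<in> A. h x = y} \<subseteq> {x \<in> A. h x = 0}"
        using a add_subgroupD(2)[OF A] by auto
      show "(\<lambda>x. x + a) ` {x \<in> A. h x = 0} \<subseteq> {x \<in> A. h x = y}"
        using a add add_subgroupD(4)[OF A] by auto
    qed auto
    then show ?thesis by (rule bij_betw_same_card[symmetric])
  qed
  moreover have "card A = (\<Sum>y\<in>h ` A. card {x \<in> A. h x = y})"
    using sum.image_gen[OF \<open>finite A\<close>, of "\<lambda>_. 1::nat" h] by simp
  ultimately show ?thesis by simp
qed

text \<open>
  Addition maps \<open>A \<times> B\<close> onto the sum, and its kernel is an antidiagonal copy of \<open>A \<inter> B\<close>.
\<close>

lemma card_sum_set_times_card_Int:
  assumes "finite A" "finite B" "add_subgroup A" "add_subgroup B"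
  shows "card (A \<oplus>\<^sub>s B) * card (A \<inter> B) = card A * card B"
proof -
  have "card (A \<times> B) = card (A \<oplus>\<^sub>s B) * card {x \<in> A \<times> B. (case x of (a, b) \<Rightarrow> a + b) = 0}"
    unfolding sum_set_def
    by (rule card_image_times_kernel)
       (use assms in \<open>simp_all add: add_subgroup_def zero_prod_def split_beta\<close>)
  moreover have "{x \<in> A \<times> B. (case x of (a, b) \<Rightarrow> a + b) = 0} = (\<lambda>a. (a, - a)) ` (A \<inter> B)"
  proof (intro equalityI subsetI)
    fix x assume "x \<in> {x \<in> A \<times> B. (case x of (a, b) \<Rightarrow> a + b) = 0}"
    then obtain a b where x: "x = (a, b)" "a \<in> A" "b \<in> B" "a + b = 0" by auto
    then have b: "b = - a" by (simp add: minus_unique)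
    then have "a \<in> B" using add_subgroupD(3)[OF assms(4) x(3)] by simp
    then show "x \<in> (\<lambda>a. (a, - a)) ` (A \<inter> B)" using x b by blast
  next
    fix x assume "x \<in> (\<lambda>a. (a, - a)) ` (A \<inter> B)"
    then obtain a where a: "a \<in> A" "a \<in> B" "x = (a, - a)" by blast
    with add_subgroupD(3)[OF assms(4) a(2)]
    show "x \<in> {x \<in> A \<times> B. (case x of (a, b) \<Rightarrow> a + b) = 0}" by simp
  qed
  moreover have "card ((\<lambda>a. (a, - a)) ` (A \<inter> B)) = card (A \<inter> B)"
    by (rule card_image) (auto simp: inj_on_def)
  ultimately show ?thesis by (simp add: card_cartesian_product)
qed

section \<open>Perfect pairings\<close>

text \<open>
  Orthogonality of characters: translation by an element where the character is \<open>- 1\<close> changes the sign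
  of the sum.
\<close>

lemma sum_sign_additive:
  fixes \<phi> :: "'v::ab_group_add \<Rightarrow> bit"
  assumes "finite A" and A: "add_subgroup A"
    and add: "\<And>x y. x \<in> A \<Longrightarrow> y \<in> A \<Longrightarrow> \<phi> (x + y) = \<phi> x + \<phi> y"
    and a: "a \<in> A" "\<phi> a \<noteq> 0"
  shows "(\<Sum>x\<in>A. if \<phi> x = 0 then 1 else - 1 :: int) = 0"
proof -
  let ?s = "\<lambda>x. if \<phi> x = 0 then 1 else - 1 :: int"
  have "(\<Sum>x\<in>A. ?s x) = (\<Sum>x\<in>A. ?s (x + a))"
    by (rule sum.reindex_bij_witness[of _ "\<lambda>x. x + a" "\<lambda>x. x - a"])
       (use a add_subgroupD(2,4)[OF A] in simp_all)
  also have "\<dots> = (\<Sum>x\<in>A. - ?s x)"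
  proof (rule sum.cong[OF refl])
    fix x assume "x \<in> A"
    then show "?s (x + a) = - ?s x"
      using a add[of x a] by (cases "\<phi> x"; cases "\<phi> a") auto
  qed
  also have "\<dots> = - (\<Sum>x\<in>A. ?s x)" by (simp add: sum_negf)
  finally show ?thesis by simp
qed

text \<open>
  Nondegeneracy is required on both sides; it forces the two groups to have the same number of
  elements (\<open>card_eq\<close>).
\<close>

locale perfect_pairing =
  fixes C :: "'v::ab_group_add set" and C' :: "'w::ab_group_add set" and pair :: "'w \<Rightarrow> 'v \<Rightarrow> bit"
  assumes finite_C: "finite C" and finite_C': "finite C'"
    and C: "add_subgroup C" and C': "add_subgroup C'"
    and pair_add_right: "\<lbrakk>f \<in> C'; x \<in> C; y \<in> C\<rbrakk> \<Longrightarrow> pair f (x + y) = pair f x + pair f y"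
    and pair_add_left: "\<lbrakk>f \<in> C'; g \<in> C'; x \<in> C\<rbrakk> \<Longrightarrow> pair (f + g) x = pair f x + pair g x"
    and nondegenerate_right: "\<lbrakk>x \<in> C; x \<noteq> 0\<rbrakk> \<Longrightarrow> \<exists>f\<in>C'. pair f x \<noteq> 0"
    and nondegenerate_left: "\<lbrakk>f \<in> C'; f \<noteq> 0\<rbrakk> \<Longrightarrow> \<exists>x\<in>C. pair f x \<noteq> 0"
begin

definition perp :: "'v set \<Rightarrow> 'w set" where
  "perp A = {f \<in> C'. \<forall>x\<in>A. pair f x = 0}"

lemma pair_zero_right: "f \<in> C' \<Longrightarrow> pair f 0 = 0"
  using pair_add_right[of f 0 0] add_subgroupD(1)[OF C] by simp

lemma pair_zero_left: "x \<in> C \<Longrightarrow> pair 0 x = 0"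
  using pair_add_left[of 0 0 x] add_subgroupD(1)[OF C'] by simp

lemma add_subgroup_perp: 
  assumes "A \<subseteq> C"
  shows "add_subgroup (perp A)"
  unfolding add_subgroup_def
proof (intro conjI ballI)
  show "0 \<in> perp A"
    using add_subgroupD(1)[OF C'] pair_zero_left assms by (auto simp: perp_def)
  fix f g assume f: "f \<in> perp A" and g: "g \<in> perp A"
  then have "f - g \<in> C'" using add_subgroupD(2)[OF C'] by (auto simp: perp_def)
  moreover have "pair (f - g) x = 0" if "x \<in> A" for x
    using pair_add_left[of "f - g" g x] f g that assms \<open>f - g \<in> C'\<close> by (auto simp: perp_def)
  ultimately show "f - g \<in> perp A" by (simp add: perp_def)
qed

lemma perp_subset: "perp A \<subseteq> C'"
  by (auto simp: perp_def)

lemma finite_perp: "finite (perp A)"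
  using finite_subset[OF perp_subset finite_C'] .

lemma perp_antimono: "A \<subseteq> B \<Longrightarrow> perp B \<subseteq> perp A"
  by (auto simp: perp_def)

text \<open>
  The sum of the signs of \<open>pair f x\<close> over all \<open>x \<in> A\<close> and \<open>f \<in> C'\<close> is computed in both orders.  By
  orthogonality of characters, summing over \<open>f\<close> first leaves only \<open>x = 0\<close>, and summing over \<open>x\<close> first
  leaves only the \<open>f\<close> that annihilate \<open>A\<close>.
\<close>

lemma card_times_card_perp:
  assumes A: "add_subgroup A" "A \<subseteq> C"
  shows "card A * card (perp A) = card C'"
proof -
  have finA: "finite A" using A(2) finite_C finite_subset by blast
  let ?s = "\<lambda>f x. if pair f x = 0 then 1 else - 1 :: int"
  have "(\<Sum>x\<in>A. \<Sum>f\<in>C'. ?s f x) = (\<Sum>x\<in>A. if x = 0 then int (card C') else 0)"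
  proof (rule sum.cong[OF refl])
    fix x assume x: "x \<in> A"
    show "(\<Sum>f\<in>C'. ?s f x) = (if x = 0 then int (card C') else 0)"
    proof (cases "x = 0")
      case True
      then show ?thesis by (simp add: pair_zero_right)
    next
      case False
      then obtain f where "f \<in> C'" "pair f x \<noteq> 0" using nondegenerate_right x A by blast
      then have "(\<Sum>f\<in>C'. ?s f x) = 0"
        using sum_sign_additive[OF finite_C' C', of "\<lambda>f. pair f x" f] pair_add_left x A by auto
      then show ?thesis using False by simp
    qed
  qed
  also have "\<dots> = int (card C')"
    using finA add_subgroupD(1)[OF A(1)] by (simp add: sum.delta)
  finally have 1: "(\<Sum>x\<in>A. \<Sum>f\<in>C'. ?s f x) = int (card C')" .
  have "(\<Sum>f\<in>C'. \<Sum>x\<in>A. ?s f x) = (\<Sum>f\<in>C'. if f \<in> perp A then int (card A) else 0)"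
  proof (rule sum.cong[OF refl])
    fix f assume f: "f \<in> C'"
    show "(\<Sum>x\<in>A. ?s f x) = (if f \<in> perp A then int (card A) else 0)"
    proof (cases "f \<in> perp A")
      case True
      then show ?thesis by (simp add: perp_def)
    next
      case False
      then obtain x where "x \<in> A" "pair f x \<noteq> 0" using f by (auto simp: perp_def)
      then have "(\<Sum>x\<in>A. ?s f x) = 0"
        using sum_sign_additive[OF finA A(1), of "pair f" x] pair_add_right f A by auto
      then show ?thesis using False by simp
    qed
  qed
  also have "\<dots> = int (card A) * int (card (perp A))"
    using finite_C' perp_subset by (simp add: sum.If_cases Int_absorb1)
  finally have "int (card A) * int (card (perp A)) = int (card C')"
    using 1 sum.swap[of "\<lambda>x f. ?s f x" C' A] by simp
  then show ?thesis by (metis of_nat_eq_iff of_nat_mult)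
qed

lemma card_eq: "card C = card C'"
proof -
  have "perp C = {0}"
  proof (intro equalityI subsetI)
    fix f assume "f \<in> perp C"
    then show "f \<in> {0}" using nondegenerate_left[of f] by (auto simp: perp_def)
  qed (use add_subgroupD(1)[OF C'] pair_zero_left in \<open>auto simp: perp_def\<close>)
  then show ?thesis using card_times_card_perp[OF C] by simp
qed

lemma perp_sum_set:
  assumes "add_subgroup A" "A \<subseteq> C" "add_subgroup B" "B \<subseteq> C"
  shows "perp (A \<oplus>\<^sub>s B) = perp A \<inter> perp B"
proof
  show "perp (A \<oplus>\<^sub>s B) \<subseteq> perp A \<inter> perp B"
    by (intro Int_greatest perp_antimono sum_set_superset assms)
  show "perp A \<inter> perp B \<subseteq> perp (A \<oplus>\<^sub>s B)"
    using assms pair_add_right by (auto simp: perp_def subset_iff elim!: sum_setE)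
qed

lemma card_pos: "add_subgroup A \<Longrightarrow> A \<subseteq> C \<Longrightarrow> card A > 0"
  using add_subgroupD(1) finite_C finite_subset card_gt_0_iff by blast

text \<open>
  One inclusion is clear, and the two sides have the same number of elements since
  \<open>|A + B| |A \<inter> B| = |A| |B|\<close> holds for the two subgroups and for their annihilators.
\<close>

lemma perp_Int:
  assumes A: "add_subgroup A" "A \<subseteq> C" and B: "add_subgroup B" "B \<subseteq> C"
  shows "perp (A \<inter> B) = perp A \<oplus>\<^sub>s perp B"
proof (rule sym, rule card_seteq)
  show "finite (perp (A \<inter> B))" by (rule finite_perp)
  have AB: "add_subgroup (A \<inter> B)" "A \<inter> B \<subseteq> C" using A B by (simp_all add: add_subgroup_Int le_infI1)
  have S: "add_subgroup (A \<oplus>\<^sub>s B)" "A \<oplus>\<^sub>s B \<subseteq> C"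
    using A B C by (simp_all add: add_subgroup_sum_set sum_set_least)
  show "perp A \<oplus>\<^sub>s perp B \<subseteq> perp (A \<inter> B)"
    using AB(2) by (intro sum_set_least add_subgroup_perp perp_antimono) auto
  have fin: "finite A" "finite B" using A B finite_C finite_subset by blast+
  have "card (perp A \<oplus>\<^sub>s perp B) * card (perp (A \<oplus>\<^sub>s B)) = card (perp A) * card (perp B)"
    using card_sum_set_times_card_Int[of "perp A" "perp B"] A B
    by (simp add: perp_sum_set finite_perp add_subgroup_perp)
  then have "(card A * card B) * (card (perp A \<oplus>\<^sub>s perp B) * card (perp (A \<oplus>\<^sub>s B)))
      = (card A * card (perp A)) * (card B * card (perp B))" by simp
  also have "\<dots> = (card (A \<inter> B) * card (perp (A \<inter> B))) * (card (A \<oplus>\<^sub>s B) * card (perp (A \<oplus>\<^sub>s B)))"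
    using A B AB S by (simp add: card_times_card_perp)
  also have "\<dots> = (card A * card B) * (card (perp (A \<inter> B)) * card (perp (A \<oplus>\<^sub>s B)))"
    using card_sum_set_times_card_Int[OF fin A(1) B(1)] by (simp add: mult_ac)
  finally have "(card (perp A \<oplus>\<^sub>s perp B) * card (perp (A \<oplus>\<^sub>s B))) = (card (perp (A \<inter> B)) * card (perp (A \<oplus>\<^sub>s B)))"
    using card_pos[OF A] card_pos[OF B] by simp
  moreover have "card (perp (A \<oplus>\<^sub>s B)) > 0"
    using add_subgroupD(1)[OF add_subgroup_perp[OF S(2)]] finite_perp card_gt_0_iff by blast
  ultimately show "card (perp (A \<inter> B)) \<le> card (perp A \<oplus>\<^sub>s perp B)" by simp
qed

end

section \<open>Dual complexes\<close>

text \<open>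
  The image of the adjoint \<open>d'\<close> is the annihilator of the cycles of \<open>d\<close>, and its kernel is the annihilator
  of the boundaries; so \<open>d'\<close> has square zero as well.
\<close>

locale dual_complexes = perfect_pairing C C' pair
  for C :: "'v::ab_group_add set" and C' :: "'w::ab_group_add set" and pair +
  fixes d :: "'v \<Rightarrow> 'v" and d' :: "'w \<Rightarrow> 'w"
  assumes d_closed: "x \<in> C \<Longrightarrow> d x \<in> C" and d'_closed: "f \<in> C' \<Longrightarrow> d' f \<in> C'"
    and d_add: "\<lbrakk>x \<in> C; y \<in> C\<rbrakk> \<Longrightarrow> d (x + y) = d x + d y"
    and d'_add: "\<lbrakk>f \<in> C'; g \<in> C'\<rbrakk> \<Longrightarrow> d' (f + g) = d' f + d' g"
    and d_d: "x \<in> C \<Longrightarrow> d (d x) = 0"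
    and adjoint: "\<lbrakk>f \<in> C'; x \<in> C\<rbrakk> \<Longrightarrow> pair (d' f) x = pair f (d x)"
begin

definition "cyc = {x \<in> C. d x = 0}"
definition "bdr = d ` C"
definition "cyc' = {f \<in> C'. d' f = 0}"
definition "bdr' = d' ` C'"

lemma d_zero: "d 0 = 0"
  using d_add[of 0 0] add_subgroupD(1)[OF C] by simp

lemma d_diff: "x \<in> C \<Longrightarrow> y \<in> C \<Longrightarrow> d (x - y) = d x - d y"
  using d_add[of "x - y" y] add_subgroupD(2)[OF C] by (simp add: algebra_simps)

lemma d'_diff: "x \<in> C' \<Longrightarrow> y \<in> C' \<Longrightarrow> d' (x - y) = d' x - d' y"
  using d'_add[of "x - y" y] add_subgroupD(2)[OF C'] by (simp add: algebra_simps)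

lemma d'_zero: "d' 0 = 0"
  using d'_add[of 0 0] add_subgroupD(1)[OF C'] by simp

lemma add_subgroup_cyc: "add_subgroup cyc" "cyc \<subseteq> C"
  using C by (auto simp: cyc_def add_subgroup_def d_zero d_diff)

lemma add_subgroup_cyc': "add_subgroup cyc'" "cyc' \<subseteq> C'"
  using C' by (auto simp: cyc'_def add_subgroup_def d'_zero d'_diff)

lemma add_subgroup_bdr: "add_subgroup bdr" "bdr \<subseteq> C"
  unfolding bdr_def using add_subgroup_image[OF C d_diff] d_closed by auto

lemma add_subgroup_bdr': "add_subgroup bdr'" "bdr' \<subseteq> C'"
  unfolding bdr'_def using add_subgroup_image[OF C' d'_diff] d'_closed by auto

lemma bdr_subset_cyc: "bdr \<subseteq> cyc"
  using d_d d_closed by (auto simp: bdr_def cyc_def)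

lemma perp_bdr: "perp bdr = cyc'"
proof (intro equalityI subsetI)
  fix f assume f: "f \<in> perp bdr"
  then have "f \<in> C'" by (simp add: perp_def)
  moreover have "d' f = 0"
  proof (rule ccontr)
    assume "d' f \<noteq> 0"
    then obtain x where "x \<in> C" "pair (d' f) x \<noteq> 0"
      using nondegenerate_left d'_closed \<open>f \<in> C'\<close> by blast
    then show False using f adjoint by (auto simp: perp_def bdr_def)
  qed
  ultimately show "f \<in> cyc'" by (simp add: cyc'_def)
next
  fix f assume "f \<in> cyc'"
  then show "f \<in> perp bdr"
    using adjoint[symmetric] pair_zero_left by (auto simp: perp_def bdr_def cyc'_def)
qed

text \<open>
  One inclusion is the adjunction, the other one follows by counting: with \<open>perp_bdr\<close> both \<open>bdr'\<close> and the
  annihilator of the cycles have as many elements as \<open>bdr\<close>.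
\<close>

lemma perp_cyc: "perp cyc = bdr'"
proof (rule sym, rule card_seteq[OF finite_perp])
  show "bdr' \<subseteq> perp cyc"
    using adjoint d'_closed pair_zero_right by (auto simp: perp_def bdr'_def cyc_def)
  have "card cyc * card (perp cyc) = card C'"
    by (rule card_times_card_perp[OF add_subgroup_cyc])
  moreover have "card bdr * card cyc = card C'"
    using card_eq card_image_times_kernel[OF finite_C C d_add] by (simp add: bdr_def cyc_def)
  moreover have "card bdr * card cyc' = card C'"
    using card_times_card_perp[OF add_subgroup_bdr] by (simp add: perp_bdr)
  moreover have "card bdr' * card cyc' = card C'"
    using card_image_times_kernel[OF finite_C' C' d'_add] by (simp add: bdr'_def cyc'_def)
  moreover have "card cyc > 0" using card_pos add_subgroup_cyc by blast
  moreover have "card cyc' > 0"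
    using add_subgroupD(1)[OF add_subgroup_cyc'(1)] finite_subset[OF add_subgroup_cyc'(2) finite_C']
    by (auto simp: card_gt_0_iff)
  ultimately have "card (perp cyc) = card bdr" "card bdr' = card bdr"
    by (metis mult.commute mult_right_cancel neq0_conv)+
  then show "card (perp cyc) \<le> card bdr'" by simp
qed

text \<open>
  The preimage, in the group of cycles, of the step induced on cohomology by the subspace \<open>F\<close>.  Working
  with these preimages avoids quotients until the very end.
\<close>

definition filtered :: "'v set \<Rightarrow> 'v set" where
  "filtered F = (F \<inter> cyc) \<oplus>\<^sub>s bdr"

definition filtered' :: "'w set \<Rightarrow> 'w set" where
  "filtered' F = (F \<inter> cyc') \<oplus>\<^sub>s bdr'"

lemma add_subgroup_filtered:
  assumes "add_subgroup F"
  shows "add_subgroup (filtered F)" "filtered F \<subseteq> cyc" "filtered F \<subseteq> C"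
  unfolding filtered_def
proof -
  show "add_subgroup ((F \<inter> cyc) \<oplus>\<^sub>s bdr)"
    using assms by (simp add: add_subgroup_sum_set add_subgroup_Int add_subgroup_cyc add_subgroup_bdr)
  show "(F \<inter> cyc) \<oplus>\<^sub>s bdr \<subseteq> cyc"
    by (simp add: sum_set_least add_subgroup_cyc bdr_subset_cyc)
  then show "(F \<inter> cyc) \<oplus>\<^sub>s bdr \<subseteq> C"
    using add_subgroup_cyc(2) by blast
qed

text \<open>
  Annihilators turn the sum into an intersection and conversely, so the left-hand side is
  \<open>(F\<^sup>\<bottom> + bdr') \<inter> cyc'\<close>.  By the modular law this is \<open>(F\<^sup>\<bottom> \<inter> cyc') + bdr'\<close>, because \<open>bdr' \<subseteq> cyc'\<close>; here
  \<open>d\<^sup>2 = 0\<close> is essential.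
\<close>

lemma perp_filtered:
  assumes F: "add_subgroup F" "F \<subseteq> C"
  shows "perp (filtered F) = filtered' (perp F)"
proof -
  have Z: "add_subgroup (F \<inter> cyc)" "F \<inter> cyc \<subseteq> C"
    using F add_subgroup_cyc by (simp_all add: add_subgroup_Int le_infI1)
  have "perp (filtered F) = (perp F \<oplus>\<^sub>s bdr') \<inter> cyc'"
    unfolding filtered_def
    using Z F by (simp add: perp_sum_set add_subgroup_bdr perp_Int add_subgroup_cyc perp_bdr perp_cyc)
  also have "\<dots> = (perp F \<inter> cyc') \<oplus>\<^sub>s bdr'"
  proof -
    have B: "bdr' \<subseteq> cyc'"
      using perp_antimono[OF bdr_subset_cyc] by (simp add: perp_bdr perp_cyc)
    show ?thesis
    proof (intro equalityI subsetI)
      fix x assume x: "x \<in> (perp F \<oplus>\<^sub>s bdr') \<inter> cyc'"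
      then obtain f b where fb: "f \<in> perp F" "b \<in> bdr'" "x = f + b" by (blast elim: sum_setE)
      have "x - b \<in> cyc'"
        by (rule add_subgroupD(2)[OF add_subgroup_cyc'(1)]) (use x fb B in blast)+
      then have "f \<in> perp F \<inter> cyc'" using fb by simp
      then show "x \<in> (perp F \<inter> cyc') \<oplus>\<^sub>s bdr'" using fb by (simp add: sum_setI)
    next
      fix x assume "x \<in> (perp F \<inter> cyc') \<oplus>\<^sub>s bdr'"
      then obtain f b where fb: "f \<in> perp F" "f \<in> cyc'" "b \<in> bdr'" "x = f + b" by (blast elim: sum_setE)
      then have "x \<in> cyc'" using B add_subgroupD(4)[OF add_subgroup_cyc'(1), of f b] by blast
      then show "x \<in> (perp F \<oplus>\<^sub>s bdr') \<inter> cyc'" using fb by (simp add: sum_setI)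
    qed
  qed
  finally show ?thesis by (simp add: filtered'_def)
qed

end

section \<open>Cardinality of graded pieces\<close>

lemma card_graded_piece:
  assumes fin: "finite F" "finite G" and sub: "add_subgroup F" "add_subgroup F1" "add_subgroup G" "add_subgroup G1"
    and le: "F1 \<subseteq> F" "G1 \<subseteq> G"
  shows "card ((F \<inter> G1) \<oplus>\<^sub>s (F1 \<inter> G)) * card (F1 \<inter> G1) = card (F \<inter> G1) * card (F1 \<inter> G)"
proof -
  have "(F \<inter> G1) \<inter> (F1 \<inter> G) = F1 \<inter> G1" using le by auto
  then show ?thesis
    using card_sum_set_times_card_Int[of "F \<inter> G1" "F1 \<inter> G"] assms by (simp add: add_subgroup_Int)
qed

text \<open>
  For decreasing steps \<open>F1 \<subseteq> F\<close> and \<open>G1 \<subseteq> G\<close>, the graded piece of the annihilator filtrations has the same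
  order as \<open>(F \<inter> G) / ((F \<inter> G1) + (F1 \<inter> G))\<close>; the equation is cross-multiplied.  Both orders are the
  alternating product of the orders of \<open>F \<inter> G\<close>, \<open>F \<inter> G1\<close>, \<open>F1 \<inter> G\<close> and \<open>F1 \<inter> G1\<close>.
\<close>

lemma (in perfect_pairing) card_graded_piece_perp:
  assumes sub: "add_subgroup F" "add_subgroup F1" "add_subgroup G" "add_subgroup G1"
    and inC: "F \<subseteq> C" "G \<subseteq> C"
    and le: "F1 \<subseteq> F" "G1 \<subseteq> G"
  shows "card (perp F1 \<inter> perp G1) * card ((F \<inter> G1) \<oplus>\<^sub>s (F1 \<inter> G))
       = card (F \<inter> G) * card ((perp F1 \<inter> perp G) \<oplus>\<^sub>s (perp F \<inter> perp G1))"
proof -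
  note fin = finite_subset[OF inC(1) finite_C] finite_subset[OF inC(2) finite_C]
  have fin1: "finite F1" "finite G1" using fin le finite_subset by blast+
  have C1: "F1 \<subseteq> C" "G1 \<subseteq> C" using inC le by auto
  define N where "N = card C'"
  define Q where "Q = card ((perp F1 \<inter> perp G) \<oplus>\<^sub>s (perp F \<inter> perp G1))"
  define W where "W = card ((F \<inter> G1) \<oplus>\<^sub>s (F1 \<inter> G))"
  have perp_sum: "card (A \<oplus>\<^sub>s B) * card (perp A \<inter> perp B) = N" "card (A \<oplus>\<^sub>s B) * card (A \<inter> B) = card A * card B"
      "card (A \<inter> B) > 0" "card (A \<oplus>\<^sub>s B) > 0" "card A > 0"
    if "add_subgroup A" "A \<subseteq> C" "add_subgroup B" "B \<subseteq> C" for A B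
  proof -
    have S: "add_subgroup (A \<oplus>\<^sub>s B)" "A \<oplus>\<^sub>s B \<subseteq> C"
      using that C by (simp_all add: add_subgroup_sum_set sum_set_least)
    show "card (A \<oplus>\<^sub>s B) * card (perp A \<inter> perp B) = N"
      using card_times_card_perp[OF S] that by (simp add: N_def perp_sum_set)
    show "card (A \<oplus>\<^sub>s B) * card (A \<inter> B) = card A * card B"
      by (rule card_sum_set_times_card_Int[OF finite_subset[OF that(2) finite_C] finite_subset[OF that(4) finite_C] that(1,3)])
    show "card (A \<inter> B) > 0" by (rule card_pos) (use that in \<open>simp_all add: add_subgroup_Int le_infI1\<close>)
    show "card (A \<oplus>\<^sub>s B) > 0" by (rule card_pos[OF S])
    show "card A > 0" by (rule card_pos[OF that(1,2)])
  qed
  have "N > 0" unfolding N_def using card_pos[OF C subset_refl] by (simp add: card_eq)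
  note * = perp_sum[OF sub(1) inC(1) sub(3) inC(2)] perp_sum[OF sub(1) inC(1) sub(4) C1(2)]
    perp_sum[OF sub(2) C1(1) sub(3) inC(2)] perp_sum[OF sub(2) C1(1) sub(4) C1(2)]
  have W: "W * card (F1 \<inter> G1) = card (F \<inter> G1) * card (F1 \<inter> G)"
    unfolding W_def by (rule card_graded_piece) (use fin sub le in auto)
  have Q: "Q * card (perp F \<inter> perp G) = card (perp F1 \<inter> perp G) * card (perp F \<inter> perp G1)"
    unfolding Q_def
    by (subst card_graded_piece[of "perp F1" "perp G1" "perp F" "perp G", symmetric])
       (simp_all only: finite_perp add_subgroup_perp inC C1 perp_antimono le Int_commute)
  \<comment> \<open>Both sides can now be written in terms of the cardinalities of \<open>F\<close>, \<open>F1\<close>, \<open>G\<close>, \<open>G1\<close> and of their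
    intersections; the cardinalities are divided as real numbers.\<close>
  have r: "real N > 0" "real (card F) > 0" "real (card F1) > 0" "real (card G) > 0" "real (card G1) > 0"
      "real (card (F \<inter> G)) > 0" "real (card (F \<inter> G1)) > 0" "real (card (F1 \<inter> G)) > 0" "real (card (F1 \<inter> G1)) > 0"
    using \<open>N > 0\<close> by (simp_all only: of_nat_0_less_iff card_pos sub inC C1 add_subgroup_Int le_infI1)
  have perp_val: "real (card (perp A \<inter> perp B)) = real N * real (card (A \<inter> B)) / (real (card A) * real (card B))"
    if "card (A \<oplus>\<^sub>s B) * card (perp A \<inter> perp B) = N" "card (A \<oplus>\<^sub>s B) * card (A \<inter> B) = card A * card B"
      "real (card A) > 0" "real (card B) > 0" "real (card (A \<inter> B)) > 0" for A :: "'v set" and B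
  proof -
    have "card A * card B * card (perp A \<inter> perp B) = N * card (A \<inter> B)"
      unfolding that(1)[symmetric] that(2)[symmetric] by (simp only: mult_ac)
    then have "real (card A) * real (card B) * real (card (perp A \<inter> perp B)) = real N * real (card (A \<inter> B))"
      by (metis of_nat_mult)
    then show ?thesis using that(3,4) by (simp add: eq_divide_eq mult_ac)
  qed
  have v: "real (card (perp F \<inter> perp G)) = real N * real (card (F \<inter> G)) / (real (card F) * real (card G))"
    "real (card (perp F1 \<inter> perp G)) = real N * real (card (F1 \<inter> G)) / (real (card F1) * real (card G))"
    "real (card (perp F \<inter> perp G1)) = real N * real (card (F \<inter> G1)) / (real (card F) * real (card G1))"
    "real (card (perp F1 \<inter> perp G1)) = real N * real (card (F1 \<inter> G1)) / (real (card F1) * real (card G1))"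
    using r by (auto intro!: perp_val *)
  have "real W * real (card (F1 \<inter> G1)) = real (card (F \<inter> G1)) * real (card (F1 \<inter> G))"
    using W by (metis of_nat_mult)
  then have W': "real W = real (card (F \<inter> G1)) * real (card (F1 \<inter> G)) / real (card (F1 \<inter> G1))"
    using r by (simp add: field_simps)
  have "real Q * real (card (perp F \<inter> perp G)) = real (card (perp F1 \<inter> perp G)) * real (card (perp F \<inter> perp G1))"
    using Q by (metis of_nat_mult)
  note Qv = this[unfolded v]
  have alg': "q = n * (c * b / (a * f1 * g1))"
    if eq: "q * (n * a / (f * g)) = n * c / (f1 * g) * (n * b / (f * g1))"
      and pos: "n > 0" "a > 0" "f > 0" "g > 0" "f1 > 0" "g1 > 0" for q n a b c f g f1 g1 :: real
  proof -
    have "n * (c * b / (a * f1 * g1)) * (n * a / (f * g)) = n * c / (f1 * g) * (n * b / (f * g1))"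
      using pos by (simp add: mult_ac)
    with eq have "q * (n * a / (f * g)) = n * (c * b / (a * f1 * g1)) * (n * a / (f * g))"
      by (rule trans[OF _ sym])
    moreover have "n * a / (f * g) \<noteq> 0" using pos by simp
    ultimately show ?thesis by (rule mult_right_cancel[THEN iffD1, rotated])
  qed
  have Q': "real Q = real N * (real (card (F1 \<inter> G)) * real (card (F \<inter> G1)) / (real (card (F \<inter> G)) * real (card F1) * real (card G1)))"
    by (rule alg'[OF Qv]) (rule r)+
  have alg: "n * d / (f1 * g1) * (b * c / d) = a * (n * (c * b / (a * f1 * g1)))"
    if "a > 0" "d > 0" "f1 > 0" "g1 > 0" for a b c d n f1 g1 :: real
    using that by simp
  have "real (card (perp F1 \<inter> perp G1)) * real W = real (card (F \<inter> G)) * real Q"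
    unfolding v W' Q' by (rule alg) (rule r)+
  then show ?thesis unfolding W_def[symmetric] Q_def[symmetric] of_nat_mult[symmetric] of_nat_eq_iff .
qed

section \<open>Quotients and isomorphisms\<close>

lemma bit_fun_add_self: "f + f = (0 :: 'a \<Rightarrow> bit)"
  by (auto simp: fun_eq_iff)

text \<open>
  The map \<open>q\<close> identifies \<open>M\<close> with \<open>N / W\<close>.  Scalars other than 0 and 1 do not exist, and records of type
  \<open>module\<close> need not satisfy any axioms, so the action of these two is part of the definition.
\<close>

definition presents :: "('v::ab_group_add \<Rightarrow> 'm) \<Rightarrow> 'v set \<Rightarrow> 'v set \<Rightarrow> (bit, 'm, 'x) module_scheme \<Rightarrow> bool" where
  "presents q N W M \<longleftrightarrow> q ` N = carrier M \<and>
     (\<forall>x\<in>N. \<forall>y\<in>N. q (x + y) = q x \<oplus>\<^bsub>M\<^esub> q y) \<and>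
     (\<forall>x\<in>N. \<forall>y\<in>N. q x = q y \<longleftrightarrow> x - y \<in> W) \<and>
     (\<forall>x\<in>N. 0 \<odot>\<^bsub>M\<^esub> q x = q 0 \<and> 1 \<odot>\<^bsub>M\<^esub> q x = q x)"

lemma presentsD:
  assumes "presents q N W M"
  shows "q ` N = carrier M" "x \<in> N \<Longrightarrow> y \<in> N \<Longrightarrow> q (x + y) = q x \<oplus>\<^bsub>M\<^esub> q y"
    "x \<in> N \<Longrightarrow> y \<in> N \<Longrightarrow> q x = q y \<longleftrightarrow> x - y \<in> W"
    "x \<in> N \<Longrightarrow> 0 \<odot>\<^bsub>M\<^esub> q x = q 0" "x \<in> N \<Longrightarrow> 1 \<odot>\<^bsub>M\<^esub> q x = q x"
  using assms by (auto simp: presents_def)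

lemma presents_carrier:
  assumes "presents q N W M"
  shows "x \<in> N \<Longrightarrow> q x \<in> carrier M" "X \<in> carrier M \<Longrightarrow> \<exists>x. x \<in> N \<and> q x = X"
  unfolding presentsD(1)[OF assms, symmetric] by auto

lemma presents_restrict:
  assumes "presents q N W M" "N' \<subseteq> N"
  shows "presents q N' W (M\<lparr>carrier := q ` N'\<rparr>)"
  using assms unfolding presents_def by (auto simp: subset_iff)

lemma set_add_image:
  assumes "presents q N W M" "A \<subseteq> N" "B \<subseteq> N"
  shows "q ` A <+>\<^bsub>M\<^esub> q ` B = q ` (A \<oplus>\<^sub>s B)"
proof -
  have "q ` A <+>\<^bsub>M\<^esub> q ` B = (\<Union>a\<in>A. \<Union>b\<in>B. {q a \<oplus>\<^bsub>M\<^esub> q b})"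
    by (auto simp: set_add_def')
  also have "\<dots> = (\<Union>a\<in>A. \<Union>b\<in>B. {q (a + b)})"
    using assms presentsD(2)[OF assms(1)] by (intro SUP_cong refl) (metis subsetD)
  also have "\<dots> = q ` (A \<oplus>\<^sub>s B)" by (auto simp: sum_set_def)
  finally show ?thesis .
qed

text \<open>
  A quotient of a quotient is a quotient: the coset of \<open>q x\<close> modulo \<open>q ` K\<close> is the image of the coset
  of \<open>x\<close> modulo \<open>K\<close>.
\<close>

lemma presents_quotient:
  assumes q: "presents q N W M" and N: "add_subgroup N" and K: "add_subgroup K"
    and le: "W \<subseteq> K" "K \<subseteq> N"
  shows "presents (\<lambda>x. (q ` K) +>\<^bsub>M\<^esub> q x) N K (quotient_module M (q ` K))"
proof -
  define Q where "Q x = (q ` K) +>\<^bsub>M\<^esub> q x" for x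
  have Q: "Q x = q ` (K \<oplus>\<^sub>s {x})" if "x \<in> N" for x
  proof -
    have "Q x = (\<Union>k\<in>K. {q k \<oplus>\<^bsub>M\<^esub> q x})" by (auto simp: Q_def a_r_coset_def')
    also have "\<dots> = (\<Union>k\<in>K. {q (k + x)})"
      using le that presentsD(2)[OF q] by (intro SUP_cong refl) (metis subsetD)
    also have "\<dots> = q ` (K \<oplus>\<^sub>s {x})" by (auto simp: sum_set_def)
    finally show ?thesis .
  qed
  have shift: "K \<oplus>\<^sub>s {x} = K \<oplus>\<^sub>s {y}" if "x - y \<in> K" for x y
  proof -
    have "k + x = (k + (x - y)) + y" "k + y = (k - (x - y)) + x" for k by simp_all
    moreover have "k + (x - y) \<in> K" "k - (x - y) \<in> K" if "k \<in> K" for k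
      using add_subgroupD(4,2)[OF K \<open>k \<in> K\<close> \<open>x - y \<in> K\<close>] .
    ultimately show ?thesis
      by (intro equalityI subsetI) (metis insertI1 singletonD sum_setE sum_setI)+
  qed
  have sub: "K \<oplus>\<^sub>s {x} \<subseteq> N" if "x \<in> N" for x
    using that le add_subgroupD(4)[OF N] by (auto elim!: sum_setE)
  have eq: "Q x = Q y \<longleftrightarrow> x - y \<in> K" if xy: "x \<in> N" "y \<in> N" for x y
  proof
    assume "x - y \<in> K"
    then show "Q x = Q y" using shift[of x y] by (simp add: Q xy)
  next
    assume "Q x = Q y"
    moreover have "q x \<in> q ` (K \<oplus>\<^sub>s {x})"
      using sum_setI[OF add_subgroupD(1)[OF K], of x "{x}"] by simp
    ultimately have "q x \<in> q ` (K \<oplus>\<^sub>s {y})" by (simp add: Q xy)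
    then obtain k where k: "k \<in> K" "q x = q (k + y)" by (auto elim!: sum_setE)
    then have "x - (k + y) \<in> W"
      using presentsD(3)[OF q] xy le add_subgroupD(4)[OF N] by blast
    then have "(x - (k + y)) + k \<in> K" using k le add_subgroupD(4)[OF K] by blast
    then show "x - y \<in> K" by (simp add: algebra_simps)
  qed
  have "presents Q N K (quotient_module M (q ` K))"
    unfolding presents_def
  proof (intro conjI ballI)
    show "Q ` N = carrier (quotient_module M (q ` K))"
      by (auto simp: quotient_module_def A_RCOSETS_def' Q_def presentsD(1)[OF q, symmetric])
  next
    fix x y assume xy: "x \<in> N" "y \<in> N"
    have "(K \<oplus>\<^sub>s {x}) \<oplus>\<^sub>s (K \<oplus>\<^sub>s {y}) = K \<oplus>\<^sub>s {x + y}"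
    proof (intro equalityI subsetI)
      fix z assume "z \<in> (K \<oplus>\<^sub>s {x}) \<oplus>\<^sub>s (K \<oplus>\<^sub>s {y})"
      then obtain k l where "k \<in> K" "l \<in> K" "z = (k + x) + (l + y)" by (auto elim!: sum_setE)
      then have "k + l \<in> K" "z = (k + l) + (x + y)"
        using add_subgroupD(4)[OF K] by (simp_all add: algebra_simps)
      then show "z \<in> K \<oplus>\<^sub>s {x + y}" by (simp add: sum_setI)
    next
      fix z assume "z \<in> K \<oplus>\<^sub>s {x + y}"
      then obtain k where k: "k \<in> K" "z = (k + x) + (0 + y)" by (auto elim!: sum_setE simp: algebra_simps)
      then show "z \<in> (K \<oplus>\<^sub>s {x}) \<oplus>\<^sub>s (K \<oplus>\<^sub>s {y})"
        unfolding k(2) by (intro sum_setI) (simp_all add: add_subgroupD(1)[OF K])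
    qed
    then have "Q x <+>\<^bsub>M\<^esub> Q y = Q (x + y)"
      using set_add_image[OF q sub sub] xy add_subgroupD(4)[OF N] by (simp add: Q)
    then show "Q (x + y) = Q x \<oplus>\<^bsub>quotient_module M (q ` K)\<^esub> Q y"
      by (simp add: quotient_module_def)
  next
    fix x y assume "x \<in> N" "y \<in> N"
    then show "Q x = Q y \<longleftrightarrow> x - y \<in> K" by (rule eq)
  next
    fix x assume x: "x \<in> N"
    have ne: "Q x \<noteq> {}" using add_subgroupD(1)[OF K] x by (auto simp: Q sum_set_def)
    have "0 \<odot>\<^bsub>M\<^esub> y = q 0" if "y \<in> Q x" for y
      using that sub[OF x] presentsD(4)[OF q] x by (auto simp: Q)
    then have "(\<Union>y\<in>Q x. q ` K +>\<^bsub>M\<^esub> (0 \<odot>\<^bsub>M\<^esub> y)) = Q 0"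
      using ne by (auto simp: Q_def[of 0])
    then show "0 \<odot>\<^bsub>quotient_module M (q ` K)\<^esub> Q x = Q 0"
      by (simp add: quotient_module_def)
    have "q ` K +>\<^bsub>M\<^esub> (1 \<odot>\<^bsub>M\<^esub> y) = Q x" if y: "y \<in> Q x" for y
    proof -
      obtain z where z: "z \<in> K \<oplus>\<^sub>s {x}" "y = q z" using y x by (auto simp: Q)
      then have "z \<in> N" "z - x \<in> K" using sub[OF x] by (blast, auto elim!: sum_setE)
      then show ?thesis using eq[of z x] x z presentsD(5)[OF q] by (simp add: Q_def)
    qed
    then show "1 \<odot>\<^bsub>quotient_module M (q ` K)\<^esub> Q x = Q x"
      using ne by (simp add: quotient_module_def)
  qed
  then show ?thesis by (simp add: Q_def[abs_def])
qed

lemma add_subgroup_union_coset: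
  assumes G: "add_subgroup G" and "x + x = 0"
  shows "add_subgroup (G \<union> (\<lambda>g. g + x) ` G)"
  unfolding add_subgroup_def
proof (intro conjI ballI)
  show "0 \<in> G \<union> (\<lambda>g. g + x) ` G" using add_subgroupD(1)[OF G] by simp
  have m: "- x = x" using assms(2) by (rule minus_unique)
  have *: "g + x - h = (g - h) + x" "g - (h + x) = (g - h) + x" "g + x - (h + x) = g - h" for g h
  proof -
    show "g + x - h = (g - h) + x" "g + x - (h + x) = g - h" by (simp_all add: algebra_simps)
    have "g - (h + x) = (g - h) + (- x)" by (simp add: algebra_simps)
    then show "g - (h + x) = (g - h) + x" unfolding m .
  qed
  fix u v assume uv: "u \<in> G \<union> (\<lambda>g. g + x) ` G" "v \<in> G \<union> (\<lambda>g. g + x) ` G"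
  then obtain g h where gh: "g \<in> G" "h \<in> G" "u = g \<or> u = g + x" "v = h \<or> v = h + x" by blast
  then have "g - h \<in> G" using add_subgroupD(2)[OF G] by blast
  then show "u - v \<in> G \<union> (\<lambda>g. g + x) ` G" using gh(3,4) * by force
qed

text \<open>
  Two quotients with the same number of elements are isomorphic.  The graph of an isomorphism is found
  as a maximal subgroup \<open>G\<close> of \<open>N \<times> N'\<close> that contains \<open>W \<times> W'\<close> and relates elements of \<open>W\<close> only to
  elements of \<open>W'\<close> and conversely.  By counting, \<open>G\<close> projects onto \<open>N\<close> iff it projects onto \<open>N'\<close>; if it
  did neither, it could be enlarged by a pair of elements outside of the two projections.
\<close>

lemma linearly_isomorphic_if_same_index:
  fixes q :: "('a \<Rightarrow> bit) \<Rightarrow> 'm" and q' :: "('b \<Rightarrow> bit) \<Rightarrow> 'n"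
  assumes q: "presents q N W M" and q': "presents q' N' W' M'"
    and sub: "add_subgroup N" "add_subgroup W" "add_subgroup N'" "add_subgroup W'"
    and le: "W \<subseteq> N" "W' \<subseteq> N'"
    and fin: "finite N" "finite N'"
    and index: "card N * card W' = card N' * card W"
  shows "linearly_isomorphic M M'"
proof -
  define adm where "adm G \<longleftrightarrow> add_subgroup G \<and> W \<times> W' \<subseteq> G \<and> G \<subseteq> N \<times> N' \<and> (\<forall>(x, y)\<in>G. x \<in> W \<longleftrightarrow> y \<in> W')" for G
  have "adm (W \<times> W')"
    using sub le by (auto simp: adm_def add_subgroup_def zero_prod_def)
  moreover have "{G. adm G} \<subseteq> Pow (N \<times> N')"
    by (auto simp only: adm_def)
  then have "finite {G. adm G}"
    by (rule finite_subset) (simp add: fin)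
  ultimately obtain G where "G \<in> {G. adm G}" "\<forall>G'\<in>{G. adm G}. G \<subseteq> G' \<longrightarrow> G = G'"
    using finite_has_maximal[of "{G. adm G}"] by blast
  then have G: "adm G" and max: "\<And>G'. adm G' \<Longrightarrow> G \<subseteq> G' \<Longrightarrow> G' = G"
    by blast+
  from G have Gs: "add_subgroup G" and WG: "W \<times> W' \<subseteq> G" and GN: "G \<subseteq> N \<times> N'"
    and GW: "\<And>x y. (x, y) \<in> G \<Longrightarrow> x \<in> W \<longleftrightarrow> y \<in> W'" by (auto simp: adm_def)
  have finG: "finite G" using GN fin finite_subset by blast
  have z: "0 \<in> W" "0 \<in> W'" using add_subgroupD(1) sub by blast+
  have "{x \<in> G. fst x = 0} = {0} \<times> W'"
    using GW[of 0] z WG by force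
  then have c1: "card G = card (fst ` G) * card W'"
    using card_image_times_kernel[OF finG Gs, of fst] by (simp add: card_cartesian_product_singleton)
  have "{x \<in> G. snd x = 0} = W \<times> {0}"
    using GW[of _ 0] z WG by force
  then have c2: "card G = card (snd ` G) * card W"
    using card_image_times_kernel[OF finG Gs, of snd] by (simp add: card_cartesian_product)
  have pos: "card W > 0" "card W' > 0"
    using add_subgroupD(1)[OF sub(2)] add_subgroupD(1)[OF sub(4)] le fin
    by (auto simp: card_gt_0_iff intro: finite_subset)
  have iff: "fst ` G = N \<longleftrightarrow> snd ` G = N'"
  proof
    assume "fst ` G = N"
    then have "card (snd ` G) * card W = card N' * card W" using c1 c2 index by simp
    then have "card (snd ` G) = card N'" using pos by simp
    moreover have "snd ` G \<subseteq> N'" using GN by auto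
    ultimately show "snd ` G = N'" using fin by (simp add: card_subset_eq)
  next
    assume "snd ` G = N'"
    then have "card (fst ` G) * card W' = card N * card W'" using c1 c2 index by presburger
    then have "card (fst ` G) = card N" using pos by (metis mult_right_cancel neq0_conv)
    moreover have "fst ` G \<subseteq> N" using GN by auto
    ultimately show "fst ` G = N" using fin by (simp add: card_subset_eq)
  qed
  have full: "fst ` G = N"
  proof (rule ccontr)
    assume ne: "fst ` G \<noteq> N"
    have "fst ` G \<subseteq> N" "snd ` G \<subseteq> N'" "snd ` G \<noteq> N'" using GN ne iff by auto
    then obtain x y where x: "x \<in> N" "x \<notin> fst ` G" and y: "y \<in> N'" "y \<notin> snd ` G"
      using ne by blast
    let ?G = "G \<union> (\<lambda>g. g + (x, y)) ` G"
    have W1: "W \<subseteq> fst ` G" "W' \<subseteq> snd ` G"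
      using WG z by force+
    have new: "u + x \<notin> W" "v + y \<notin> W'" if uv: "(u, v) \<in> G" for u v
    proof -
      show "u + x \<notin> W"
      proof
        assume "u + x \<in> W"
        then obtain w where "(u + x, w) \<in> G" using W1 by force
        then have "(u + x, w) - (u, v) \<in> G" by (rule add_subgroupD(2)[OF Gs _ uv])
        then have "(x, w - v) \<in> G" by simp
        then show False using x(2) by (metis fst_conv image_eqI)
      qed
      show "v + y \<notin> W'"
      proof
        assume "v + y \<in> W'"
        then obtain w where "(w, v + y) \<in> G" using W1 by force
        then have "(w, v + y) - (u, v) \<in> G" by (rule add_subgroupD(2)[OF Gs _ uv])
        then have "(w - u, y) \<in> G" by simp
        then show False using y(2) by (metis snd_conv image_eqI)
      qed
    qed
    have "adm ?G"
      unfolding adm_def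
    proof (intro conjI)
      show "add_subgroup ?G"
        by (rule add_subgroup_union_coset[OF Gs]) (simp add: zero_prod_def bit_fun_add_self)
      show "W \<times> W' \<subseteq> ?G" using WG by blast
      show "?G \<subseteq> N \<times> N'"
      proof (intro Un_least GN subsetI)
        fix g assume "g \<in> (\<lambda>g. g + (x, y)) ` G"
        then obtain u v where uv: "(u, v) \<in> G" "g = (u + x, v + y)" by force
        then have "u \<in> N" "v \<in> N'" using GN by auto
        then show "g \<in> N \<times> N'"
          unfolding uv(2) using x(1) y(1) by (intro SigmaI add_subgroupD(4)[OF sub(1)] add_subgroupD(4)[OF sub(3)])
      qed
      show "\<forall>(x, y)\<in>?G. (x \<in> W) = (y \<in> W')"
        using GW new by auto
    qed
    then have "?G = G" by (rule max) blast
    moreover have "0 + (x, y) \<in> ?G" using add_subgroupD(1)[OF Gs] by blast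
    ultimately have "(x, y) \<in> G" by simp
    then show False using x by force
  qed
  define r where "r x = (SOME y. (x, y) \<in> G)" for x
  have r: "(x, r x) \<in> G" if xN: "x \<in> N" for x
  proof -
    obtain y where "(x, y) \<in> G" using xN full by force
    then show ?thesis unfolding r_def by (rule someI[where P = "\<lambda>y. (x, y) \<in> G"])
  qed
  have rN: "r x \<in> N'" if "x \<in> N" for x using r[OF that] GN by blast
  have rq: "q' (r x) = q' y" if "(x', y) \<in> G" "x \<in> N" "q x = q x'" for x x' y
  proof -
    have "x' \<in> N" "y \<in> N'" using that GN by auto
    then have "x - x' \<in> W" using that presentsD(3)[OF q] by blast
    moreover have "(x - x', r x - y) \<in> G"
      using add_subgroupD(2)[OF Gs r[OF that(2)] that(1)] by simp
    ultimately have "r x - y \<in> W'" using GW by blast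
    then show ?thesis using presentsD(3)[OF q' rN[OF that(2)] \<open>y \<in> N'\<close>] by blast
  qed
  define p where "p X = (SOME x. x \<in> N \<and> q x = X)" for X
  have p: "p X \<in> N \<and> q (p X) = X" if "X \<in> carrier M" for X
  proof -
    obtain x where "x \<in> N \<and> q x = X" using presents_carrier(2)[OF q \<open>X \<in> carrier M\<close>] ..
    then show ?thesis unfolding p_def by (rule someI[where P = "\<lambda>x. x \<in> N \<and> q x = X"])
  qed
  define h where "h X = q' (r (p X))" for X
  have h: "h (q x) = q' y" if "(x, y) \<in> G" for x y
  proof -
    have "x \<in> N" using that GN by auto
    then have "p (q x) \<in> N \<and> q (p (q x)) = q x" by (intro p presents_carrier(1)[OF q])
    then show ?thesis unfolding h_def using rq[OF that, of "p (q x)"] by simp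
  qed
  have z0: "(0, 0) \<in> G" using add_subgroupD(1)[OF Gs] by (simp add: zero_prod_def)
  have ex: "\<exists>x y. (x, y) \<in> G \<and> X = q x" if "X \<in> carrier M" for X
  proof -
    obtain x where "x \<in> N" "X = q x" using presents_carrier(2)[OF q \<open>X \<in> carrier M\<close>] by blast
    then show ?thesis using r by blast
  qed
  have "bij_betw h (carrier M) (carrier M')"
  proof (rule bij_betw_imageI)
    show "inj_on h (carrier M)"
    proof (rule inj_onI)
      fix X Y assume "X \<in> carrier M" "Y \<in> carrier M" and hXY: "h X = h Y"
      with ex[of X] ex[of Y] obtain x y u v where G2: "(x, y) \<in> G" "X = q x" "(u, v) \<in> G" "Y = q u" by blast
      then have N2: "x \<in> N" "u \<in> N" "y \<in> N'" "v \<in> N'" using GN by auto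
      have "q' y = q' v" using hXY G2 h by simp
      then have "y - v \<in> W'" using presentsD(3)[OF q' N2(3,4)] by blast
      moreover have "(x - u, y - v) \<in> G" using add_subgroupD(2)[OF Gs G2(1,3)] by simp
      ultimately have "x - u \<in> W" using GW by blast
      then show "X = Y" using presentsD(3)[OF q N2(1,2)] G2 by blast
    qed
    show "h ` carrier M = carrier M'"
    proof (intro equalityI subsetI)
      fix Y assume "Y \<in> h ` carrier M"
      then obtain X where "X \<in> carrier M" "Y = h X" by blast
      with ex[of X] obtain x y where "(x, y) \<in> G" "Y = h (q x)" by blast
      then have "(x, y) \<in> G" "Y = q' y" using h by simp_all
      then show "Y \<in> carrier M'" using GN presents_carrier(1)[OF q'] by blast
    next
      fix Y assume "Y \<in> carrier M'"
      then obtain y where y: "y \<in> N'" "Y = q' y" using presents_carrier(2)[OF q'] by blast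
      then obtain x where x: "(x, y) \<in> G" using iff full by force
      then have "x \<in> N" using GN by auto
      then show "Y \<in> h ` carrier M"
        using imageI[OF presents_carrier(1)[OF q], of x h] h[OF x] y by simp
    qed
  qed
  moreover have "h (X \<oplus>\<^bsub>M\<^esub> Y) = h X \<oplus>\<^bsub>M'\<^esub> h Y" if "X \<in> carrier M" "Y \<in> carrier M" for X Y
  proof -
    from ex[OF that(1)] ex[OF that(2)]
    obtain x y u v where G2: "(x, y) \<in> G" "X = q x" "(u, v) \<in> G" "Y = q u" by blast
    then have N2: "x \<in> N" "u \<in> N" "y \<in> N'" "v \<in> N'" using GN by auto
    have "(x + u, y + v) \<in> G" using add_subgroupD(4)[OF Gs G2(1,3)] by simp
    then show ?thesis
      using h[OF G2(1)] h[OF G2(3)] h[of "x + u" "y + v"] G2(2,4)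
      by (simp only: presentsD(2)[OF q N2(1,2), symmetric] presentsD(2)[OF q' N2(3,4), symmetric])
  qed
  moreover have "h (a \<odot>\<^bsub>M\<^esub> X) = a \<odot>\<^bsub>M'\<^esub> h X" if "X \<in> carrier M" for a X
  proof -
    from ex[OF that] obtain x y where G2: "(x, y) \<in> G" "X = q x" by blast
    then have N2: "x \<in> N" "y \<in> N'" using GN by auto
    show ?thesis
    proof (cases "a = 0")
      case True
      then show ?thesis
        unfolding G2(2) h[OF G2(1)] by (simp only: presentsD(4)[OF q N2(1)] presentsD(4)[OF q' N2(2)] h[OF z0])
    next
      case False
      then have "a = 1" by simp
      then show ?thesis
        unfolding G2(2) h[OF G2(1)] by (simp only: presentsD(5)[OF q N2(1)] presentsD(5)[OF q' N2(2)] h[OF G2(1)])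
    qed
  qed
  ultimately show ?thesis unfolding linearly_isomorphic_def by (intro exI[of _ h] conjI ballI allI)
qed

section \<open>Chains\<close>

definition supported :: "'a set \<Rightarrow> ('a \<Rightarrow> bit) set" where
  "supported A = {f. \<forall>g. f g \<noteq> 0 \<longrightarrow> g \<in> A}"

lemma supported_iff: "f \<in> supported A \<longleftrightarrow> (\<forall>g. g \<notin> A \<longrightarrow> f g = 0)"
  unfolding supported_def by blast

lemma supportedD: "f \<in> supported A \<Longrightarrow> g \<notin> A \<Longrightarrow> f g = 0"
  by (simp add: supported_iff)

lemma add_subgroup_supported: "add_subgroup (supported A)"
  by (simp add: add_subgroup_def supported_iff)

lemma supported_mono: "A \<subseteq> B \<Longrightarrow> supported A \<subseteq> supported B"
  unfolding supported_def by blast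

lemma finite_supported:
  assumes "finite A"
  shows "finite (supported A)"
proof (rule finite_subset)
  show "supported A \<subseteq> (\<lambda>B g. of_bool (g \<in> B)) ` Pow A"
  proof
    fix f assume f: "f \<in> supported A"
    have "f = (\<lambda>g. of_bool (g \<in> {g \<in> A. f g = 1}))"
    proof
      fix g show "f g = of_bool (g \<in> {g \<in> A. f g = 1})"
        using f by (cases "f g = 0") (auto simp: supported_iff)
    qed
    then show "f \<in> (\<lambda>B g. of_bool (g \<in> B)) ` Pow A" by (rule image_eqI) auto
  qed
qed (use assms in simp)

lemma sum_supported_subset:
  fixes c :: "'a \<Rightarrow> bit"
  assumes "finite B" "A \<subseteq> B" "f \<in> supported A"
  shows "(\<Sum>g\<in>B. c g * f g) = (\<Sum>g\<in>A. c g * f g)"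
  using assms by (intro sum.mono_neutral_right) (auto simp: supported_iff)

text \<open>
  The standard bilinear form, after the identification of the two bases by \<open>\<phi>\<close>.
\<close>

definition transport_pair :: "'b set \<Rightarrow> ('b \<Rightarrow> 'a) \<Rightarrow> ('b \<Rightarrow> bit) \<Rightarrow> ('a \<Rightarrow> bit) \<Rightarrow> bit" where
  "transport_pair B \<phi> f x = (\<Sum>g\<in>B. f g * x (\<phi> g))"

lemma perfect_pairing_supported:
  assumes bij: "bij_betw \<phi> B A" and fin: "finite A"
  shows "perfect_pairing (supported A) (supported B) (transport_pair B \<phi>)"
proof
  have finB: "finite B" using bij fin bij_betw_finite by blast
  show "finite (supported A)" "finite (supported B)"
    by (simp_all add: finite_supported fin finB)
  show "add_subgroup (supported A)" "add_subgroup (supported B)"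
    by (rule add_subgroup_supported)+
  show "transport_pair B \<phi> f (x + y) = transport_pair B \<phi> f x + transport_pair B \<phi> f y" for f x y
    by (simp add: transport_pair_def distrib_left sum.distrib)
  show "transport_pair B \<phi> (f + g) x = transport_pair B \<phi> f x + transport_pair B \<phi> g x" for f g x
    by (simp add: transport_pair_def distrib_right sum.distrib)
  have delta: "transport_pair B \<phi> (\<lambda>g. of_bool (g = b)) x = x (\<phi> b)" if "b \<in> B" for b x
  proof -
    have "transport_pair B \<phi> (\<lambda>g. of_bool (g = b)) x = (\<Sum>g\<in>B. if g = b then x (\<phi> g) else 0)"
      unfolding transport_pair_def by (rule sum.cong) auto
    then show ?thesis using that finB by simp
  qed
  show "\<exists>f\<in>supported B. transport_pair B \<phi> f x \<noteq> 0" if x: "x \<in> supported A" "x \<noteq> 0" for x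
  proof -
    obtain a where "x a \<noteq> 0" using x(2) by (auto simp: fun_eq_iff)
    then have "a \<in> A" using x(1) unfolding supported_iff by blast
    then have "a \<in> \<phi> ` B" using bij by (simp add: bij_betw_def)
    then obtain b where b: "b \<in> B" "a = \<phi> b" by blast
    have "(\<lambda>g. of_bool (g = b)) \<in> supported B" using b by (auto simp: supported_iff)
    moreover have "transport_pair B \<phi> (\<lambda>g. of_bool (g = b)) x \<noteq> 0"
      unfolding delta[OF b(1)] using \<open>x a \<noteq> 0\<close> b(2) by simp
    ultimately show ?thesis by (intro bexI)
  qed
  show "\<exists>x\<in>supported A. transport_pair B \<phi> f x \<noteq> 0" if f: "f \<in> supported B" "f \<noteq> 0" for f
  proof -
    obtain b where "f b \<noteq> 0" using f(2) by (auto simp: fun_eq_iff)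
    then have b: "b \<in> B" using f(1) unfolding supported_iff by blast
    have "transport_pair B \<phi> f (\<lambda>a. of_bool (a = \<phi> b)) = (\<Sum>g\<in>B. if g = b then f g else 0)"
      unfolding transport_pair_def
      by (rule sum.cong) (use bij b in \<open>auto simp: bij_betw_def inj_on_def\<close>)
    then have "transport_pair B \<phi> f (\<lambda>a. of_bool (a = \<phi> b)) \<noteq> 0"
      using b finB \<open>f b \<noteq> 0\<close> by simp
    moreover have "(\<lambda>a. of_bool (a = \<phi> b)) \<in> supported A"
      using bij b by (auto simp: supported_iff bij_betw_def)
    ultimately show ?thesis by (rule bexI)
  qed
qed

lemma perp_supported:
  assumes bij: "bij_betw \<phi> B A" and fin: "finite A" and "A1 \<subseteq> A"
  shows "perfect_pairing.perp (supported B) (transport_pair B \<phi>) (supported A1) = supported {b \<in> B. \<phi> b \<notin> A1}"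
proof -
  interpret perfect_pairing "supported A" "supported B" "transport_pair B \<phi>"
    by (rule perfect_pairing_supported[OF bij fin])
  have finB: "finite B" using bij fin bij_betw_finite by blast
  show ?thesis
  proof (intro equalityI subsetI)
    fix f assume f: "f \<in> perp (supported A1)"
    show "f \<in> supported {b \<in> B. \<phi> b \<notin> A1}"
      unfolding supported_iff
    proof (intro allI impI)
      fix b assume b: "b \<notin> {b \<in> B. \<phi> b \<notin> A1}"
      show "f b = 0"
      proof (cases "b \<in> B")
        case True
        have "transport_pair B \<phi> f (\<lambda>a. of_bool (a = \<phi> b)) = (\<Sum>g\<in>B. if g = b then f g else 0)"
          unfolding transport_pair_def
          by (rule sum.cong) (use bij True in \<open>auto simp: bij_betw_def inj_on_def\<close>)
        also have "\<dots> = f b" using True finB by simp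
        finally have "transport_pair B \<phi> f (\<lambda>a. of_bool (a = \<phi> b)) = f b" .
        moreover have "(\<lambda>a. of_bool (a = \<phi> b)) \<in> supported A1"
          using b True by (auto simp: supported_iff)
        ultimately show ?thesis using f unfolding perp_def by auto
      next
        case False
        then show ?thesis using f by (simp add: perp_def supported_iff)
      qed
    qed
  next
    fix f assume f: "f \<in> supported {b \<in> B. \<phi> b \<notin> A1}"
    have "transport_pair B \<phi> f x = 0" if "x \<in> supported A1" for x
      unfolding transport_pair_def
    proof (rule sum.neutral, rule ballI)
      fix g assume "g \<in> B"
      then show "f g * x (\<phi> g) = 0"
        using f that by (cases "\<phi> g \<in> A1") (simp_all add: supported_iff)
    qed
    moreover have "f \<in> supported B" using f by (simp add: supported_iff)
    ultimately show "f \<in> perp (supported A1)" by (simp add: perp_def)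
  qed
qed

lemma cochains_eq: "cochains D j = supported {g \<in> gens D. deg_j D g = j}"
  by (auto simp: cochains_def supported_def)

lemma filt_F_eq: "filt_F D j i = supported {g \<in> gens D. deg_j D g = j \<and> deg_i D g \<le> i}"
  by (auto simp: filt_F_def cochains_def supported_def)

lemma filt_G_eq: "filt_G \<nu> D j k = supported {g \<in> gens D. deg_j D g = j \<and> weight \<nu> D (fst g) \<ge> k}"
  by (auto simp: filt_G_def cochains_def supported_def)

section \<open>Presentation of graded pieces\<close>

lemma presents_chain_module:
  assumes "add_subgroup Z"
  shows "presents id Z {0} (chain_module Z)"
  using add_subgroupD(1)[OF assms]
  unfolding presents_def
proof (intro conjI ballI)
  show "(id x = id y) = (x - y \<in> {0})" for x y :: chain by simp
qed (simp_all add: chain_module_def plus_fun_def zero_fun_def)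

context
  fixes \<nu> :: "real^3" and D :: diagram and j :: int
  assumes Z: "add_subgroup (cocycles \<nu> D j)" and B: "add_subgroup (coboundaries \<nu> D j)"
    and BZ: "coboundaries \<nu> D j \<subseteq> cocycles \<nu> D j"
begin

definition filt :: "chain set \<Rightarrow> chain set" where
  "filt S = (S \<inter> cocycles \<nu> D j) \<oplus>\<^sub>s coboundaries \<nu> D j"

lemma filt_subset: "filt S \<subseteq> cocycles \<nu> D j"
  unfolding filt_def by (rule sum_set_least[OF Z _ BZ]) simp

lemma coboundaries_subset_filt:
  assumes "0 \<in> S"
  shows "coboundaries \<nu> D j \<subseteq> filt S"
proof
  fix b assume "b \<in> coboundaries \<nu> D j"
  then have "0 + b \<in> filt S" unfolding filt_def
    using assms add_subgroupD(1)[OF Z] by (intro sum_setI) simp_all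
  then show "b \<in> filt S" by simp
qed

lemma add_subgroup_filt: "add_subgroup S \<Longrightarrow> add_subgroup (filt S)"
  unfolding filt_def by (intro add_subgroup_sum_set add_subgroup_Int Z B)

lemma filt_mono: "S \<subseteq> S' \<Longrightarrow> filt S \<subseteq> filt S'"
  unfolding filt_def by (rule sum_set_mono) auto

definition cls :: "chain \<Rightarrow> chain set" where
  "cls x = coboundaries \<nu> D j +>\<^bsub>chain_module (cocycles \<nu> D j)\<^esub> x"

lemma cls_eq: "cls x = (\<lambda>b. b + x) ` coboundaries \<nu> D j"
  by (auto simp: cls_def a_r_coset_def' chain_module_def plus_fun_def)

lemma presents_H_tau: "presents cls (cocycles \<nu> D j) (coboundaries \<nu> D j) (H_tau \<nu> D j)"
  using presents_quotient[OF presents_chain_module[OF Z] Z B _ BZ] add_subgroupD(1)[OF B]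
  by (simp add: H_tau_def cls_def[abs_def])

text \<open>
  A class lies in the step induced by \<open>S\<close> iff one, equivalently each, of its representatives differs by a
  coboundary from a cocycle in \<open>S\<close>.
\<close>

lemma induced_eq: "induced \<nu> D j S = cls ` filt S"
proof (intro equalityI subsetI)
  fix X assume "X \<in> induced \<nu> D j S"
  then have X: "X \<in> carrier (H_tau \<nu> D j)" "X \<inter> S \<noteq> {}" by (auto simp: induced_def)
  obtain z where z: "z \<in> cocycles \<nu> D j" "cls z = X"
    using presents_carrier(2)[OF presents_H_tau X(1)] by blast
  obtain b where b: "b \<in> coboundaries \<nu> D j" "b + z \<in> S"
    using X(2) unfolding z(2)[symmetric] cls_eq by blast
  have "b + z \<in> cocycles \<nu> D j" using add_subgroupD(4)[OF Z] b z BZ by blast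
  then have "(b + z) + (- b) \<in> filt S"
    unfolding filt_def using b add_subgroupD(3)[OF B b(1)] by (intro sum_setI) simp_all
  then have "z \<in> filt S" by simp
  then show "X \<in> cls ` filt S" using z(2) by blast
next
  fix X assume "X \<in> cls ` filt S"
  then obtain z where z: "z \<in> filt S" "X = cls z" by blast
  then obtain s b where s: "s \<in> S" "s \<in> cocycles \<nu> D j" "b \<in> coboundaries \<nu> D j" "z = s + b"
    unfolding filt_def by (blast elim: sum_setE)
  have "- b + z \<in> cls z" unfolding cls_eq using add_subgroupD(3)[OF B s(3)] by (rule imageI)
  then have "s \<in> X" using s(4) z(2) by simp
  moreover have "X \<in> carrier (H_tau \<nu> D j)"
    unfolding z(2) by (rule presents_carrier(1)[OF presents_H_tau]) (use z(1) filt_subset in blast)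
  ultimately show "X \<in> induced \<nu> D j S" using s(1) by (auto simp: induced_def)
qed

lemma induced_Int:
  assumes "add_subgroup S" "add_subgroup T"
  shows "induced \<nu> D j S \<inter> induced \<nu> D j T = cls ` (filt S \<inter> filt T)"
proof (intro equalityI subsetI)
  fix X assume "X \<in> induced \<nu> D j S \<inter> induced \<nu> D j T"
  then obtain s t where st: "s \<in> filt S" "t \<in> filt T" "X = cls s" "X = cls t"
    unfolding induced_eq by blast
  have "s \<in> cocycles \<nu> D j" "t \<in> cocycles \<nu> D j" using st filt_subset by blast+
  then have "s - t \<in> coboundaries \<nu> D j"
    using presentsD(3)[OF presents_H_tau, of s t] st by simp
  then have "s - t \<in> filt T"
    using coboundaries_subset_filt[OF add_subgroupD(1)[OF assms(2)]] by blast
  then have "(s - t) + t \<in> filt T"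
    using add_subgroupD(4)[OF add_subgroup_filt[OF assms(2)]] st(2) by blast
  then show "X \<in> cls ` (filt S \<inter> filt T)" using st by simp
qed (auto simp: induced_eq)

lemma presents_Kh_tau:
  "\<exists>q. presents q (filt (filt_F D j i) \<inter> filt (filt_G \<nu> D j k))
     ((filt (filt_F D j i) \<inter> filt (filt_G \<nu> D j (k + 1/2))) \<oplus>\<^sub>s (filt (filt_F D j (i - 1)) \<inter> filt (filt_G \<nu> D j k)))
     (Kh_tau \<nu> D i j k)"
proof -
  let ?F = "\<lambda>i. filt (filt_F D j i)" and ?G = "\<lambda>k. filt (filt_G \<nu> D j k)"
  let ?N = "?F i \<inter> ?G k" and ?K = "(?F i \<inter> ?G (k + 1/2)) \<oplus>\<^sub>s (?F (i - 1) \<inter> ?G k)"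
  have F: "add_subgroup (filt_F D j i)" for i unfolding filt_F_eq by (rule add_subgroup_supported)
  have G: "add_subgroup (filt_G \<nu> D j k)" for k unfolding filt_G_eq by (rule add_subgroup_supported)
  have FG: "add_subgroup (?F i \<inter> ?G k)" for i k by (intro add_subgroup_Int add_subgroup_filt F G)
  have le: "?F (i - 1) \<subseteq> ?F i" "?G (k + 1/2) \<subseteq> ?G k"
    unfolding filt_F_eq filt_G_eq by (intro filt_mono supported_mono; auto)+
  have N: "?F i \<inter> ?G k \<subseteq> cocycles \<nu> D j" for i k using filt_subset by blast
  have K: "?K \<subseteq> ?N" by (rule sum_set_least[OF FG]) (use le in blast)+
  have "coboundaries \<nu> D j \<subseteq> ?F i \<inter> ?G (k + 1/2)"
    using coboundaries_subset_filt add_subgroupD(1)[OF F] add_subgroupD(1)[OF G] by blast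
  then have BK: "coboundaries \<nu> D j \<subseteq> ?K"
    using sum_set_superset(1)[OF FG FG] by blast
  have add: "X <+>\<^bsub>H_tau \<nu> D j\<lparr>carrier := C\<rparr>\<^esub> Y = X <+>\<^bsub>H_tau \<nu> D j\<^esub> Y" for C X Y
    by (simp add: set_add_def')
  have "Kh_tau \<nu> D i j k = quotient_module (H_tau \<nu> D j\<lparr>carrier := cls ` ?N\<rparr>) (cls ` ?K)"
    unfolding Kh_tau_def Let_def induced_Int[OF F G] set_add_image[OF presents_H_tau N N] ..
  moreover have "presents (\<lambda>x. (cls ` ?K) +>\<^bsub>H_tau \<nu> D j\<lparr>carrier := cls ` ?N\<rparr>\<^esub> cls x) ?N ?K
      (quotient_module (H_tau \<nu> D j\<lparr>carrier := cls ` ?N\<rparr>) (cls ` ?K))"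
    by (rule presents_quotient[OF presents_restrict[OF presents_H_tau N] FG add_subgroup_sum_set[OF FG FG] BK K])
  ultimately show ?thesis by metis
qed

end

section \<open>Duality\<close>

text \<open>
  The matrix of \<open>\<partial> = d + id + \<tau>\<close>.  When \<open>\<tau>\<close> fixes \<open>g\<close>, the last two summands cancel.
\<close>

definition total_entry :: "real^3 \<Rightarrow> diagram \<Rightarrow> gen \<Rightarrow> gen \<Rightarrow> bit" where
  "total_entry \<nu> D g h = of_bool (khovanov_edge D g h) + of_bool (h = g) + of_bool (h = tau_gen \<nu> g)"

lemma total_d_supported:
  assumes fin: "finite (gens D)" and f: "f \<in> supported (gens D)"
  shows "total_d \<nu> D f h = (if h \<in> gens D then \<Sum>g\<in>gens D. total_entry \<nu> D g h * f g else 0)"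
proof (cases "h \<in> gens D")
  case True
  have "(\<Sum>g\<in>gens D. of_bool (h = g) * f g) = (\<Sum>g\<in>gens D. if g = h then f g else 0)"
    by (rule sum.cong) auto
  then have "(\<Sum>g\<in>gens D. of_bool (h = g) * f g) = f h" using True fin by simp
  then show ?thesis
    using True
    by (simp add: total_d_def d_tau_def khovanov_d_def tau_chain_def linear_extension_def total_entry_def
        distrib_right sum.distrib add.assoc)
next
  case False
  then have "f h = 0" by (rule supportedD[OF f])
  with False show ?thesis
    by (simp add: total_d_def d_tau_def khovanov_d_def tau_chain_def linear_extension_def)
qed

lemma total_d_add:
  "total_d \<nu> D (f + g) = total_d \<nu> D f + total_d \<nu> D g"
  by (auto simp: fun_eq_iff total_d_def d_tau_def khovanov_d_def tau_chain_def linear_extension_def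
      distrib_left sum.distrib add_ac)

text \<open>
  The assumptions say that \<open>\<phi>\<close> identifies the complex of \<open>D'\<close> with the transpose of that of \<open>D\<close> and
  negates the three gradings.  The annihilator of \<open>F\<close> at \<open>i\<close> is \<open>F\<close> at \<open>- i - 1\<close>, and that of \<open>G\<close> at \<open>k\<close> is \<open>G\<close> at
  \<open>1/2 - k\<close>, so that the graded piece of \<open>D'\<close> at \<open>(i, k)\<close> is the graded piece of annihilator filtrations
  for \<open>F = F\<^sub>-\<^sub>i\<close>, \<open>F1 = F\<^sub>-\<^sub>i\<^sub>-\<^sub>1\<close>, \<open>G = G\<^sub>-\<^sub>k\<close> and \<open>G1\<close> the next step of \<open>G\<close>.
\<close>

lemma Kh_tau_dual_isomorphic:
  fixes \<nu> :: "real^3" and D D' :: diagram and \<phi> :: "gen \<Rightarrow> gen"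
  assumes fin: "finite (gens D)"
    and bij: "bij_betw \<phi> (gens D') (gens D)"
    and deg_i: "\<And>g. g \<in> gens D' \<Longrightarrow> deg_i D (\<phi> g) = - deg_i D' g"
    and deg_j: "\<And>g. g \<in> gens D' \<Longrightarrow> deg_j D (\<phi> g) = - deg_j D' g"
    and weight: "\<And>g. g \<in> gens D' \<Longrightarrow> weight \<nu> D (fst (\<phi> g)) = - weight \<nu> D' (fst g)"
    and half: "\<And>g. g \<in> gens D' \<Longrightarrow> 2 * weight \<nu> D' (fst g) \<in> \<int>"
    and edge: "\<And>g h. g \<in> gens D' \<Longrightarrow> h \<in> gens D' \<Longrightarrow>
                 khovanov_edge D' g h \<longleftrightarrow> khovanov_edge D (\<phi> h) (\<phi> g)"
    and tau: "\<And>g. g \<in> gens D' \<Longrightarrow> \<phi> (tau_gen \<nu> g) = tau_gen \<nu> (\<phi> g)"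
    and tau_in: "\<And>g. g \<in> gens D' \<Longrightarrow> tau_gen \<nu> g \<in> gens D'"
    and tau_tau: "\<And>g. tau_gen \<nu> (tau_gen \<nu> g) = g"
    and edge_deg: "\<And>g h. g \<in> gens D \<Longrightarrow> h \<in> gens D \<Longrightarrow> khovanov_edge D g h \<Longrightarrow> deg_j D h = deg_j D g"
    and tau_deg: "\<And>g. g \<in> gens D \<Longrightarrow> deg_j D (tau_gen \<nu> g) = deg_j D g"
    and d_d: "\<And>f. f \<in> supported (gens D) \<Longrightarrow> total_d \<nu> D (total_d \<nu> D f) = 0"
    and k: "2 * k \<in> \<int>"
  shows "linearly_isomorphic (Kh_tau \<nu> D' i j k) (Kh_tau \<nu> D (- i) (- j) (- k))"
proof -
  define A where "A = {g \<in> gens D. deg_j D g = - j}"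
  define B where "B = {g \<in> gens D'. deg_j D' g = j}"
  have finA: "finite A" using fin by (simp add: A_def)
  have fin': "finite (gens D')" using bij fin bij_betw_finite by blast
  have phi_in: "\<phi> g \<in> gens D" if "g \<in> gens D'" for g using bij that by (auto simp: bij_betw_def)
  have inj: "\<phi> g = \<phi> h \<longleftrightarrow> g = h" if "g \<in> gens D'" "h \<in> gens D'" for g h
    using bij that by (auto simp: bij_betw_def inj_on_def)
  have onto: "\<exists>g. g \<in> gens D' \<and> \<phi> g = h" if "h \<in> gens D" for h
  proof -
    have "h \<in> \<phi> ` gens D'" using bij that by (simp add: bij_betw_def)
    then show ?thesis by blast
  qed
  have entry: "total_entry \<nu> D' g h = total_entry \<nu> D (\<phi> h) (\<phi> g)"
    if gh: "g \<in> gens D'" "h \<in> gens D'" for g h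
  proof -
    have "\<phi> g = tau_gen \<nu> (\<phi> h) \<longleftrightarrow> g = tau_gen \<nu> h"
      using inj[OF gh(1) tau_in[OF gh(2)]] tau[OF gh(2)] by simp
    also have "\<dots> \<longleftrightarrow> h = tau_gen \<nu> g" by (metis tau_tau)
    finally show ?thesis
      using edge[OF gh] inj[OF gh] by (auto simp: total_entry_def)
  qed
  have entry_deg: "deg_j D h = deg_j D g" if "total_entry \<nu> D g h \<noteq> 0" "g \<in> gens D" "h \<in> gens D" for g h
  proof -
    have "khovanov_edge D g h \<or> h = g \<or> h = tau_gen \<nu> g"
      using that(1) by (auto simp: total_entry_def)
    then show ?thesis using edge_deg[OF that(2,3)] tau_deg[OF that(2)] by metis
  qed
  have entry_deg': "deg_j D' h = deg_j D' g" if "total_entry \<nu> D' g h \<noteq> 0" "g \<in> gens D'" "h \<in> gens D'" for g h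
    using entry_deg[of "\<phi> h" "\<phi> g"] that entry[OF that(2,3)] phi_in deg_j by simp
  have AB: "bij_betw \<phi> B A"
    unfolding bij_betw_def
  proof
    show "inj_on \<phi> B" using inj by (auto simp: inj_on_def B_def)
    show "\<phi> ` B = A"
    proof (intro equalityI subsetI)
      fix h assume "h \<in> A"
      then obtain g where "g \<in> gens D'" "\<phi> g = h" "deg_j D h = - j" using onto[of h] by (auto simp: A_def)
      then show "h \<in> \<phi> ` B" using deg_j[of g] by (auto simp: B_def)
    qed (use phi_in deg_j in \<open>auto simp: A_def B_def\<close>)
  qed
  have cA: "cochains D (- j) = supported A" and cB: "cochains D' j = supported B"
    by (simp_all add: cochains_eq A_def B_def)
  have sA: "supported A \<subseteq> supported (gens D)" and sB: "supported B \<subseteq> supported (gens D')"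
    by (intro supported_mono; auto simp: A_def B_def)+
  have closedA: "total_d \<nu> D x \<in> supported A" if x: "x \<in> supported A" for x
    unfolding supported_iff
  proof (intro allI impI)
    fix h assume h: "h \<notin> A"
    show "total_d \<nu> D x h = 0"
    proof (cases "h \<in> gens D")
      case True
      have "total_entry \<nu> D g h * x g = 0" if g: "g \<in> gens D" for g
      proof (cases "g \<in> A")
        case False
        then show ?thesis using supportedD[OF x False] by simp
      next
        case 2: True
        have "total_entry \<nu> D g h = 0"
        proof (rule ccontr)
          assume "total_entry \<nu> D g h \<noteq> 0"
          then have "deg_j D h = deg_j D g" by (rule entry_deg[OF _ g True])
          then show False using 2 h True by (simp add: A_def)
        qed
        then show ?thesis by simp
      qed
      then have "(\<Sum>g\<in>gens D. total_entry \<nu> D g h * x g) = 0" by (intro sum.neutral) blast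
      then show ?thesis using total_d_supported[OF fin subsetD[OF sA x], of \<nu> h] True by simp
    next
      case False
      then show ?thesis using total_d_supported[OF fin subsetD[OF sA x], of \<nu> h] by simp
    qed
  qed
  have closedB: "total_d \<nu> D' x \<in> supported B" if x: "x \<in> supported B" for x
    unfolding supported_iff
  proof (intro allI impI)
    fix h assume h: "h \<notin> B"
    show "total_d \<nu> D' x h = 0"
    proof (cases "h \<in> gens D'")
      case True
      have "total_entry \<nu> D' g h * x g = 0" if g: "g \<in> gens D'" for g
      proof (cases "g \<in> B")
        case False
        then show ?thesis using supportedD[OF x False] by simp
      next
        case 2: True
        have "total_entry \<nu> D' g h = 0"
        proof (rule ccontr)
          assume "total_entry \<nu> D' g h \<noteq> 0"
          then have "deg_j D' h = deg_j D' g" by (rule entry_deg'[OF _ g True])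
          then show False using 2 h True by (simp add: B_def)
        qed
        then show ?thesis by simp
      qed
      then have "(\<Sum>g\<in>gens D'. total_entry \<nu> D' g h * x g) = 0" by (intro sum.neutral) blast
      then show ?thesis using total_d_supported[OF fin' subsetD[OF sB x], of \<nu> h] True by simp
    next
      case False
      then show ?thesis using total_d_supported[OF fin' subsetD[OF sB x], of \<nu> h] by simp
    qed
  qed
  interpret perfect_pairing "supported A" "supported B" "transport_pair B \<phi>"
    by (rule perfect_pairing_supported[OF AB finA])
  have adj: "transport_pair B \<phi> (total_d \<nu> D' f) x = transport_pair B \<phi> f (total_d \<nu> D x)"
    if f: "f \<in> supported B" and x: "x \<in> supported A" for f x
  proof -
    have "transport_pair B \<phi> (total_d \<nu> D' f) x = (\<Sum>h\<in>B. (\<Sum>g\<in>B. total_entry \<nu> D' g h * f g) * x (\<phi> h))"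
      unfolding transport_pair_def
    proof (rule sum.cong[OF refl])
      fix h assume "h \<in> B"
      then have "total_d \<nu> D' f h = (\<Sum>g\<in>gens D'. total_entry \<nu> D' g h * f g)"
        using total_d_supported[OF fin', of f \<nu> h] f sB by (auto simp: B_def)
      also have "\<dots> = (\<Sum>g\<in>B. total_entry \<nu> D' g h * f g)"
        by (rule sum_supported_subset[OF fin' _ f]) (auto simp: B_def)
      finally show "total_d \<nu> D' f h * x (\<phi> h) = (\<Sum>g\<in>B. total_entry \<nu> D' g h * f g) * x (\<phi> h)" by simp
    qed
    also have "\<dots> = (\<Sum>h\<in>B. \<Sum>g\<in>B. f g * (total_entry \<nu> D (\<phi> h) (\<phi> g) * x (\<phi> h)))"
      unfolding sum_distrib_right
      by (intro sum.cong refl) (simp add: entry B_def mult_ac)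
    also have "\<dots> = (\<Sum>g\<in>B. \<Sum>h\<in>B. f g * (total_entry \<nu> D (\<phi> h) (\<phi> g) * x (\<phi> h)))"
      by (rule sum.swap)
    also have "\<dots> = (\<Sum>g\<in>B. f g * (\<Sum>h\<in>B. total_entry \<nu> D (\<phi> h) (\<phi> g) * x (\<phi> h)))"
      by (simp add: sum_distrib_left)
    also have "\<dots> = transport_pair B \<phi> f (total_d \<nu> D x)"
      unfolding transport_pair_def
    proof (rule sum.cong[OF refl])
      fix g assume "g \<in> B"
      then have "\<phi> g \<in> gens D" using phi_in by (auto simp: B_def)
      then have "total_d \<nu> D x (\<phi> g) = (\<Sum>h\<in>gens D. total_entry \<nu> D h (\<phi> g) * x h)"
        using total_d_supported[OF fin, of x \<nu> "\<phi> g"] x sA by auto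
      also have "\<dots> = (\<Sum>h\<in>A. total_entry \<nu> D h (\<phi> g) * x h)"
        by (rule sum_supported_subset[OF fin _ x]) (auto simp: A_def)
      also have "\<dots> = (\<Sum>h\<in>B. total_entry \<nu> D (\<phi> h) (\<phi> g) * x (\<phi> h))"
        using sum.reindex_bij_betw[OF AB, of "\<lambda>h. total_entry \<nu> D h (\<phi> g) * x h"] by simp
      finally show "f g * (\<Sum>h\<in>B. total_entry \<nu> D (\<phi> h) (\<phi> g) * x (\<phi> h)) = f g * total_d \<nu> D x (\<phi> g)"
        by simp
    qed
    finally show ?thesis .
  qed
  interpret dual_complexes "supported A" "supported B" "transport_pair B \<phi>" "total_d \<nu> D" "total_d \<nu> D'"
    by unfold_locales (use closedA closedB adj d_d sA in \<open>auto simp: total_d_add\<close>)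
  have cyc_eq: "cyc = cocycles \<nu> D (- j)" "cyc' = cocycles \<nu> D' j"
    "bdr = coboundaries \<nu> D (- j)" "bdr' = coboundaries \<nu> D' j"
    by (simp_all add: cyc_def cyc'_def bdr_def bdr'_def cocycles_def coboundaries_def cA cB zero_fun_def)
  have bdr'_cyc': "bdr' \<subseteq> cyc'"
    using perp_antimono[OF bdr_subset_cyc] by (simp add: perp_bdr perp_cyc)
  note sub = add_subgroup_cyc(1)[unfolded cyc_eq] add_subgroup_bdr(1)[unfolded cyc_eq] bdr_subset_cyc[unfolded cyc_eq]
  note sub' = add_subgroup_cyc'(1)[unfolded cyc_eq] add_subgroup_bdr'(1)[unfolded cyc_eq] bdr'_cyc'[unfolded cyc_eq]
  have filt: "filt \<nu> D (- j) S = filtered S" "filt \<nu> D' j S' = filtered' S'" for S S'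
    by (simp_all add: filt_def[OF sub] filt_def[OF sub'] filtered_def filtered'_def cyc_eq)
  let ?F = "\<lambda>i. filtered (filt_F D (- j) i)" and ?G = "\<lambda>k. filtered (filt_G \<nu> D (- j) k)"
  let ?F' = "\<lambda>i. filtered' (filt_F D' j i)" and ?G' = "\<lambda>k. filtered' (filt_G \<nu> D' j k)"
  have subF: "add_subgroup (filt_F D (- j) i)" "filt_F D (- j) i \<subseteq> supported A" for i
    unfolding filt_F_eq A_def by (rule add_subgroup_supported, rule supported_mono, auto)
  have subG: "add_subgroup (filt_G \<nu> D (- j) k)" "filt_G \<nu> D (- j) k \<subseteq> supported A" for k
    unfolding filt_G_eq A_def by (rule add_subgroup_supported, rule supported_mono, auto)
  have perpF: "perp (?F i) = ?F' (- i - 1)" for i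
  proof -
    have "perp (filt_F D (- j) i) = filt_F D' j (- i - 1)"
      unfolding filt_F_eq
      by (subst perp_supported[OF AB finA])
         (auto simp: A_def B_def deg_i deg_j phi_in intro!: arg_cong[of _ _ supported])
    then show ?thesis by (simp add: perp_filtered[OF subF])
  qed
  have perpG: "perp (?G k) = ?G' (1/2 - k)" if "2 * k \<in> \<int>" for k
  proof -
    \<comment> \<open>Half-integers that are larger than \<open>- k\<close> are at least \<open>1/2 - k\<close>.\<close>
    have half_step: "\<not> k \<le> - w \<longleftrightarrow> 1/2 - k \<le> w" if "2 * w \<in> \<int>" for w :: rat
    proof -
      obtain m n :: int where mn: "2 * w = of_int m" "2 * k = of_int n"
        using \<open>2 * w \<in> \<int>\<close> \<open>2 * k \<in> \<int>\<close> by (auto elim!: Ints_cases)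
      have "\<not> k \<le> - w \<longleftrightarrow> - (2 * w) < 2 * k" by linarith
      also have "\<dots> \<longleftrightarrow> - m < n" unfolding mn by (simp flip: of_int_minus)
      also have "\<dots> \<longleftrightarrow> 1 - n \<le> m" by linarith
      also have "\<dots> \<longleftrightarrow> (of_int (1 - n) :: rat) \<le> of_int m" by (simp only: of_int_le_iff)
      also have "\<dots> \<longleftrightarrow> 1/2 - k \<le> w" using mn by simp linarith
      finally show ?thesis .
    qed
    have "perp (filt_G \<nu> D (- j) k) = filt_G \<nu> D' j (1/2 - k)"
      unfolding filt_G_eq
      by (subst perp_supported[OF AB finA])
         (use weight deg_j phi_in half_step[OF half] in \<open>auto simp: A_def B_def simp del: split_paired_All intro!: arg_cong[of _ _ supported]\<close>)
    then show ?thesis by (simp add: perp_filtered[OF subG])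
  qed
  have k2: "2 * (- k) \<in> \<int>" "2 * (- k + 1/2) \<in> \<int>"
    using k by (simp_all add: distrib_left)
  obtain q where q: "presents q (?F (- i) \<inter> ?G (- k)) ((?F (- i) \<inter> ?G (- k + 1/2)) \<oplus>\<^sub>s (?F (- i - 1) \<inter> ?G (- k)))
     (Kh_tau \<nu> D (- i) (- j) (- k))"
    using presents_Kh_tau[OF sub, of "- i" "- k"] unfolding filt by blast
  obtain q' where q': "presents q' (?F' i \<inter> ?G' k) ((?F' i \<inter> ?G' (k + 1/2)) \<oplus>\<^sub>s (?F' (i - 1) \<inter> ?G' k))
     (Kh_tau \<nu> D' i j k)"
    using presents_Kh_tau[OF sub', of i k] unfolding filt by blast
  have dict: "?F' i = perp (?F (- i - 1))" "?F' (i - 1) = perp (?F (- i))"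
      "?G' k = perp (?G (- k + 1/2))" "?G' (k + 1/2) = perp (?G (- k))"
    using perpF[of "- i - 1"] perpF[of "- i"] perpG[OF k2(1)] perpG[OF k2(2)] by (simp_all add: add.commute)
  note fsub = add_subgroup_filtered[OF subF(1)] add_subgroup_filtered[OF subG(1)]
  have le: "?F (- i - 1) \<subseteq> ?F (- i)" "?G (- k + 1/2) \<subseteq> ?G (- k)"
    unfolding filtered_def filt_F_eq filt_G_eq
    by (intro sum_set_mono Int_mono supported_mono order_refl; auto)+
  have index: "card (?F' i \<inter> ?G' k) * card ((?F (- i) \<inter> ?G (- k + 1/2)) \<oplus>\<^sub>s (?F (- i - 1) \<inter> ?G (- k)))
      = card (?F (- i) \<inter> ?G (- k)) * card ((?F' i \<inter> ?G' (k + 1/2)) \<oplus>\<^sub>s (?F' (i - 1) \<inter> ?G' k))"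
    unfolding dict
    by (rule card_graded_piece_perp) (rule fsub le)+
  show ?thesis
  proof (rule linearly_isomorphic_if_same_index[OF q' q _ _ _ _ _ _ _ _ index])
    show "add_subgroup (?F (- i) \<inter> ?G (- k))"
      by (intro add_subgroup_Int fsub)
    show "add_subgroup ((?F (- i) \<inter> ?G (- k + 1/2)) \<oplus>\<^sub>s (?F (- i - 1) \<inter> ?G (- k)))"
      by (intro add_subgroup_sum_set add_subgroup_Int fsub)
    show "(?F (- i) \<inter> ?G (- k + 1/2)) \<oplus>\<^sub>s (?F (- i - 1) \<inter> ?G (- k)) \<subseteq> ?F (- i) \<inter> ?G (- k)"
      by (intro sum_set_least add_subgroup_Int fsub) (use le in blast)+
    show "finite (?F (- i) \<inter> ?G (- k))"
      by (rule finite_subset[OF _ finite_C]) (use fsub in blast)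
    show "add_subgroup (?F' i \<inter> ?G' k)"
      unfolding dict by (intro add_subgroup_Int add_subgroup_perp fsub)
    show "add_subgroup ((?F' i \<inter> ?G' (k + 1/2)) \<oplus>\<^sub>s (?F' (i - 1) \<inter> ?G' k))"
      unfolding dict by (intro add_subgroup_sum_set add_subgroup_Int add_subgroup_perp fsub)
    show "(?F' i \<inter> ?G' (k + 1/2)) \<oplus>\<^sub>s (?F' (i - 1) \<inter> ?G' k) \<subseteq> ?F' i \<inter> ?G' k"
      unfolding dict
      by (intro sum_set_least add_subgroup_Int add_subgroup_perp fsub)
         (use perp_antimono[OF le(1)] perp_antimono[OF le(2)] in blast)+
    show "finite (?F' i \<inter> ?G' k)"
      unfolding dict by (simp add: finite_perp)
  qed
qed

section \<open>Labelled circles\<close>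

text \<open>
  The condition on labels in \<open>khovanov_edge\<close>, for arbitrary sets \<open>S\<close> and \<open>S'\<close> of circles.
\<close>

definition kedge :: "'c set \<Rightarrow> 'c set \<Rightarrow> 'c set \<Rightarrow> 'c set \<Rightarrow> bool" where
  "kedge S S' P P' \<longleftrightarrow>
     P \<inter> (S \<inter> S') = P' \<inter> (S \<inter> S') \<and>
        ((\<exists>a b e. a \<noteq> b \<and> S - S' = {a, b} \<and> S' - S = {e} \<and>
            (a \<in> P \<and> b \<in> P \<and> e \<in> P' \<or> (a \<in> P \<longleftrightarrow> b \<notin> P) \<and> e \<notin> P')) \<or>
         (\<exists>a b e. a \<noteq> b \<and> S - S' = {e} \<and> S' - S = {a, b} \<and>
            (e \<in> P \<and> (a \<in> P' \<longleftrightarrow> b \<notin> P') \<or> e \<notin> P \<and> a \<notin> P' \<and> b \<notin> P')))"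

lemma kedge_merge:
  assumes "A \<noteq> B" "S - S' = {A, B}" "S' - S = {M}"
  shows "kedge S S' P P' \<longleftrightarrow> P \<inter> (S \<inter> S') = P' \<inter> (S \<inter> S') \<and>
    (A \<in> P \<and> B \<in> P \<and> M \<in> P' \<or> (A \<in> P \<longleftrightarrow> B \<notin> P) \<and> M \<notin> P')"
proof -
  have "(\<exists>a b e. a \<noteq> b \<and> S - S' = {a, b} \<and> S' - S = {e} \<and>
            (a \<in> P \<and> b \<in> P \<and> e \<in> P' \<or> (a \<in> P \<longleftrightarrow> b \<notin> P) \<and> e \<notin> P')) \<longleftrightarrow>
        (A \<in> P \<and> B \<in> P \<and> M \<in> P' \<or> (A \<in> P \<longleftrightarrow> B \<notin> P) \<and> M \<notin> P')"
    unfolding assms(2,3) using assms(1) by (auto simp: doubleton_eq_iff)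
  moreover have "\<not> (\<exists>a b e. a \<noteq> b \<and> S - S' = {e} \<and> S' - S = {a, b} \<and>
            (e \<in> P \<and> (a \<in> P' \<longleftrightarrow> b \<notin> P') \<or> e \<notin> P \<and> a \<notin> P' \<and> b \<notin> P'))"
    unfolding assms(2,3) using assms(1) by (auto simp: doubleton_eq_iff)
  ultimately show ?thesis unfolding kedge_def by argo
qed

lemma kedge_split:
  assumes "A \<noteq> B" "S' - S = {A, B}" "S - S' = {M}"
  shows "kedge S S' P P' \<longleftrightarrow> P \<inter> (S \<inter> S') = P' \<inter> (S \<inter> S') \<and>
    (M \<in> P \<and> (A \<in> P' \<longleftrightarrow> B \<notin> P') \<or> M \<notin> P \<and> A \<notin> P' \<and> B \<notin> P')"
proof -
  have "(\<exists>a b e. a \<noteq> b \<and> S - S' = {e} \<and> S' - S = {a, b} \<and>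
            (e \<in> P \<and> (a \<in> P' \<longleftrightarrow> b \<notin> P') \<or> e \<notin> P \<and> a \<notin> P' \<and> b \<notin> P')) \<longleftrightarrow>
        (M \<in> P \<and> (A \<in> P' \<longleftrightarrow> B \<notin> P') \<or> M \<notin> P \<and> A \<notin> P' \<and> B \<notin> P')"
    unfolding assms(2,3) using assms(1) by (auto simp: doubleton_eq_iff)
  moreover have "\<not> (\<exists>a b e. a \<noteq> b \<and> S - S' = {a, b} \<and> S' - S = {e} \<and>
            (a \<in> P \<and> b \<in> P \<and> e \<in> P' \<or> (a \<in> P \<longleftrightarrow> b \<notin> P) \<and> e \<notin> P'))"
    unfolding assms(2,3) using assms(1) by (auto simp: doubleton_eq_iff)
  ultimately show ?thesis unfolding kedge_def by argo
qed

lemma not_kedge_same: "\<not> kedge S S P P'"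
  by (auto simp: kedge_def)

lemma kedge_cases:
  assumes "kedge S S' P P'"
  obtains (merge) A B M where "A \<noteq> B" "S - S' = {A, B}" "S' - S = {M}"
        | (split) A B M where "A \<noteq> B" "S' - S = {A, B}" "S - S' = {M}"
proof -
  from assms have "(\<exists>a b e. a \<noteq> b \<and> S - S' = {a, b} \<and> S' - S = {e}) \<or>
      (\<exists>a b e. a \<noteq> b \<and> S' - S = {a, b} \<and> S - S' = {e})"
    unfolding kedge_def by (elim conjE disjE) (elim exE conjE, intro disjI1 exI conjI, assumption+,
      elim exE conjE, intro disjI2 exI conjI, assumption+)+
  then show ?thesis using merge split by (elim disjE exE conjE) simp_all
qed

text \<open>
  Multiplication and comultiplication are transposes of each other in the bases with \<open>v\<^sub>+\<close> and \<open>v\<^sub>-\<close>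
  exchanged.
\<close>

lemma kedge_complement:
  assumes "P \<subseteq> S" "P' \<subseteq> S'"
  shows "kedge S S' P P' \<longleftrightarrow> kedge S' S (S' - P') (S - P)"
proof -
  have main: "kedge S' S (S' - P') (S - P)" if le: "P \<subseteq> S" "P' \<subseteq> S'" and k: "kedge S S' P P'" for S S' P P' :: "'a set"
    using k
  proof (cases rule: kedge_cases)
    case (merge A B M)
    have "A \<in> S" "B \<in> S" "M \<in> S'" "A \<notin> S'" "B \<notin> S'" "M \<notin> S" using merge by auto
    then have "A \<in> S - P \<longleftrightarrow> A \<notin> P" "B \<in> S - P \<longleftrightarrow> B \<notin> P" "M \<in> S' - P' \<longleftrightarrow> M \<notin> P'" by blast+
    moreover have "P \<inter> (S \<inter> S') = P' \<inter> (S \<inter> S')" using k by (simp add: kedge_def)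
    then have "(S' - P') \<inter> (S' \<inter> S) = (S - P) \<inter> (S' \<inter> S)" by blast
    ultimately show ?thesis
      using k unfolding kedge_merge[OF merge] kedge_split[OF merge] by argo
  next
    case (split A B M)
    have "A \<in> S'" "B \<in> S'" "M \<in> S" "A \<notin> S" "B \<notin> S" "M \<notin> S'" using split by auto
    then have "A \<in> S' - P' \<longleftrightarrow> A \<notin> P'" "B \<in> S' - P' \<longleftrightarrow> B \<notin> P'" "M \<in> S - P \<longleftrightarrow> M \<notin> P" by blast+
    moreover have "P \<inter> (S \<inter> S') = P' \<inter> (S \<inter> S')" using k by (simp add: kedge_def)
    then have "(S' - P') \<inter> (S' \<inter> S) = (S - P) \<inter> (S' \<inter> S)" by blast
    ultimately show ?thesis
      using k unfolding kedge_merge[OF split] kedge_split[OF split] by argo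
  qed
  have "S - (S - P) = P" "S' - (S' - P') = P'" using assms by auto
  then show ?thesis using main[OF assms] main[of "S' - P'" S' "S - P" S] by auto
qed

text \<open>
  The count of labels \<open>v\<^sub>+\<close> minus that of \<open>v\<^sub>-\<close> drops by one under multiplication and under
  comultiplication; unaffected circles contribute equally to both sides.
\<close>

lemma kedge_degree:
  assumes fin: "finite S" "finite S'" and le: "P \<subseteq> S" "P' \<subseteq> S'" and k: "kedge S S' P P'"
  shows "int (card P) - int (card (S - P)) = int (card P') - int (card (S' - P')) + 1"
proof -
  define I where "I = S \<inter> S'"
  have finI: "finite I" and eq: "P \<inter> I = P' \<inter> I" using fin k by (auto simp: I_def kedge_def)
  have count: "int (card Q) - int (card (T - Q)) =
      int (card (Q \<inter> I)) - int (card (I - Q)) + (\<Sum>U\<in>T - I. if U \<in> Q then 1 else - 1)"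
    if T: "finite T" "I \<subseteq> T" "Q \<subseteq> T" for T Q
  proof -
    have s: "int (card Q) - int (card (T - Q)) = (\<Sum>U\<in>T. if U \<in> Q then 1 else - 1)" if "finite T" "Q \<subseteq> T" for T Q :: "'a set"
    proof -
      have "(\<Sum>U\<in>T. if U \<in> Q then 1 else - 1 :: int) = (\<Sum>U\<in>T \<inter> Q. 1) + (\<Sum>U\<in>T \<inter> - Q. - 1)"
        using that(1) by (simp add: sum.If_cases)
      moreover have "T \<inter> Q = Q" "T \<inter> - Q = T - Q" using that(2) by auto
      ultimately show ?thesis by simp
    qed
    have "(\<Sum>U\<in>T. if U \<in> Q then 1 else - 1 :: int)
        = (\<Sum>U\<in>I. if U \<in> Q then 1 else - 1) + (\<Sum>U\<in>T - I. if U \<in> Q then 1 else - 1)"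
      by (rule sum.subset_diff[OF T(2,1), THEN trans]) (simp add: add.commute)
    moreover have "(\<Sum>U\<in>I. if U \<in> Q then 1 else - 1 :: int) = (\<Sum>U\<in>I. if U \<in> Q \<inter> I then 1 else - 1)"
      by (rule sum.cong) auto
    moreover have "I - (Q \<inter> I) = I - Q" by blast
    note s[OF finI Int_lower2, of Q, unfolded this]
    ultimately show ?thesis using s[OF T(1,3)] by linarith
  qed
  have I: "I \<subseteq> S" "I \<subseteq> S'" "S - I = S - S'" "S' - I = S' - S" by (auto simp: I_def)
  have "I - P = I - P'" using eq by blast
  then have *: "int (card P) - int (card (S - P)) - (\<Sum>U\<in>S - S'. if U \<in> P then 1 else - 1)
      = int (card P') - int (card (S' - P')) - (\<Sum>U\<in>S' - S. if U \<in> P' then 1 else - 1)"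
    using count[OF fin(1) I(1) le(1)] count[OF fin(2) I(2) le(2)] unfolding eq I(3,4) by simp
  show ?thesis using k
  proof (cases rule: kedge_cases)
    case (merge A B M)
    have "A \<in> P \<and> B \<in> P \<and> M \<in> P' \<or> A \<in> P \<and> B \<notin> P \<and> M \<notin> P' \<or> A \<notin> P \<and> B \<in> P \<and> M \<notin> P'"
      using k unfolding kedge_merge[OF merge] by argo
    then show ?thesis using * merge(1) unfolding merge(2,3) by (elim disjE conjE) simp_all
  next
    case (split A B M)
    have "M \<in> P \<and> A \<in> P' \<and> B \<notin> P' \<or> M \<in> P \<and> A \<notin> P' \<and> B \<in> P' \<or> M \<notin> P \<and> A \<notin> P' \<and> B \<notin> P'"
      using k unfolding kedge_split[OF split] by argo
    then show ?thesis using * split(1) unfolding split(2,3) by (elim disjE conjE) simp_all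
  qed
qed

section \<open>Equivalence closures\<close>

text \<open>
  The closure used for the circles of a smoothing.  It is reflexive on the whole type, also outside of
  the set of arcs.
\<close>

definition cl :: "('e \<times> 'e) set \<Rightarrow> ('e \<times> 'e) set" where
  "cl G = (G \<union> G\<inverse>)\<^sup>*"

lemma cl_refl: "(x, x) \<in> cl G" by (simp add: cl_def)

lemma cl_sym: "(x, y) \<in> cl G \<Longrightarrow> (y, x) \<in> cl G"
  unfolding cl_def by (metis converse_Un converse_converse rtrancl_converseD converseI sup_commute rtrancl_converseI)

lemma cl_trans: "(x, y) \<in> cl G \<Longrightarrow> (y, z) \<in> cl G \<Longrightarrow> (x, z) \<in> cl G"
  unfolding cl_def by (rule rtrancl_trans)

lemma cl_cong: "(x, y) \<in> cl G \<Longrightarrow> (x, z) \<in> cl G \<longleftrightarrow> (y, z) \<in> cl G"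
  by (meson cl_trans cl_sym)

lemma cl_base: "(x, y) \<in> G \<Longrightarrow> (x, y) \<in> cl G"
  unfolding cl_def by blast

lemma cl_mono: "G \<subseteq> G' \<Longrightarrow> cl G \<subseteq> cl G'"
  unfolding cl_def by (rule rtrancl_mono) blast

lemma cl_least:
  assumes "G \<subseteq> cl H" shows "cl G \<subseteq> cl H"
proof (rule subrelI)
  fix x y assume "(x, y) \<in> cl G"
  then show "(x, y) \<in> cl H" unfolding cl_def[of G]
  proof (induction rule: rtrancl_induct)
    case base show ?case by (rule cl_refl)
  next
    case (step y z)
    then have "(y, z) \<in> cl H" using assms cl_sym by fast
    with step.IH show ?case by (rule cl_trans)
  qed
qed

lemma cl_class_eq: "cl G `` {x} = cl G `` {y} \<longleftrightarrow> (x, y) \<in> cl G"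
  by (auto intro: cl_refl cl_trans cl_sym)

text \<open>
  For an equivalence relation \<open>r\<close>, the classes of \<open>x\<close> and \<open>y\<close> are united.
\<close>

definition joined :: "('e \<times> 'e) set \<Rightarrow> 'e \<Rightarrow> 'e \<Rightarrow> ('e \<times> 'e) set" where
  "joined r x y = {(u, v). (u, v) \<in> r \<or> (u, x) \<in> r \<and> (y, v) \<in> r \<or> (u, y) \<in> r \<and> (x, v) \<in> r}"

lemma cl_insert: "cl (insert (x, y) G) = joined (cl G) x y"
proof (intro equalityI subrelI)
  fix u v assume "(u, v) \<in> cl (insert (x, y) G)"
  then show "(u, v) \<in> joined (cl G) x y" unfolding cl_def[of "insert _ _"]
  proof (induction rule: rtrancl_induct)
    case base show ?case by (simp add: joined_def cl_refl)
  next
    case (step v w)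
    then have "(v, w) \<in> cl G \<or> v = x \<and> w = y \<or> v = y \<and> w = x"
      using cl_base cl_sym by fast
    with step.IH show ?case unfolding joined_def by (blast intro: cl_refl cl_trans)
  qed
next
  fix u v assume uv: "(u, v) \<in> joined (cl G) x y"
  have 1: "cl G \<subseteq> cl (insert (x, y) G)" by (rule cl_mono) blast
  have 2: "(x, y) \<in> cl (insert (x, y) G)" by (rule cl_base) blast
  note 3 = cl_sym[OF 2]
  show "(u, v) \<in> cl (insert (x, y) G)"
    using uv 1 2 3 unfolding joined_def by (blast intro: cl_trans)
qed

lemma joined_absorb: "(x, y) \<in> cl G \<Longrightarrow> joined (cl G) x y = cl G"
  unfolding joined_def by (blast intro: cl_trans cl_sym)

lemma cl_insert_absorb: "(x, y) \<in> cl G \<Longrightarrow> cl (insert (x, y) G) = cl G"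
  by (simp add: cl_insert joined_absorb)

text \<open>
  Here \<open>G\<close> describes the rest of the smoothing.  If \<open>a\<close> and \<open>c\<close> are not connected, then among the three
  ways to pair the four ends within the rest only \<open>{a, b}\<close>, \<open>{c, d}\<close> is possible; so the pairs joined
  before the change were connected anyhow, and afterwards one more connection is added.  Exchanging
  \<open>b\<close> and \<open>c\<close> gives the statement for a circle that splits.
\<close>

lemma resmooth_merge:
  assumes pair: "(a, b) \<in> cl G \<and> (c, d) \<in> cl G \<or> (a, c) \<in> cl G \<and> (b, d) \<in> cl G \<or> (a, d) \<in> cl G \<and> (b, c) \<in> cl G"
    and n: "(a, c) \<notin> cl (insert (a, b) (insert (c, d) G))"
  shows "cl (insert (a, c) (insert (b, d) G)) = joined (cl (insert (a, b) (insert (c, d) G))) a c"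
proof -
  let ?H = "insert (a, b) (insert (c, d) G)"
  have mono: "(x, y) \<in> cl ?H" if "(x, y) \<in> cl G" for x y
    using that cl_mono[of G ?H] by blast
  have base: "(a, b) \<in> cl ?H" "(c, d) \<in> cl ?H" by (rule cl_base; simp)+
  have ab: "(a, b) \<in> cl G" "(c, d) \<in> cl G"
    using pair n mono base cl_trans cl_sym by metis+
  have cd: "cl (insert (c, d) G) = cl G" using ab(2) by (rule cl_insert_absorb)
  have ab': "cl ?H = cl G" using ab cd by (metis cl_insert_absorb)
  have "cl (insert (a, c) (insert (b, d) G)) = cl (insert (b, d) (insert (a, c) G))"
    by (simp add: insert_commute)
  also have "\<dots> = cl (insert (a, c) G)"
  proof (rule cl_insert_absorb)
    have 1: "cl G \<subseteq> cl (insert (a, c) G)" by (rule cl_mono) blast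
    have "(a, c) \<in> cl (insert (a, c) G)" by (rule cl_base) simp
    then show "(b, d) \<in> cl (insert (a, c) G)"
      using ab 1 cl_trans cl_sym by (metis subsetD)
  qed
  also have "\<dots> = joined (cl G) a c" by (rule cl_insert)
  finally show ?thesis using ab' by simp
qed

lemma resmooth_single:
  assumes "(a, c) \<in> cl (insert (a, b) (insert (c, d) G))" "(a, b) \<in> cl (insert (a, c) (insert (b, d) G))"
  shows "cl (insert (a, b) (insert (c, d) G)) = cl (insert (a, c) (insert (b, d) G))"
proof -
  let ?H = "insert (a, b) (insert (c, d) G)" and ?K = "insert (a, c) (insert (b, d) G)"
  have H: "(a, b) \<in> cl ?H" "(c, d) \<in> cl ?H" "(a, c) \<in> cl ?K" "(b, d) \<in> cl ?K" by (rule cl_base; simp)+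
  have "(c, d) \<in> cl ?K" "(b, d) \<in> cl ?H" using H assms cl_trans cl_sym by metis+
  then have "?H \<subseteq> cl ?K" "?K \<subseteq> cl ?H" using assms cl_base[of _ _ ?H] cl_base[of _ _ ?K] by auto
  then show ?thesis using cl_least by (metis subset_antisym)
qed

text \<open>
  Read from \<open>G\<close> to \<open>G'\<close> this describes a merge of circles, and from \<open>G'\<close> to \<open>G\<close> a split.
\<close>

lemma quotient_joined:
  assumes r': "cl G' = joined (cl G) x y" and n: "(x, y) \<notin> cl G" and E: "x \<in> E" "y \<in> E"
  shows "cl G `` {x} \<noteq> cl G `` {y}" "E // cl G - E // cl G' = {cl G `` {x}, cl G `` {y}}"
    "E // cl G' - E // cl G = {cl G' `` {x}}"
    "e \<in> E \<Longrightarrow> cl G `` {e} = cl G' `` {e} \<and> cl G `` {e} \<in> E // cl G \<inter> E // cl G' \<or>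
       cl G `` {e} \<in> {cl G `` {x}, cl G `` {y}} \<and> cl G' `` {e} = cl G' `` {x}"
proof -
  show ne: "cl G `` {x} \<noteq> cl G `` {y}" using n by (simp add: cl_class_eq)
  have xy: "(x, y) \<in> cl G'" unfolding r' joined_def using cl_refl[of _ G] by blast
  have le: "cl G \<subseteq> cl G'" unfolding r' joined_def by blast
  have cls: "cl G' `` {e} = (if (e, x) \<in> cl G \<or> (e, y) \<in> cl G then cl G `` {x} \<union> cl G `` {y} else cl G `` {e})" for e
  proof -
    consider "(e, x) \<in> cl G" | "(e, x) \<notin> cl G" "(e, y) \<in> cl G" | "(e, x) \<notin> cl G" "(e, y) \<notin> cl G" by blast
    then show ?thesis
    proof cases
      case 1
      have "(e, y) \<notin> cl G" using n unfolding cl_cong[OF 1] .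
      then show ?thesis using 1 unfolding r' joined_def by (auto simp: cl_cong[OF 1])
    next
      case 2
      then show ?thesis unfolding r' joined_def by (auto simp: cl_cong[OF 2(2)])
    next
      case 3
      then show ?thesis unfolding r' joined_def by auto
    qed
  qed
  have x': "cl G' `` {x} = cl G `` {x} \<union> cl G `` {y}" using cls[of x] cl_refl[of x G] by simp
  have notin: "cl G `` {e} \<notin> E // cl G'" if "(e, x) \<in> cl G \<or> (e, y) \<in> cl G" for e
  proof
    assume "cl G `` {e} \<in> E // cl G'"
    then obtain f where f: "cl G `` {e} = cl G' `` {f}" by (auto simp: quotient_def)
    then have iff: "(e, z) \<in> cl G \<longleftrightarrow> (f, z) \<in> cl G'" for z by (simp add: set_eq_iff)
    have "(f, x) \<in> cl G' \<longleftrightarrow> (f, y) \<in> cl G'" by (meson xy cl_trans cl_sym)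
    then have "(e, x) \<in> cl G" "(e, y) \<in> cl G" using that by (simp_all add: iff)
    then show False using n by (meson cl_trans cl_sym)
  qed
  have notin': "cl G' `` {x} \<notin> E // cl G"
  proof
    assume "cl G' `` {x} \<in> E // cl G"
    then obtain f where f: "cl G' `` {x} = cl G `` {f}" by (auto simp: quotient_def)
    then have iff: "(x, z) \<in> cl G' \<longleftrightarrow> (f, z) \<in> cl G" for z by (simp add: set_eq_iff)
    have "(f, x) \<in> cl G" "(f, y) \<in> cl G" using xy cl_refl[of x G'] by (simp_all add: iff)
    then show False using n by (meson cl_trans cl_sym)
  qed
  have in1: "cl G `` {e} \<in> E // cl G" if "e \<in> E" for e using that by (rule quotientI)
  have in2: "cl G' `` {e} \<in> E // cl G'" if "e \<in> E" for e using that by (rule quotientI)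
  have other: "cl G' `` {e} = cl G' `` {x} \<and> cl G `` {e} \<in> {cl G `` {x}, cl G `` {y}}"
    if "(e, x) \<in> cl G \<or> (e, y) \<in> cl G" for e
    using that cls[of e] x' by (simp add: cl_class_eq)
  show "E // cl G - E // cl G' = {cl G `` {x}, cl G `` {y}}"
  proof (intro equalityI subsetI)
    fix U assume U: "U \<in> E // cl G - E // cl G'"
    then obtain e where e: "e \<in> E" "U = cl G `` {e}" by (auto simp: quotient_def)
    then have "(e, x) \<in> cl G \<or> (e, y) \<in> cl G" using U in2[OF e(1)] cls[of e] by (auto split: if_splits)
    then show "U \<in> {cl G `` {x}, cl G `` {y}}" using other e(2) by blast
  next
    fix U assume "U \<in> {cl G `` {x}, cl G `` {y}}"
    then show "U \<in> E // cl G - E // cl G'"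
      using in1 E notin[of x] notin[of y] cl_refl[of _ G] by auto
  qed
  show "E // cl G' - E // cl G = {cl G' `` {x}}"
  proof (intro equalityI subsetI)
    fix U assume U: "U \<in> E // cl G' - E // cl G"
    then obtain e where e: "e \<in> E" "U = cl G' `` {e}" by (auto simp: quotient_def)
    then have "(e, x) \<in> cl G \<or> (e, y) \<in> cl G" using U in1[OF e(1)] cls[of e] by (auto split: if_splits)
    then show "U \<in> {cl G' `` {x}}" using other e(2) by blast
  next
    fix U assume "U \<in> {cl G' `` {x}}"
    then show "U \<in> E // cl G' - E // cl G" using in2 E notin' by auto
  qed
  show "cl G `` {e} = cl G' `` {e} \<and> cl G `` {e} \<in> E // cl G \<inter> E // cl G' \<or>
       cl G `` {e} \<in> {cl G `` {x}, cl G `` {y}} \<and> cl G' `` {e} = cl G' `` {x}" if "e \<in> E"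
  proof (cases "(e, x) \<in> cl G \<or> (e, y) \<in> cl G")
    case True
    then show ?thesis using other by blast
  next
    case False
    then have "cl G' `` {e} = cl G `` {e}" using cls[of e] by simp
    then show ?thesis using in1[OF that] in2[OF that] by simp
  qed
qed

section \<open>Squares in the cube of smoothings\<close>

text \<open>
  Functions of a set of labels encode chains in a fixed smoothing.  This operator is the action of
  \<open>v\<^sub>-\<close> on the factor \<open>U\<close>, in \<open>F[x]/(x\<^sup>2)\<close> with \<open>v\<^sub>+ = 1\<close> and \<open>v\<^sub>- = x\<close>: it changes the label \<open>v\<^sub>+\<close> of \<open>U\<close> to \<open>v\<^sub>-\<close>
  and kills the generators where \<open>U\<close> has the label \<open>v\<^sub>-\<close>.
\<close>

definition lower :: "'c \<Rightarrow> ('c set \<Rightarrow> bit) \<Rightarrow> 'c set \<Rightarrow> bit" where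
  "lower U f R = (if U \<in> R then 0 else f (insert U R))"

lemma lower_commute: "lower U (lower V f) = lower V (lower U f)"
  by (auto simp: lower_def fun_eq_iff insert_commute)

lemma lower_add: "lower U (\<lambda>R. f R + g R) = (\<lambda>R. lower U f R + lower U g R)"
  by (auto simp: lower_def fun_eq_iff)

lemma lower_zero: "lower U (\<lambda>R. 0) = (\<lambda>R. 0)"
  by (auto simp: lower_def fun_eq_iff)

text \<open>
  A combinatorial link diagram with arcs \<open>E\<close> and crossings \<open>X\<close>.  The 0-smoothing at \<open>p\<close> joins the ends
  \<open>a p\<close> with \<open>b p\<close> and \<open>c p\<close> with \<open>d p\<close>, the 1-smoothing joins \<open>a p\<close> with \<open>c p\<close> and \<open>b p\<close> with \<open>d p\<close>.  The last
  assumption is what remains of the fact that an arc has either two ends or none.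
\<close>

locale resolution =
  fixes E :: "'e set" and X :: "'p set" and a b c d :: "'p \<Rightarrow> 'e"
  assumes finite_E: "finite E" and finite_X: "finite X"
    and ends: "p \<in> X \<Longrightarrow> a p \<in> E" "p \<in> X \<Longrightarrow> b p \<in> E" "p \<in> X \<Longrightarrow> c p \<in> E" "p \<in> X \<Longrightarrow> d p \<in> E"
    and even_ends: "\<And>C. even (\<Sum>p\<in>X. of_bool (a p \<in> C) + of_bool (b p \<in> C) + of_bool (c p \<in> C) + of_bool (d p \<in> C) :: nat)"
begin

definition pairs :: "'p set \<Rightarrow> 'p \<Rightarrow> ('e \<times> 'e) set" where
  "pairs s p = (if p \<in> s then {(a p, c p), (b p, d p)} else {(a p, b p), (c p, d p)})"

definition rest :: "'p set \<Rightarrow> 'p \<Rightarrow> ('e \<times> 'e) set" where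
  "rest s p = (\<Union>q\<in>X - {p}. pairs s q)"

definition eqv :: "'p set \<Rightarrow> ('e \<times> 'e) set" where
  "eqv s = cl (\<Union>p\<in>X. pairs s p)"

definition circ :: "'p set \<Rightarrow> 'e set set" where
  "circ s = E // eqv s"

lemma finite_circ: "finite (circ s)"
proof -
  have "circ s = (\<lambda>e. eqv s `` {e}) ` E" by (auto simp: circ_def quotient_def)
  then show ?thesis using finite_E by simp
qed

lemma eqv_split:
  assumes "p \<in> X" "p \<notin> s"
  shows "eqv s = cl (insert (a p, b p) (insert (c p, d p) (rest s p)))"
    and "eqv (insert p s) = cl (insert (a p, c p) (insert (b p, d p) (rest s p)))"
proof -
  have X: "X = insert p (X - {p})" using assms by blast
  have r: "(\<Union>q\<in>X - {p}. pairs (insert p s) q) = rest s p"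
    unfolding rest_def by (rule SUP_cong) (auto simp: pairs_def)
  have "(\<Union>q\<in>X. pairs s q) = pairs s p \<union> rest s p"
    unfolding rest_def using X by blast
  then show "eqv s = cl (insert (a p, b p) (insert (c p, d p) (rest s p)))"
    unfolding eqv_def pairs_def using assms(2) by (simp add: insert_commute)
  have "(\<Union>q\<in>X. pairs (insert p s) q) = pairs (insert p s) p \<union> rest s p"
    unfolding r[symmetric] using X by blast
  then show "eqv (insert p s) = cl (insert (a p, c p) (insert (b p, d p) (rest s p)))"
    unfolding eqv_def pairs_def[of _ p] by (simp add: insert_commute)
qed

text \<open>
  Every other crossing joins ends in pairs within a class of the rest, so by the handshake assumption
  each class contains an even number of the four ends at \<open>p\<close>.
\<close>

lemma rest_pairing:
  fixes s
  assumes p: "p \<in> X"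
  defines "R \<equiv> cl (rest s p)"
  shows "(a p, b p) \<in> R \<and> (c p, d p) \<in> R \<or> (a p, c p) \<in> R \<and> (b p, d p) \<in> R \<or> (a p, d p) \<in> R \<and> (b p, c p) \<in> R"
proof -
  define n where "n q C = (of_bool (a q \<in> C) + of_bool (b q \<in> C) + of_bool (c q \<in> C) + of_bool (d q \<in> C) :: nat)" for q C
  have ev: "even (n p (R `` {e}))" for e
  proof -
    let ?C = "R `` {e}"
    have "even (n q ?C)" if q: "q \<in> X - {p}" for q
    proof -
      have "pairs s q \<subseteq> rest s p" using q by (auto simp: rest_def)
      then have "pairs s q \<subseteq> R" unfolding R_def using cl_base[of _ _ "rest s p"] by auto
      then have iff: "(u, v) \<in> pairs s q \<Longrightarrow> u \<in> ?C \<longleftrightarrow> v \<in> ?C" for u v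
        unfolding R_def by (auto intro: cl_trans cl_sym)
      show ?thesis
      proof (cases "q \<in> s")
        case True
        then have "a q \<in> ?C \<longleftrightarrow> c q \<in> ?C" "b q \<in> ?C \<longleftrightarrow> d q \<in> ?C"
          by (rule_tac iff, simp add: pairs_def)+
        then show ?thesis by (auto simp: n_def)
      next
        case False
        then have "a q \<in> ?C \<longleftrightarrow> b q \<in> ?C" "c q \<in> ?C \<longleftrightarrow> d q \<in> ?C"
          by (rule_tac iff, simp add: pairs_def)+
        then show ?thesis by (auto simp: n_def)
      qed
    qed
    then have "even (\<Sum>q\<in>X - {p}. n q ?C)" by (rule dvd_sum)
    moreover have "even (\<Sum>q\<in>X. n q ?C)" using even_ends[of ?C] by (simp only: n_def)
    moreover have "(\<Sum>q\<in>X. n q ?C) = n p ?C + (\<Sum>q\<in>X - {p}. n q ?C)"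
      by (rule sum.remove[OF finite_X p])
    ultimately show ?thesis by simp
  qed
  have r: "(u, u) \<in> R" for u unfolding R_def by (rule cl_refl)
  have "even (of_bool True + of_bool ((a p, b p) \<in> R) + of_bool ((a p, c p) \<in> R) + of_bool ((a p, d p) \<in> R) :: nat)"
    using ev[of "a p"] r by (simp add: n_def)
  then have 1: "(a p, b p) \<in> R \<longleftrightarrow> ((a p, c p) \<in> R \<longleftrightarrow> (a p, d p) \<in> R)"
    by (auto split: if_splits simp: of_bool_def)
  have "even (of_bool ((b p, a p) \<in> R) + of_bool True + of_bool ((b p, c p) \<in> R) + of_bool ((b p, d p) \<in> R) :: nat)"
    using ev[of "b p"] r by (simp add: n_def)
  then have 2: "(b p, a p) \<in> R \<longleftrightarrow> ((b p, c p) \<in> R \<longleftrightarrow> (b p, d p) \<in> R)"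
    by (auto split: if_splits simp: of_bool_def)
  have "even (of_bool ((c p, a p) \<in> R) + of_bool ((c p, b p) \<in> R) + of_bool True + of_bool ((c p, d p) \<in> R) :: nat)"
    using ev[of "c p"] r by (simp add: n_def)
  then have 3: "(c p, a p) \<in> R \<longleftrightarrow> ((c p, b p) \<in> R \<longleftrightarrow> (c p, d p) \<in> R)"
    by (auto split: if_splits simp: of_bool_def)
  have sym: "(u, v) \<in> R \<longleftrightarrow> (v, u) \<in> R" for u v unfolding R_def by (blast intro: cl_sym)
  have tr: "(u, v) \<in> R \<longrightarrow> (v, w) \<in> R \<longrightarrow> (u, w) \<in> R" for u v w
    unfolding R_def by (blast intro: cl_trans)
  show ?thesis
    using 1 2 3 sym[of "a p" "b p"] sym[of "a p" "c p"] sym[of "b p" "c p"] sym[of "b p" "d p"]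
      tr[of "b p" "a p" "c p"] tr[of "a p" "b p" "c p"] tr[of "a p" "c p" "b p"] tr[of "a p" "d p" "b p"]
    by argo
qed

definition merges :: "'p \<Rightarrow> 'p set \<Rightarrow> bool" where
  "merges p s \<longleftrightarrow> (a p, c p) \<notin> eqv s"

lemma eqv_pairs:
  assumes "p \<in> X"
  shows "p \<notin> s \<Longrightarrow> (a p, b p) \<in> eqv s" "p \<notin> s \<Longrightarrow> (c p, d p) \<in> eqv s"
    "p \<in> s \<Longrightarrow> (a p, c p) \<in> eqv s" "p \<in> s \<Longrightarrow> (b p, d p) \<in> eqv s"
  using assms unfolding eqv_def by (auto intro!: cl_base simp: pairs_def split: if_splits)

lemma eqv_sym: "(x, y) \<in> eqv s \<Longrightarrow> (y, x) \<in> eqv s"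
  unfolding eqv_def by (rule cl_sym)

lemma eqv_trans: "(x, y) \<in> eqv s \<Longrightarrow> (y, z) \<in> eqv s \<Longrightarrow> (x, z) \<in> eqv s"
  unfolding eqv_def by (rule cl_trans)

lemma eqv_merge:
  assumes "p \<in> X" "p \<notin> s" "merges p s"
  shows "eqv (insert p s) = joined (eqv s) (a p) (c p)"
  using resmooth_merge[OF rest_pairing[OF assms(1), of s]] assms(3)
  unfolding eqv_split[OF assms(1,2)] merges_def by blast

lemma eqv_split_off:
  assumes "p \<in> X" "p \<notin> s" "\<not> merges p s" "(a p, b p) \<notin> eqv (insert p s)"
  shows "eqv s = joined (eqv (insert p s)) (a p) (b p)"
proof -
  have "(a p, c p) \<in> cl (rest s p) \<and> (b p, d p) \<in> cl (rest s p) \<or>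
      (a p, b p) \<in> cl (rest s p) \<and> (c p, d p) \<in> cl (rest s p) \<or>
      (a p, d p) \<in> cl (rest s p) \<and> (c p, b p) \<in> cl (rest s p)"
    using rest_pairing[OF assms(1), of s] by (blast intro: cl_sym)
  from resmooth_merge[OF this] assms(4) show ?thesis
    unfolding eqv_split[OF assms(1,2)] merges_def by blast
qed

lemma eqv_single:
  assumes "p \<in> X" "p \<notin> s" "\<not> merges p s" "(a p, b p) \<in> eqv (insert p s)"
  shows "eqv s = eqv (insert p s)"
  using resmooth_single[of "a p" "c p" "b p" "d p" "rest s p"] assms(3,4)
  unfolding eqv_split[OF assms(1,2)] merges_def by blast

lemma joined_mono: "r \<subseteq> joined r x y"
  by (auto simp: joined_def)

lemma eqv_mono_merge: "p \<in> X \<Longrightarrow> p \<notin> s \<Longrightarrow> merges p s \<Longrightarrow> eqv s \<subseteq> eqv (insert p s)"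
  using eqv_merge joined_mono by metis

lemma eqv_antimono: "p \<in> X \<Longrightarrow> p \<notin> s \<Longrightarrow> \<not> merges p s \<Longrightarrow> eqv (insert p s) \<subseteq> eqv s"
  using eqv_split_off eqv_single joined_mono by (metis order_refl)

definition cls :: "'p set \<Rightarrow> 'e \<Rightarrow> 'e set" where
  "cls s e = eqv s `` {e}"

lemma cls_in_circ: "e \<in> E \<Longrightarrow> cls s e \<in> circ s"
  unfolding cls_def circ_def by (rule quotientI)

lemma circ_cls: "U \<in> circ s \<Longrightarrow> \<exists>e\<in>E. U = cls s e"
  by (auto simp: cls_def circ_def quotient_def)

lemma cls_eq_iff: "cls s x = cls s y \<longleftrightarrow> (x, y) \<in> eqv s"
  unfolding cls_def eqv_def by (rule cl_class_eq)

lemma circ_merge: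
  assumes "p \<in> X" "p \<notin> s" "merges p s"
  defines "t \<equiv> insert p s"
  shows "cls s (a p) \<noteq> cls s (c p)" "circ s - circ t = {cls s (a p), cls s (c p)}"
    "circ t - circ s = {cls t (a p)}"
    "e \<in> E \<Longrightarrow> cls s e = cls t e \<and> cls s e \<in> circ s \<inter> circ t \<or>
       cls s e \<in> {cls s (a p), cls s (c p)} \<and> cls t e = cls t (a p)"
proof -
  have n: "(a p, c p) \<notin> cl (\<Union>p\<in>X. pairs s p)" using assms(3) by (simp add: merges_def eqv_def)
  note * = quotient_joined[OF eqv_merge[OF assms(1-3), unfolded eqv_def] n ends(1)[OF assms(1)] ends(3)[OF assms(1)]]
  show "cls s (a p) \<noteq> cls s (c p)" "circ s - circ t = {cls s (a p), cls s (c p)}"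
    "circ t - circ s = {cls t (a p)}"
    "e \<in> E \<Longrightarrow> cls s e = cls t e \<and> cls s e \<in> circ s \<inter> circ t \<or>
       cls s e \<in> {cls s (a p), cls s (c p)} \<and> cls t e = cls t (a p)"
    unfolding cls_def circ_def eqv_def t_def using * by simp_all
qed

lemma circ_split_off:
  assumes "p \<in> X" "p \<notin> s" "\<not> merges p s" "(a p, b p) \<notin> eqv (insert p s)"
  defines "t \<equiv> insert p s"
  shows "cls t (a p) \<noteq> cls t (b p)" "circ t - circ s = {cls t (a p), cls t (b p)}"
    "circ s - circ t = {cls s (a p)}"
    "e \<in> E \<Longrightarrow> cls t e = cls s e \<and> cls t e \<in> circ t \<inter> circ s \<or>
       cls t e \<in> {cls t (a p), cls t (b p)} \<and> cls s e = cls s (a p)"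
proof -
  note * = quotient_joined[OF eqv_split_off[OF assms(1-4), unfolded eqv_def] assms(4)[unfolded eqv_def] ends(1)[OF assms(1)] ends(2)[OF assms(1)]]
  show "cls t (a p) \<noteq> cls t (b p)" "circ t - circ s = {cls t (a p), cls t (b p)}"
    "circ s - circ t = {cls s (a p)}"
    "e \<in> E \<Longrightarrow> cls t e = cls s e \<and> cls t e \<in> circ t \<inter> circ s \<or>
       cls t e \<in> {cls t (a p), cls t (b p)} \<and> cls s e = cls s (a p)"
    unfolding cls_def circ_def eqv_def t_def using * by simp_all
qed

text \<open>
  In the last case the set of circles does not change, and there are no edges between labellings of the
  same set of circles.
\<close>

lemma step_cases:
  assumes "p \<in> X" "p \<notin> s"
  obtains (merge) "merges p s"
    | (split) "\<not> merges p s" "(a p, b p) \<notin> eqv (insert p s)"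
    | (single) "\<not> merges p s" "(a p, b p) \<in> eqv (insert p s)" "eqv s = eqv (insert p s)"
  using eqv_single[OF assms] by blast

text \<open>
  The edge maps commute with the action of \<open>v\<^sub>-\<close> at an arc \<open>e\<close>, in terms of matrix entries: multiplication
  and comultiplication are maps of bimodules.
\<close>

lemma kedge_lower:
  assumes p: "p \<in> X" "p \<notin> s" and e: "e \<in> E"
    and le: "P \<subseteq> circ s" "Q \<subseteq> circ (insert p s)"
  shows "cls s e \<in> P \<Longrightarrow> kedge (circ s) (circ (insert p s)) (P - {cls s e}) Q \<longleftrightarrow>
      cls (insert p s) e \<notin> Q \<and> kedge (circ s) (circ (insert p s)) P (insert (cls (insert p s) e) Q)"
    and "cls s e \<notin> P \<Longrightarrow> kedge (circ s) (circ (insert p s)) P Q \<Longrightarrow> cls (insert p s) e \<notin> Q"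
proof -
  let ?t = "insert p s"
  define S T U V where defs: "S = circ s" "T = circ ?t" "U = cls s e" "V = cls ?t e"
  have UV: "U \<in> S" "V \<in> T" using e by (simp_all add: defs cls_in_circ)
  have "(U \<in> P \<longrightarrow> (kedge S T (P - {U}) Q \<longleftrightarrow> V \<notin> Q \<and> kedge S T P (insert V Q))) \<and>
      (U \<notin> P \<longrightarrow> kedge S T P Q \<longrightarrow> V \<notin> Q)"
  using p proof (cases rule: step_cases)
    case 1: merge
    define A B M where ABM: "A = cls s (a p)" "B = cls s (c p)" "M = cls ?t (a p)"
    have m: "A \<noteq> B" "S - T = {A, B}" "T - S = {M}" "U = V \<and> U \<in> S \<inter> T \<or> U \<in> {A, B} \<and> V = M"
      using circ_merge[OF p 1] e by (simp_all add: defs ABM)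
    have n: "A \<notin> T" "B \<notin> T" "M \<notin> S" "A \<in> S" "B \<in> S" "M \<in> T" using m by auto
    then have AM: "A \<noteq> M" "B \<noteq> M" by auto
    show ?thesis
      using m(4)
    proof
      assume UV': "U = V \<and> U \<in> S \<inter> T"
      then have ne: "A \<noteq> U" "B \<noteq> U" "M \<noteq> V" using n by auto
      have "U \<in> P \<Longrightarrow> (P - {U}) \<inter> (S \<inter> T) = Q \<inter> (S \<inter> T) \<longleftrightarrow> V \<notin> Q \<and> P \<inter> (S \<inter> T) = insert V Q \<inter> (S \<inter> T)"
        "U \<notin> P \<Longrightarrow> P \<inter> (S \<inter> T) = Q \<inter> (S \<inter> T) \<Longrightarrow> V \<notin> Q"
        using UV' by blast+
      then show ?thesis
        unfolding kedge_merge[OF m(1-3)] using ne by simp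
    next
      assume UV': "U \<in> {A, B} \<and> V = M"
      then have I: "(P - {U}) \<inter> (S \<inter> T) = P \<inter> (S \<inter> T)" "insert V Q \<inter> (S \<inter> T) = Q \<inter> (S \<inter> T)"
        using n by blast+
      have V: "M \<in> insert V Q" "V \<in> Q \<longleftrightarrow> M \<in> Q" using UV' by simp_all
      from UV' have "U = A \<or> U = B" by blast
      then show ?thesis
      proof
        assume "U = A"
        then have "A \<notin> P - {U}" "B \<in> P - {U} \<longleftrightarrow> B \<in> P" "U \<in> P \<longleftrightarrow> A \<in> P" using m(1) by blast+
        with V show ?thesis unfolding kedge_merge[OF m(1-3)] I by argo
      next
        assume "U = B"
        then have "B \<notin> P - {U}" "A \<in> P - {U} \<longleftrightarrow> A \<in> P" "U \<in> P \<longleftrightarrow> B \<in> P" using m(1) by blast+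
        with V show ?thesis unfolding kedge_merge[OF m(1-3)] I by argo
      qed
    qed
  next
    case 2: split
    define A B M where ABM: "A = cls ?t (a p)" "B = cls ?t (b p)" "M = cls s (a p)"
    have m: "A \<noteq> B" "T - S = {A, B}" "S - T = {M}" "V = U \<and> V \<in> T \<inter> S \<or> V \<in> {A, B} \<and> U = M"
      using circ_split_off[OF p 2] e by (simp_all add: defs ABM)
    have n: "A \<notin> S" "B \<notin> S" "M \<notin> T" "A \<in> T" "B \<in> T" "M \<in> S" using m by auto
    then have AM: "A \<noteq> M" "B \<noteq> M" by auto
    show ?thesis
      using m(4)
    proof
      assume UV': "V = U \<and> V \<in> T \<inter> S"
      then have ne: "A \<noteq> V" "B \<noteq> V" "M \<noteq> U" using n by auto
      have "U \<in> P \<Longrightarrow> (P - {U}) \<inter> (S \<inter> T) = Q \<inter> (S \<inter> T) \<longleftrightarrow> V \<notin> Q \<and> P \<inter> (S \<inter> T) = insert V Q \<inter> (S \<inter> T)"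
        "U \<notin> P \<Longrightarrow> P \<inter> (S \<inter> T) = Q \<inter> (S \<inter> T) \<Longrightarrow> V \<notin> Q"
        using UV' by blast+
      then show ?thesis
        unfolding kedge_split[OF m(1-3)] using ne by simp
    next
      assume UV': "V \<in> {A, B} \<and> U = M"
      then have I: "(P - {U}) \<inter> (S \<inter> T) = P \<inter> (S \<inter> T)" "insert V Q \<inter> (S \<inter> T) = Q \<inter> (S \<inter> T)"
        using n by blast+
      have U: "M \<notin> P - {U}" "U \<in> P \<longleftrightarrow> M \<in> P" using UV' by simp_all
      from UV' have "V = A \<or> V = B" by blast
      then show ?thesis
      proof
        assume "V = A"
        then have "A \<in> insert V Q" "B \<in> insert V Q \<longleftrightarrow> B \<in> Q" "V \<in> Q \<longleftrightarrow> A \<in> Q" using m(1) by blast+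
        with U show ?thesis unfolding kedge_split[OF m(1-3)] I by argo
      next
        assume "V = B"
        then have "B \<in> insert V Q" "A \<in> insert V Q \<longleftrightarrow> A \<in> Q" "V \<in> Q \<longleftrightarrow> B \<in> Q" using m(1) by blast+
        with U show ?thesis unfolding kedge_split[OF m(1-3)] I by argo
      qed
    qed
  next
    case 3: single
    then have "S = T" by (simp add: defs circ_def)
    then show ?thesis by (simp add: not_kedge_same)
  qed
  then show "cls s e \<in> P \<Longrightarrow> kedge (circ s) (circ (insert p s)) (P - {cls s e}) Q \<longleftrightarrow>
      cls (insert p s) e \<notin> Q \<and> kedge (circ s) (circ (insert p s)) P (insert (cls (insert p s) e) Q)"
    and "cls s e \<notin> P \<Longrightarrow> kedge (circ s) (circ (insert p s)) P Q \<Longrightarrow> cls (insert p s) e \<notin> Q"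
    unfolding defs by blast+
qed

text \<open>
  The unit of the smoothing is sent to the unit by a multiplication, and to \<open>x\<^sub>a + x\<^sub>b\<close> by a
  comultiplication.  The same formula gives zero when the circles do not change, because \<open>a p\<close> and \<open>b p\<close>
  then lie on one circle.
\<close>

lemma kedge_top:
  assumes p: "p \<in> X" "p \<notin> s" and le: "Q \<subseteq> circ (insert p s)"
  shows "of_bool (kedge (circ s) (circ (insert p s)) (circ s) Q) =
    (if merges p s then of_bool (Q = circ (insert p s)) else
       (of_bool (Q = circ (insert p s) - {cls (insert p s) (a p)})
        + of_bool (Q = circ (insert p s) - {cls (insert p s) (b p)}) :: bit))"
proof -
  let ?t = "insert p s"
  define S T where defs: "S = circ s" "T = circ ?t"
  have QT: "Q \<subseteq> T" using le by (simp add: defs)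
  show ?thesis
  using p proof (cases rule: step_cases)
    case 1: merge
    define A B M where ABM: "A = cls s (a p)" "B = cls s (c p)" "M = cls ?t (a p)"
    have m: "A \<noteq> B" "S - T = {A, B}" "T - S = {M}"
      using circ_merge[OF p 1] by (simp_all add: defs ABM)
    have mem: "x \<in> T \<and> x \<notin> S \<longleftrightarrow> x = M" for x using m(3) by (simp add: set_eq_iff)
    then have T: "insert M (S \<inter> T) = T" unfolding set_eq_iff by blast
    have AB: "A \<in> S" "B \<in> S" using m(2) by blast+
    have "kedge S T S Q \<longleftrightarrow> S \<inter> (S \<inter> T) = Q \<inter> (S \<inter> T) \<and> M \<in> Q"
      unfolding kedge_merge[OF m] using AB by simp
    also have "\<dots> \<longleftrightarrow> insert M (S \<inter> T) \<subseteq> Q" by blast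
    also have "\<dots> \<longleftrightarrow> Q = T" unfolding T using QT by blast
    finally have "kedge S T S Q \<longleftrightarrow> Q = T" .
    then show ?thesis using 1 by (simp add: defs)
  next
    case 2: split
    define A B M where ABM: "A = cls ?t (a p)" "B = cls ?t (b p)" "M = cls s (a p)"
    have m: "A \<noteq> B" "T - S = {A, B}" "S - T = {M}"
      using circ_split_off[OF p 2] by (simp_all add: defs ABM)
    have AB: "A \<in> T" "B \<in> T" "A \<notin> S" "B \<notin> S" "M \<in> S" using m(2,3) by blast+
    have mem: "x \<in> T \<and> x \<notin> S \<longleftrightarrow> x = A \<or> x = B" for x using m(2) by (simp add: set_eq_iff)
    then have T: "T = insert A (insert B (S \<inter> T))" unfolding set_eq_iff by blast
    have TA: "T - {A} = insert B (S \<inter> T)" "T - {B} = insert A (S \<inter> T)"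
      unfolding set_eq_iff using mem AB m(1) by blast+
    have "kedge S T S Q \<longleftrightarrow> S \<inter> (S \<inter> T) = Q \<inter> (S \<inter> T) \<and> (A \<in> Q \<longleftrightarrow> B \<notin> Q)"
      unfolding kedge_split[OF m] using AB by simp
    also have "\<dots> \<longleftrightarrow> S \<inter> T \<subseteq> Q \<and> (A \<in> Q \<longleftrightarrow> B \<notin> Q)" by blast
    also have "\<dots> \<longleftrightarrow> Q = insert B (S \<inter> T) \<or> Q = insert A (S \<inter> T)"
    proof -
      have "Q \<subseteq> insert A (insert B (S \<inter> T))" using QT T by (rule subset_trans[OF _ equalityD1])
      moreover have "(I \<subseteq> Q \<and> (A \<in> Q \<longleftrightarrow> B \<notin> Q)) = (Q = insert B I \<or> Q = insert A I)"
        if "Q \<subseteq> insert A (insert B I)" "A \<notin> I" "B \<notin> I" for I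
        using that m(1) by (cases "A \<in> Q"; cases "B \<in> Q") auto
      ultimately show ?thesis using AB by blast
    qed
    finally have k: "kedge S T S Q \<longleftrightarrow> Q = T - {A} \<or> Q = T - {B}" by (simp only: TA)
    have "A \<in> T - {B}" using AB(1) m(1) by simp
    then have ne: "T - {A} \<noteq> T - {B}" by (metis Diff_iff singletonI)
    have "(of_bool (kedge S T S Q) :: bit) = of_bool (Q = T - {A}) + of_bool (Q = T - {B})"
      unfolding k using ne by (cases "Q = T - {A}") simp_all
    then show ?thesis using 2(1) unfolding defs ABM by simp
  next
    case 3: single
    then have "S = T" by (simp add: defs circ_def)
    then have "\<not> kedge S T S Q" by (simp add: not_kedge_same)
    moreover have "cls ?t (a p) = cls ?t (b p)" using 3 by (simp add: cls_eq_iff)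
    ultimately show ?thesis using 3(1) unfolding defs by simp
  qed
qed

definition paths :: "'p \<Rightarrow> 'p \<Rightarrow> 'p set \<Rightarrow> 'e set set \<Rightarrow> 'e set set \<Rightarrow> bit" where
  "paths p q s P R = (\<Sum>Q\<in>Pow (circ (insert p s)).
      of_bool (kedge (circ s) (circ (insert p s)) P Q)
      * of_bool (kedge (circ (insert p s)) (circ (insert q (insert p s))) Q R))"

text \<open>
  The element by which an edge map multiplies the unit, acting on a function of labels: 1 for a
  multiplication, and \<open>x\<^sub>a + x\<^sub>b\<close> otherwise.
\<close>

definition edge_factor :: "bool \<Rightarrow> 'p \<Rightarrow> 'p set \<Rightarrow> ('e set set \<Rightarrow> bit) \<Rightarrow> 'e set set \<Rightarrow> bit" where
  "edge_factor m p t f = (if m then f else (\<lambda>R. lower (cls t (a p)) f R + lower (cls t (b p)) f R))"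

lemma paths_lower:
  assumes p: "p \<in> X" "p \<notin> s" and q: "q \<in> X" "q \<notin> insert p s" and e: "e \<in> E"
    and P: "P \<subseteq> circ s" "cls s e \<in> P" and R: "R \<subseteq> circ (insert q (insert p s))"
  shows "paths p q s (P - {cls s e}) R = lower (cls (insert q (insert p s)) e) (paths p q s P) R"
proof -
  let ?sp = "insert p s" and ?t = "insert q (insert p s)"
  define S T W where defs: "S = circ s" "T = circ ?sp" "W = circ ?t"
  let ?V = "cls ?sp e" and ?Z = "cls ?t e"
  have V: "?V \<in> T" and Z: "?Z \<in> W" using e by (simp_all add: defs cls_in_circ)
  have finT: "finite T" by (simp add: defs finite_circ)
  have k1: "kedge S T (P - {cls s e}) Q \<longleftrightarrow> ?V \<notin> Q \<and> kedge S T P (insert ?V Q)" if "Q \<subseteq> T" for Q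
    using kedge_lower(1)[OF p e P(1) _ P(2)] that by (simp add: defs)
  have k2: "kedge T W (Q - {?V}) R \<longleftrightarrow> ?Z \<notin> R \<and> kedge T W Q (insert ?Z R)" if "Q \<subseteq> T" "?V \<in> Q" for Q
    using kedge_lower(1)[OF q e _ R that(2)] that(1) by (simp add: defs)
  have k3: "\<not> kedge T W Q (insert ?Z R)" if "Q \<subseteq> T" "?V \<notin> Q" for Q
    using kedge_lower(2)[OF q e _ _ that(2), of "insert ?Z R"] that(1) R Z by (auto simp: defs)
  have "paths p q s (P - {cls s e}) R = (\<Sum>Q\<in>Pow T. of_bool (?V \<notin> Q \<and> kedge S T P (insert ?V Q)) * of_bool (kedge T W Q R))"
    unfolding paths_def defs[symmetric] by (rule sum.cong) (auto simp: k1)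
  also have "\<dots> = (\<Sum>Q\<in>{Q \<in> Pow T. ?V \<notin> Q}. of_bool (kedge S T P (insert ?V Q)) * of_bool (kedge T W Q R))"
    using finT by (intro sum.mono_neutral_cong_right) auto
  also have "\<dots> = (\<Sum>Q\<in>{Q \<in> Pow T. ?V \<in> Q}. of_bool (kedge S T P Q) * of_bool (kedge T W (Q - {?V}) R))"
    by (rule sum.reindex_bij_witness[of _ "\<lambda>Q. Q - {?V}" "insert ?V"]) (use V in \<open>auto simp: insert_absorb\<close>)
  also have "\<dots> = (\<Sum>Q\<in>{Q \<in> Pow T. ?V \<in> Q}. of_bool (kedge S T P Q) * of_bool (?Z \<notin> R \<and> kedge T W Q (insert ?Z R)))"
    by (rule sum.cong) (auto simp: k2)
  also have "\<dots> = (\<Sum>Q\<in>Pow T. of_bool (kedge S T P Q) * of_bool (?Z \<notin> R \<and> kedge T W Q (insert ?Z R)))"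
    using finT by (intro sum.mono_neutral_left) (auto simp: k3)
  also have "\<dots> = lower ?Z (paths p q s P) R"
    unfolding lower_def paths_def defs[symmetric] by (auto intro!: sum.neutral)
  finally show ?thesis .
qed

lemma sum_delta_Pow:
  fixes g :: "'c set \<Rightarrow> bit"
  assumes "finite T" "B \<subseteq> T"
  shows "(\<Sum>Q\<in>Pow T. of_bool (Q = B) * g Q) = g B"
proof -
  have "(\<Sum>Q\<in>Pow T. of_bool (Q = B) * g Q) = (\<Sum>Q\<in>Pow T. if Q = B then g Q else 0)"
    by (rule sum.cong) auto
  then show ?thesis using assms by simp
qed

lemma paths_top:
  assumes p: "p \<in> X" "p \<notin> s" and q: "q \<in> X" "q \<notin> insert p s"
    and R: "R \<subseteq> circ (insert q (insert p s))"
  defines "t \<equiv> insert q (insert p s)"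
  shows "paths p q s (circ s) R =
    edge_factor (merges p s) p t (edge_factor (merges q (insert p s)) q t (\<lambda>R. of_bool (R = circ t))) R"
proof -
  let ?sp = "insert p s"
  define T W where defs: "T = circ ?sp" "W = circ t"
  have finT: "finite T" by (simp add: defs finite_circ)
  have a: "a p \<in> E" "b p \<in> E" "a q \<in> E" "b q \<in> E" using ends p q by auto
  define k where "k = (\<lambda>Q R. of_bool (kedge T W Q R) :: bit)"
  define \<delta> where "\<delta> = (\<lambda>R. of_bool (R = W) :: bit)"
  have lowW: "lower (cls t e) \<delta> R = of_bool (R = W - {cls t e})" if "e \<in> E" "R \<subseteq> W" for e R
    using cls_in_circ[OF that(1), of t] that(2) by (auto simp: lower_def \<delta>_def defs)
  have ktop: "k T R = edge_factor (merges q ?sp) q t \<delta> R" if "R \<subseteq> W" for R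
    using kedge_top[OF q, of R] that lowW[OF a(3) that] lowW[OF a(4) that]
    by (simp add: k_def defs edge_factor_def t_def[symmetric] \<delta>_def)
  have klow: "k (T - {cls ?sp e}) R = lower (cls t e) (k T) R" if "e \<in> E" for e
    using kedge_lower(1)[OF q that order_refl R cls_in_circ[OF that]]
    by (auto simp: k_def defs t_def lower_def)
  have low_cong: "lower (cls t e) f R = lower (cls t e) g R"
    if "e \<in> E" "\<And>R. R \<subseteq> W \<Longrightarrow> f R = g R" for e f g
    using that(2)[of "insert (cls t e) R"] cls_in_circ[OF that(1), of t] R
    by (simp add: lower_def defs t_def)
  have "paths p q s (circ s) R = (\<Sum>Q\<in>Pow T. of_bool (kedge (circ s) T (circ s) Q) * k Q R)"
    by (simp add: paths_def defs k_def t_def)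
  also have "\<dots> = (if merges p s then k T R else k (T - {cls ?sp (a p)}) R + k (T - {cls ?sp (b p)}) R)"
  proof (cases "merges p s")
    case True
    then have "(\<Sum>Q\<in>Pow T. of_bool (kedge (circ s) T (circ s) Q) * k Q R) = (\<Sum>Q\<in>Pow T. of_bool (Q = T) * k Q R)"
      using kedge_top[OF p] by (intro sum.cong refl) (simp add: defs)
    then show ?thesis using True sum_delta_Pow[OF finT, of T] by simp
  next
    case False
    then have "(\<Sum>Q\<in>Pow T. of_bool (kedge (circ s) T (circ s) Q) * k Q R)
       = (\<Sum>Q\<in>Pow T. of_bool (Q = T - {cls ?sp (a p)}) * k Q R + of_bool (Q = T - {cls ?sp (b p)}) * k Q R)"
      using kedge_top[OF p] by (intro sum.cong refl) (simp add: defs distrib_right)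
    then show ?thesis using False by (simp add: sum.distrib sum_delta_Pow[OF finT])
  qed
  also have "\<dots> = edge_factor (merges p s) p t (edge_factor (merges q ?sp) q t \<delta>) R"
    using R klow[OF a(1)] klow[OF a(2)] ktop[of R] low_cong[OF a(1) ktop] low_cong[OF a(2) ktop]
    by (simp add: edge_factor_def[of "merges p s"] defs t_def)
  finally show ?thesis by (simp add: \<delta>_def defs)
qed

lemma lower_same: "cls t x = cls t y \<Longrightarrow> (\<lambda>R. lower (cls t x) f R + lower (cls t y) f R) = (\<lambda>R. 0)"
  by (simp add: fun_eq_iff)

text \<open>
  Merging coarsens the relation of lying on one circle, and the other changes refine it.
\<close>

lemma merges_if_not_merges:
  assumes p: "p \<in> X" "p \<notin> s" and q: "q \<in> X" "q \<notin> s" and "p \<noteq> q"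
    and m: "merges p s" "\<not> merges q s"
  shows "\<not> merges q (insert p s)" "merges p (insert q s)"
proof -
  have "eqv s \<subseteq> eqv (insert p s)" by (rule eqv_mono_merge[OF p m(1)])
  then show "\<not> merges q (insert p s)" using m(2) by (auto simp: merges_def)
  have "eqv (insert q s) \<subseteq> eqv s" by (rule eqv_antimono[OF q m(2)])
  then show "merges p (insert q s)" using m(1) by (auto simp: merges_def)
qed

lemma merge_merge_same_pair:
  assumes p: "p \<in> X" "p \<notin> s" and q: "q \<in> X" "q \<notin> s" and "p \<noteq> q"
    and m: "merges p s" "merges q s" "\<not> merges q (insert p s)"
  shows "(a q, a p) \<in> eqv s \<and> (c p, c q) \<in> eqv s \<or> (a q, c p) \<in> eqv s \<and> (a p, c q) \<in> eqv s"
    "\<not> merges p (insert q s)"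
proof -
  have "(a q, c q) \<in> joined (eqv s) (a p) (c p)"
    using m(3) unfolding merges_def eqv_merge[OF p m(1)] by blast
  then show *: "(a q, a p) \<in> eqv s \<and> (c p, c q) \<in> eqv s \<or> (a q, c p) \<in> eqv s \<and> (a p, c q) \<in> eqv s"
    using m(2) unfolding joined_def merges_def by blast
  have le: "eqv s \<subseteq> eqv (insert q s)" by (rule eqv_mono_merge[OF q m(2)])
  have "(a q, c q) \<in> eqv (insert q s)" by (rule eqv_pairs(3)[OF q(1)]) simp
  then have "(a p, c p) \<in> eqv (insert q s)"
    using * le by (meson eqv_sym eqv_trans subsetD)
  then show "\<not> merges p (insert q s)" by (simp add: merges_def)
qed

text \<open>
  If both crossings connect the same two circles, then the second change can only split the merged circle.
  Both orders split it into the same two circles, or both leave it unchanged.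
\<close>

lemma merge_then_split_same_circles:
  assumes p: "p \<in> X" "p \<notin> s" and q: "q \<in> X" "q \<notin> s" and "p \<noteq> q"
    and m: "merges p s" "merges q s" "\<not> merges q (insert p s)"
  defines "t \<equiv> insert p (insert q s)"
  shows "(a p, b p) \<in> eqv t \<and> (a q, b q) \<in> eqv t \<or>
    (a p, a q) \<in> eqv t \<and> (b p, b q) \<in> eqv t \<or> (a p, b q) \<in> eqv t \<and> (b p, a q) \<in> eqv t"
proof -
  have t: "t = insert q (insert p s)" by (auto simp: t_def)
  have pq: "p \<notin> insert q s" "q \<notin> insert p s" using p q \<open>p \<noteq> q\<close> by auto
  note same = merge_merge_same_pair[OF p q \<open>p \<noteq> q\<close> m]
  have lep: "eqv s \<subseteq> eqv (insert p s)" by (rule eqv_mono_merge[OF p m(1)])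
  have leq: "eqv s \<subseteq> eqv (insert q s)" by (rule eqv_mono_merge[OF q m(2)])
  have abs: "(a p, b p) \<in> eqv s" "(a q, b q) \<in> eqv s" using eqv_pairs(1) p q by blast+
  show ?thesis
  proof (cases "(a q, b q) \<in> eqv t")
    case True
    then have "eqv (insert p s) = eqv t"
      using eqv_single[OF q(1) pq(2) m(3)] unfolding t by blast
    then show ?thesis using True abs lep by blast
  next
    case q_split: False
    show ?thesis
    proof (cases "(a p, b p) \<in> eqv t")
      case True
      then have "eqv (insert q s) = eqv t"
        using eqv_single[OF p(1) pq(1) same(2)] unfolding t_def by blast
      then show ?thesis using True abs leq by blast
    next
      case p_split: False
      have j: "eqv (insert p s) = joined (eqv t) (a q) (b q)"
        using eqv_split_off[OF q(1) pq(2) m(3)] q_split unfolding t by blast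
      have pc: "(a p, c p) \<in> eqv (insert p s)" by (rule eqv_pairs(3)[OF p(1)]) simp
      have "(a p, a q) \<in> eqv (insert p s)"
        using same(1) lep pc by (meson eqv_sym eqv_trans subsetD)
      moreover have "(b p, a q) \<in> eqv (insert p s)"
        using calculation abs(1) lep by (meson eqv_sym eqv_trans subsetD)
      ultimately have "(a p, a q) \<in> eqv t \<or> (a p, b q) \<in> eqv t" "(b p, a q) \<in> eqv t \<or> (b p, b q) \<in> eqv t"
        unfolding j joined_def by blast+
      moreover have "\<not> ((a p, x) \<in> eqv t \<and> (b p, x) \<in> eqv t)" for x
        using p_split by (meson eqv_sym eqv_trans)
      ultimately show ?thesis by blast
    qed
  qed
qed

text \<open>
  The circle that \<open>p\<close> splits carries all ends at \<open>q\<close>, so a subsequent merge at \<open>q\<close> reunites the two parts.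
  Then \<open>x\<^sub>a + x\<^sub>b = 0\<close> in the final smoothing.
\<close>

lemma split_then_merge_connects:
  assumes p: "p \<in> X" "p \<notin> s" and q: "q \<in> X" "q \<notin> s" and "p \<noteq> q"
    and m: "\<not> merges p s" "\<not> merges q s" "merges q (insert p s)"
  shows "(a p, b p) \<in> eqv (insert q (insert p s))"
proof -
  let ?sp = "insert p s" and ?t = "insert q (insert p s)"
  have q': "q \<notin> ?sp" using q \<open>p \<noteq> q\<close> by simp
  have aq: "(a q, c q) \<in> eqv s" "(a q, c q) \<notin> eqv ?sp" using m by (simp_all add: merges_def)
  then have "(a p, b p) \<notin> eqv ?sp" using eqv_single[OF p m(1)] by auto
  then have "eqv s = joined (eqv ?sp) (a p) (b p)" by (rule eqv_split_off[OF p m(1)])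
  then have 1: "(a q, a p) \<in> eqv ?sp \<and> (b p, c q) \<in> eqv ?sp \<or> (a q, b p) \<in> eqv ?sp \<and> (a p, c q) \<in> eqv ?sp"
    using aq unfolding joined_def by blast
  have le: "eqv ?sp \<subseteq> eqv ?t" by (rule eqv_mono_merge[OF q(1) q' m(3)])
  have "(a q, c q) \<in> eqv ?t" by (rule eqv_pairs(3)[OF q(1)]) simp
  then show ?thesis using 1 le by (meson eqv_sym eqv_trans subsetD)
qed

lemma edge_factor_zero: "edge_factor m p t (\<lambda>R. 0) = (\<lambda>R. 0)"
  by (simp add: edge_factor_def lower_zero)

text \<open>
  The two products of factors agree.  If \<open>p\<close> merges and \<open>q\<close> does not (or conversely), each of them does
  so in both orders.  If neither merges at first, a later merge makes both products vanish, and
  without one the factors commute.  If both merge at first, then either both merge later, or neither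
  does and their factors are equal.
\<close>

lemma paths_commute_top:
  assumes p: "p \<in> X" "p \<notin> s" and q: "q \<in> X" "q \<notin> s" and pq: "p \<noteq> q"
    and R: "R \<subseteq> circ (insert q (insert p s))"
  shows "paths p q s (circ s) R = paths q p s (circ s) R"
proof -
  define t where "t = insert q (insert p s)"
  have t': "insert p (insert q s) = t" by (auto simp: t_def)
  have qp: "q \<notin> insert p s" "p \<notin> insert q s" using p q pq by auto
  define \<delta> where "\<delta> = (\<lambda>R. of_bool (R = circ t) :: bit)"
  have 1: "paths p q s (circ s) R = edge_factor (merges p s) p t (edge_factor (merges q (insert p s)) q t \<delta>) R"
    using paths_top[OF p q(1) qp(1) R] by (simp add: t_def \<delta>_def)
  have 2: "paths q p s (circ s) R = edge_factor (merges q s) q t (edge_factor (merges p (insert q s)) p t \<delta>) R"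
    using paths_top[OF q p(1) qp(2)] R t' by (simp add: t_def \<delta>_def)
  have "edge_factor (merges p s) p t (edge_factor (merges q (insert p s)) q t \<delta>)
      = edge_factor (merges q s) q t (edge_factor (merges p (insert q s)) p t \<delta>)"
  proof (cases "merges p s"; cases "merges q s")
    assume m: "merges p s" "merges q s"
    show ?thesis
    proof (cases "merges q (insert p s)")
      case True
      then have "merges p (insert q s)"
        using merge_merge_same_pair(2)[OF q p _ m(2,1)] pq by blast
      then show ?thesis using m True by (simp add: edge_factor_def)
    next
      case False
      then have F: "\<not> merges p (insert q s)"
        using merge_merge_same_pair(2)[OF p q pq m] by blast
      have "(\<lambda>R. lower (cls t (a p)) \<delta> R + lower (cls t (b p)) \<delta> R)
          = (\<lambda>R. lower (cls t (a q)) \<delta> R + lower (cls t (b q)) \<delta> R)"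
        using merge_then_split_same_circles[OF p q pq m False]
      proof (elim disjE conjE)
        assume "(a p, b p) \<in> eqv (insert p (insert q s))" "(a q, b q) \<in> eqv (insert p (insert q s))"
        then have e: "cls t (a p) = cls t (b p)" "cls t (a q) = cls t (b q)" by (simp_all add: cls_eq_iff t')
        show ?thesis unfolding lower_same[OF e(1)] lower_same[OF e(2)] ..
      next
        assume "(a p, a q) \<in> eqv (insert p (insert q s))" "(b p, b q) \<in> eqv (insert p (insert q s))"
        then have "cls t (a p) = cls t (a q)" "cls t (b p) = cls t (b q)" by (simp_all add: cls_eq_iff t')
        then show ?thesis by simp
      next
        assume "(a p, b q) \<in> eqv (insert p (insert q s))" "(b p, a q) \<in> eqv (insert p (insert q s))"
        then have "cls t (a p) = cls t (b q)" "cls t (b p) = cls t (a q)" by (simp_all add: cls_eq_iff t')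
        then show ?thesis by (simp add: add.commute)
      qed
      then show ?thesis using m False F by (simp add: edge_factor_def)
    qed
  next
    assume m: "merges p s" "\<not> merges q s"
    then show ?thesis
      using merges_if_not_merges[OF p q pq m] by (simp add: edge_factor_def)
  next
    assume m: "\<not> merges p s" "merges q s"
    then show ?thesis
      using merges_if_not_merges[OF q p pq[symmetric] m(2,1)] by (simp add: edge_factor_def)
  next
    assume m: "\<not> merges p s" "\<not> merges q s"
    have P0: "edge_factor False p t f = (\<lambda>R. 0)" if "merges q (insert p s)" for f
      using split_then_merge_connects[OF p q pq m that]
      by (simp add: edge_factor_def lower_same cls_eq_iff t_def)
    have Q0: "edge_factor False q t f = (\<lambda>R. 0)" if "merges p (insert q s)" for f
      using split_then_merge_connects[OF q p pq[symmetric] m(2,1) that]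
      by (simp add: edge_factor_def lower_same cls_eq_iff t')
    show ?thesis
    proof (cases "merges q (insert p s)"; cases "merges p (insert q s)")
      assume "merges q (insert p s)" "merges p (insert q s)"
      then show ?thesis using m P0 Q0 by simp
    next
      assume "merges q (insert p s)" "\<not> merges p (insert q s)"
      then show ?thesis using m P0 by (simp add: edge_factor_zero)
    next
      assume "\<not> merges q (insert p s)" "merges p (insert q s)"
      then show ?thesis using m Q0 by (simp add: edge_factor_zero)
    next
      assume n: "\<not> merges q (insert p s)" "\<not> merges p (insert q s)"
      have "edge_factor False p t (edge_factor False q t \<delta>) = edge_factor False q t (edge_factor False p t \<delta>)"
        unfolding edge_factor_def if_False lower_add
        by (simp add: lower_commute[of "cls t (a q)"] lower_commute[of "cls t (b q)"] add_ac)
      then show ?thesis using m n by simp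
    qed
  qed
  then show ?thesis using 1 2 by simp
qed

text \<open>
  Induction on the number of labels \<open>v\<^sub>-\<close>: each of them is the result of \<open>lower\<close>, which commutes with both
  paths.
\<close>

lemma paths_commute:
  assumes p: "p \<in> X" "p \<notin> s" and q: "q \<in> X" "q \<notin> s" and pq: "p \<noteq> q"
    and P: "P \<subseteq> circ s" and R: "R \<subseteq> circ (insert q (insert p s))"
  shows "paths p q s P R = paths q p s P R"
  using P R
proof (induction "card (circ s - P)" arbitrary: P R rule: less_induct)
  case less
  have t': "insert p (insert q s) = insert q (insert p s)" by auto
  have qp: "q \<notin> insert p s" "p \<notin> insert q s" using p q pq by auto
  show ?case
  proof (cases "P = circ s")
    case True
    then show ?thesis using paths_commute_top[OF p q pq less.prems(2)] by simp
  next
    case False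
    then obtain U where U: "U \<in> circ s" "U \<notin> P" using less.prems(1) by blast
    then obtain e where e: "e \<in> E" "U = cls s e" using circ_cls by blast
    define P' where "P' = insert U P"
    have P': "P' \<subseteq> circ s" "cls s e \<in> P'" "P = P' - {cls s e}"
      using U e less.prems(1) by (auto simp: P'_def)
    have "circ s - P' \<subset> circ s - P" using U by (auto simp: P'_def)
    then have lt: "card (circ s - P') < card (circ s - P)"
      by (intro psubset_card_mono finite_Diff finite_circ)
    have "lower (cls (insert q (insert p s)) e) (paths p q s P') R
        = lower (cls (insert q (insert p s)) e) (paths q p s P') R"
      unfolding lower_def using less.hyps[OF lt P'(1)] less.prems(2) cls_in_circ[OF e(1)] by simp
    then show ?thesis
      using paths_lower[OF p q(1) qp(1) e(1) P'(1,2) less.prems(2)]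
        paths_lower[OF q p(1) qp(2) e(1) P'(1,2)] less.prems(2) P'(3) t' by simp
  qed
qed

definition state_edge :: "'p set \<times> 'e set set \<Rightarrow> 'p set \<times> 'e set set \<Rightarrow> bool" where
  "state_edge = (\<lambda>(s, P) (s', P'). (\<exists>p\<in>X. p \<notin> s \<and> s' = insert p s) \<and> kedge (circ s) (circ s') P P')"

text \<open>
  The paths from one generator to another one go through the two intermediate smoothings of a square,
  and the contributions of these cancel modulo two.
\<close>

lemma state_edge_square_zero:
  assumes g: "s \<subseteq> X" "P \<subseteq> circ s" and h: "t \<subseteq> X" "R \<subseteq> circ t"
  shows "(\<Sum>m\<in>Sigma (Pow X) (\<lambda>s. Pow (circ s)). of_bool (state_edge (s, P) m) * of_bool (state_edge m (t, R)) :: bit) = 0"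
proof (cases "\<exists>p q. p \<in> X \<and> q \<in> X \<and> p \<noteq> q \<and> p \<notin> s \<and> q \<notin> s \<and> t = insert q (insert p s)")
  case False
  have "\<not> (state_edge (s, P) m \<and> state_edge m (t, R))" for m
  proof
    assume "state_edge (s, P) m \<and> state_edge m (t, R)"
    then obtain p q where "p \<in> X" "p \<notin> s" "fst m = insert p s" "q \<in> X" "q \<notin> fst m" "t = insert q (fst m)"
      by (auto simp: state_edge_def split: prod.splits)
    then have "p \<in> X \<and> q \<in> X \<and> p \<noteq> q \<and> p \<notin> s \<and> q \<notin> s \<and> t = insert q (insert p s)" by auto
    with False show False by blast
  qed
  then show ?thesis by (intro sum.neutral ballI) auto
next
  case True
  then obtain p q where pq: "p \<in> X" "q \<in> X" "p \<noteq> q" "p \<notin> s" "q \<notin> s" and t: "t = insert q (insert p s)"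
    by blast
  define f where "f s' Q = (of_bool (state_edge (s, P) (s', Q)) * of_bool (state_edge (s', Q) (t, R)) :: bit)" for s' Q
  have sub: "insert p s \<in> Pow X" "insert q s \<in> Pow X" using pq g by auto
  have ne: "insert p s \<noteq> insert q s" using pq by auto
  have f0: "f s' Q = 0" if "s' \<noteq> insert p s" "s' \<noteq> insert q s" for s' Q
  proof -
    have "\<not> (state_edge (s, P) (s', Q) \<and> state_edge (s', Q) (t, R))"
    proof
      assume "state_edge (s, P) (s', Q) \<and> state_edge (s', Q) (t, R)"
      then obtain p' q' where *: "p' \<notin> s" "s' = insert p' s" "t = insert q' s'"
        by (auto simp: state_edge_def)
      then have "p' \<in> t" by simp
      then have "p' = p \<or> p' = q" using * t by auto
      then show False using * that by auto
    qed
    then show ?thesis by (auto simp: f_def)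
  qed
  have fp: "(\<Sum>Q\<in>Pow (circ (insert p s)). f (insert p s) Q) = paths p q s P R"
  proof -
    have "(\<exists>p'\<in>X. p' \<notin> s \<and> insert p s = insert p' s)" "(\<exists>q'\<in>X. q' \<notin> insert p s \<and> t = insert q' (insert p s))"
      by (rule bexI[of _ p], use pq in simp_all, rule bexI[of _ q], use pq t in simp_all)
    then show ?thesis by (simp add: f_def paths_def state_edge_def t)
  qed
  have fq: "(\<Sum>Q\<in>Pow (circ (insert q s)). f (insert q s) Q) = paths q p s P R"
  proof -
    have t': "t = insert p (insert q s)" using t by auto
    have "(\<exists>p'\<in>X. p' \<notin> s \<and> insert q s = insert p' s)" "(\<exists>q'\<in>X. q' \<notin> insert q s \<and> t = insert q' (insert q s))"
      by (rule bexI[of _ q], use pq in simp_all, rule bexI[of _ p], use pq t' in simp_all)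
    then show ?thesis by (simp add: f_def paths_def state_edge_def t')
  qed
  have "(\<Sum>m\<in>Sigma (Pow X) (\<lambda>s. Pow (circ s)). of_bool (state_edge (s, P) m) * of_bool (state_edge m (t, R)) :: bit)
      = (\<Sum>(s', Q)\<in>Sigma (Pow X) (\<lambda>s. Pow (circ s)). f s' Q)"
    by (rule sum.cong) (auto simp: f_def)
  also have "\<dots> = (\<Sum>s'\<in>Pow X. \<Sum>Q\<in>Pow (circ s'). f s' Q)"
    using finite_X by (intro sum.Sigma[symmetric]) (auto simp: finite_circ)
  also have "\<dots> = (\<Sum>s'\<in>{insert p s, insert q s}. \<Sum>Q\<in>Pow (circ s'). f s' Q)"
    using finite_X sub f0 by (intro sum.mono_neutral_right) (auto intro!: sum.neutral)
  also have "\<dots> = paths p q s P R + paths q p s P R"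
    using ne by (simp add: fp fq)
  also have "\<dots> = 0"
    using paths_commute[OF pq(1,4,2,5,3) g(2)] h(2) t by simp
  finally show ?thesis .
qed

end

section \<open>Reflection\<close>

lemma reflect_linear: "linear (reflect \<nu>)"
  unfolding reflect_def by (rule linearI) (simp_all add: algebra_simps)

lemma reflect_scaleR: "reflect \<nu> (r *\<^sub>R x) = r *\<^sub>R reflect \<nu> x"
  by (rule linear_scale[OF reflect_linear])

lemma reflect_reflect:
  assumes "norm \<nu> = 1"
  shows "reflect \<nu> (reflect \<nu> x) = x"
proof -
  have "\<nu> \<bullet> \<nu> = 1" using assms by (simp add: norm_eq_1)
  then show ?thesis by (simp add: reflect_def inner_diff_right)
qed

lemma norm_reflect:
  assumes "norm \<nu> = 1"
  shows "norm (reflect \<nu> x) = norm x"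
proof -
  have "\<nu> \<bullet> \<nu> = 1" using assms by (simp add: norm_eq_1)
  then have "reflect \<nu> x \<bullet> reflect \<nu> x = x \<bullet> x"
    by (simp add: reflect_def inner_diff_right inner_diff_left inner_commute)
  then show ?thesis by (simp add: norm_eq_sqrt_inner)
qed

text \<open>
  The determinant of a reflection is \<open>- 1\<close>.
\<close>

lemma reflect_triple:
  assumes "norm \<nu> = 1"
  shows "reflect \<nu> x \<bullet> cross3 (reflect \<nu> y) (reflect \<nu> z) = - (x \<bullet> cross3 y z)"
proof -
  have "\<nu> \<bullet> \<nu> = 1" using assms by (simp add: norm_eq_1)
  then have n: "\<nu> $ 1 * \<nu> $ 1 + \<nu> $ 2 * \<nu> $ 2 + \<nu> $ 3 * \<nu> $ 3 = 1"
    by (simp add: inner_vec_def sum_3)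
  have coordinates: "(n1 * x1 + n2 * x2 + n3 * x3) * (n1 * (y2 * z3 - y3 * z2) + n2 * (y3 * z1 - y1 * z3) + n3 * (y1 * z2 - y2 * z1)) +
    (n1 * y1 + n2 * y2 + n3 * y3) * (x1 * (n2 * z3 - n3 * z2) + x2 * (n3 * z1 - n1 * z3) + x3 * (n1 * z2 - n2 * z1)) +
    (n1 * z1 + n2 * z2 + n3 * z3) * (x1 * (y2 * n3 - y3 * n2) + x2 * (y3 * n1 - y1 * n3) + x3 * (y1 * n2 - y2 * n1)) =
    (n1 * n1 + n2 * n2 + n3 * n3) * (x1 * (y2 * z3 - y3 * z2) + x2 * (y3 * z1 - y1 * z3) + x3 * (y1 * z2 - y2 * z1))"
    for n1 n2 n3 x1 x2 x3 y1 y2 y3 z1 z2 z3 :: real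
    by (simp add: algebra_simps)
  have zero: "\<nu> \<bullet> cross3 \<nu> w = 0" "\<nu> \<bullet> cross3 w \<nu> = 0" "w \<bullet> cross3 \<nu> \<nu> = 0" for w
    by (simp_all add: dot_cross_self)
  \<comment> \<open>Cramer's rule for the coordinates of \<open>\<nu>\<close> with respect to \<open>x\<close>, \<open>y\<close>, \<open>z\<close>.\<close>
  have expand: "(\<nu> \<bullet> x) * (\<nu> \<bullet> cross3 y z) + (\<nu> \<bullet> y) * (x \<bullet> cross3 \<nu> z) + (\<nu> \<bullet> z) * (x \<bullet> cross3 y \<nu>)
      = (\<nu> $ 1 * \<nu> $ 1 + \<nu> $ 2 * \<nu> $ 2 + \<nu> $ 3 * \<nu> $ 3) * (x \<bullet> cross3 y z)"
    by (simp add: cross3_def inner_vec_def sum_3) (rule coordinates)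
  have "reflect \<nu> x \<bullet> cross3 (reflect \<nu> y) (reflect \<nu> z) = x \<bullet> cross3 y z
      - 2 * ((\<nu> \<bullet> x) * (\<nu> \<bullet> cross3 y z) + (\<nu> \<bullet> y) * (x \<bullet> cross3 \<nu> z) + (\<nu> \<bullet> z) * (x \<bullet> cross3 y \<nu>))"
    unfolding reflect_def
    by (simp add: Cross3.left_diff_distrib Cross3.right_diff_distrib cross_mult_left cross_mult_right
        inner_diff_left inner_diff_right zero algebra_simps)
  then show ?thesis unfolding expand n by simp
qed

lemma image_reflect_image_reflect: "norm \<nu> = 1 \<Longrightarrow> reflect \<nu> ` (reflect \<nu> ` A) = A"
  by (simp add: image_image reflect_reflect)

section \<open>Reparametrisation of immersed curves\<close>

lemma has_vector_derivative_slope: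
  assumes "(f has_vector_derivative v) (at x)"
  shows "((\<lambda>y. (1 / (y - x)) *\<^sub>R (f y - f x)) \<longlongrightarrow> v) (at x)"
proof -
  have "((\<lambda>y. norm (f y - f x - (y - x) *\<^sub>R v) / norm (y - x)) \<longlongrightarrow> 0) (at x)"
    using assms unfolding has_vector_derivative_def has_derivative_iff_norm by simp
  moreover have "\<forall>\<^sub>F y in at x. norm (f y - f x - (y - x) *\<^sub>R v) / norm (y - x)
      = norm ((1 / (y - x)) *\<^sub>R (f y - f x) - v)"
    unfolding eventually_at_filter
  proof (rule always_eventually, intro allI impI)
    fix y assume "y \<noteq> x"
    then have "(1 / (y - x)) *\<^sub>R (f y - f x) - v = (1 / (y - x)) *\<^sub>R (f y - f x - (y - x) *\<^sub>R v)"
      by (simp add: scaleR_diff_right)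
    then show "norm (f y - f x - (y - x) *\<^sub>R v) / norm (y - x) = norm ((1 / (y - x)) *\<^sub>R (f y - f x) - v)"
      by simp
  qed
  ultimately have "((\<lambda>y. norm ((1 / (y - x)) *\<^sub>R (f y - f x) - v)) \<longlongrightarrow> 0) (at x)"
    by (rule Lim_transform_eventually)
  then show ?thesis by (rule LIM_zero_cancel[OF tendsto_norm_zero_cancel])
qed

text \<open>
  A continuous change of parameter between two immersed curves is differentiable with nonzero derivative
  \<open>r\<close>: the difference quotient of \<open>g\<close> is that of \<open>u\<close> times that of \<open>f\<close>, and taking the inner product with \<open>v\<close>
  isolates the difference quotient of \<open>u\<close>.  The sign of \<open>r\<close> decides whether \<open>u\<close> preserves the two sides.
\<close>

lemma reparametrisation:
  fixes f g :: "real \<Rightarrow> 'a::real_inner" and u :: "real \<Rightarrow> real"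
  assumes f: "(f has_vector_derivative v) (at s0)" and v: "v \<noteq> 0"
    and g: "(g has_vector_derivative w) (at t0)" and w: "w \<noteq> 0"
    and u: "(u \<longlongrightarrow> s0) (at t0)"
    and fu: "\<forall>\<^sub>F t in at t0. f (u t) = g t" and fu0: "f s0 = g t0"
  obtains r where "r \<noteq> 0" "w = r *\<^sub>R v"
    "r > 0 \<Longrightarrow> filterlim u (at_right s0) (at_right t0) \<and> filterlim u (at_left s0) (at_left t0)"
    "r < 0 \<Longrightarrow> filterlim u (at_left s0) (at_right t0) \<and> filterlim u (at_right s0) (at_left t0)"
proof -
  \<comment> \<open>The difference quotient of \<open>f\<close>, extended continuously by the derivative.\<close>
  define G where "G y = (if y = s0 then v else (1 / (y - s0)) *\<^sub>R (f y - f s0))" for y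
  define q where "q t = (u t - s0) / (t - t0)" for t
  have Gs0: "G s0 = v" by (simp add: G_def)
  have fG: "f y - f s0 = (y - s0) *\<^sub>R G y" for y by (simp add: G_def)
  have "((\<lambda>y. (1 / (y - s0)) *\<^sub>R (f y - f s0)) \<longlongrightarrow> v) (at s0)"
    by (rule has_vector_derivative_slope[OF f])
  then have "(G \<longlongrightarrow> v) (at s0)"
    by (rule Lim_transform_eventually) (auto simp: G_def eventually_at intro: exI[of _ 1])
  then have "isCont G s0" by (simp add: isCont_def Gs0)
  then have Gu: "((\<lambda>t. G (u t)) \<longlongrightarrow> v) (at t0)"
    using isCont_tendsto_compose[OF _ u, of G] unfolding Gs0 by blast
  have gq: "((\<lambda>t. (1 / (t - t0)) *\<^sub>R (g t - g t0)) \<longlongrightarrow> w) (at t0)"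
    by (rule has_vector_derivative_slope[OF g])
  have eq: "\<forall>\<^sub>F t in at t0. (1 / (t - t0)) *\<^sub>R (g t - g t0) = q t *\<^sub>R G (u t)"
    using fu
  proof eventually_elim
    case (elim t)
    then have "g t - g t0 = (u t - s0) *\<^sub>R G (u t)" using fG[of "u t"] fu0 by simp
    then show ?case by (simp add: q_def)
  qed
  have qG: "((\<lambda>t. q t *\<^sub>R G (u t)) \<longlongrightarrow> w) (at t0)"
    by (rule Lim_transform_eventually[OF gq eq])
  define r where "r = (w \<bullet> v) / (v \<bullet> v)"
  have vv: "v \<bullet> v > 0" using v by simp
  have "((\<lambda>t. (q t *\<^sub>R G (u t)) \<bullet> v / (G (u t) \<bullet> v)) \<longlongrightarrow> r) (at t0)"
    unfolding r_def by (intro tendsto_intros qG Gu) (use vv in simp)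
  moreover have "\<forall>\<^sub>F t in at t0. (q t *\<^sub>R G (u t)) \<bullet> v / (G (u t) \<bullet> v) = q t"
  proof -
    have "((\<lambda>t. G (u t) \<bullet> v) \<longlongrightarrow> v \<bullet> v) (at t0)" by (intro tendsto_intros Gu)
    then have "\<forall>\<^sub>F t in at t0. G (u t) \<bullet> v > 0" using vv by (rule order_tendstoD(1))
    then show ?thesis by eventually_elim simp
  qed
  ultimately have q: "(q \<longlongrightarrow> r) (at t0)" by (rule Lim_transform_eventually)
  have "((\<lambda>t. q t *\<^sub>R G (u t)) \<longlongrightarrow> r *\<^sub>R v) (at t0)" by (intro tendsto_intros q Gu)
  then have w': "w = r *\<^sub>R v" by (rule tendsto_unique[OF at_neq_bot qG])
  then have "r \<noteq> 0" using w by auto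
  have ur: "(u \<longlongrightarrow> s0) (at_right t0)" and ul: "(u \<longlongrightarrow> s0) (at_left t0)"
    by (rule tendsto_mono[OF at_le u], simp)+
  have right_side: "\<forall>\<^sub>F t in at_right t0. t > t0" and left_side: "\<forall>\<^sub>F t in at_left t0. t < t0"
    by (simp_all add: eventually_at_filter)
  have "filterlim u (at_right s0) (at_right t0) \<and> filterlim u (at_left s0) (at_left t0)" if "r > 0"
  proof -
    have "\<forall>\<^sub>F t in at t0. q t > 0" by (rule order_tendstoD(1)[OF q that])
    then have "\<forall>\<^sub>F t in at t0. (t > t0 \<longrightarrow> u t > s0) \<and> (t < t0 \<longrightarrow> u t < s0)"
      by eventually_elim (auto simp: q_def zero_less_divide_iff)
    note sides = filter_leD[OF at_le[OF subset_UNIV] this]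
    have "\<forall>\<^sub>F t in at_right t0. u t > s0" using sides right_side by eventually_elim simp
    moreover have "\<forall>\<^sub>F t in at_left t0. u t < s0" using sides left_side by eventually_elim simp
    ultimately show ?thesis
      by (intro conjI tendsto_imp_filterlim_at_right tendsto_imp_filterlim_at_left ur ul)
  qed
  moreover have "filterlim u (at_left s0) (at_right t0) \<and> filterlim u (at_right s0) (at_left t0)" if "r < 0"
  proof -
    have "\<forall>\<^sub>F t in at t0. q t < 0" by (rule order_tendstoD(2)[OF q that])
    then have "\<forall>\<^sub>F t in at t0. (t > t0 \<longrightarrow> u t < s0) \<and> (t < t0 \<longrightarrow> u t > s0)"
      by eventually_elim (auto simp: q_def divide_less_0_iff)
    note sides = filter_leD[OF at_le[OF subset_UNIV] this]
    have "\<forall>\<^sub>F t in at_right t0. u t < s0" using sides right_side by eventually_elim simp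
    moreover have "\<forall>\<^sub>F t in at_left t0. u t > s0" using sides left_side by eventually_elim simp
    ultimately show ?thesis
      by (intro conjI tendsto_imp_filterlim_at_right tendsto_imp_filterlim_at_left ur ul)
  qed
  ultimately show thesis by (rule that[OF \<open>r \<noteq> 0\<close> w'])
qed

section \<open>Components\<close>

lemma components_involution:
  fixes R :: "'a::topological_space \<Rightarrow> 'a"
  assumes cont: "continuous_on UNIV R" and RR: "\<And>x. R (R x) = x" and G: "R ` G = G" and A: "A \<in> components G"
  shows "R ` A \<in> components G"
proof -
  have RRA: "R ` R ` B = B" for B by (simp add: image_image RR)
  have conn: "connected (R ` B)" if "connected B" for B
    by (rule connected_continuous_image[OF continuous_on_subset[OF cont subset_UNIV] that])
  have max: "D \<noteq> {} \<and> A \<subseteq> D \<and> D \<subseteq> G \<and> connected D \<longrightarrow> D = A" for D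
    using A unfolding in_components_maximal by (elim conjE allE[of _ D])
  have "R ` A \<noteq> {} \<and> R ` A \<subseteq> G \<and> connected (R ` A) \<and>
      (\<forall>B. B \<noteq> {} \<and> R ` A \<subseteq> B \<and> B \<subseteq> G \<and> connected B \<longrightarrow> B = R ` A)"
  proof (intro conjI allI impI)
    show "R ` A \<noteq> {}" using in_components_nonempty[OF A] by simp
    show "R ` A \<subseteq> G" using image_mono[OF in_components_subset[OF A], of R] G by simp
    show "connected (R ` A)" by (rule conn[OF in_components_connected[OF A]])
    fix B assume B: "B \<noteq> {} \<and> R ` A \<subseteq> B \<and> B \<subseteq> G \<and> connected B"
    have "A \<subseteq> R ` B" using image_mono[of "R ` A" B R] B RRA by simp
    moreover have "R ` B \<subseteq> G" using image_mono[of B G R] B G by simp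
    moreover have "connected (R ` B)" using B conn by blast
    moreover have "R ` B \<noteq> {}" using B by simp
    ultimately have "R ` B = A" using max by simp
    then have "R ` (R ` B) = R ` A" by (rule arg_cong)
    then show "B = R ` A" unfolding RRA .
  qed
  then show ?thesis unfolding in_components_maximal .
qed

section \<open>Cyclic successors\<close>

definition cyclic_succ :: "'a::linorder set \<Rightarrow> 'a \<Rightarrow> 'a" where
  "cyclic_succ T t = (if \<exists>t'\<in>T. t < t' then Min {t' \<in> T. t < t'} else Min T)"

lemma cyclic_succ_in: "finite T \<Longrightarrow> t \<in> T \<Longrightarrow> cyclic_succ T t \<in> T"
  unfolding cyclic_succ_def using Min_in[of T] Min_in[of "{t' \<in> T. t < t'}"] by (cases "T = {}") auto

lemma inj_on_cyclic_succ:
  assumes fin: "finite T"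
  shows "inj_on (cyclic_succ T) T"
proof -
  have "\<not> (t1 < t2 \<and> cyclic_succ T t1 = cyclic_succ T t2)" if t: "t1 \<in> T" "t2 \<in> T" for t1 t2
  proof
    assume *: "t1 < t2 \<and> cyclic_succ T t1 = cyclic_succ T t2"
    have fin1: "finite {t' \<in> T. t1 < t'}" "finite {t' \<in> T. t2 < t'}" using fin by auto
    have "\<exists>t'\<in>T. t1 < t'" using * t by blast
    then have s1: "cyclic_succ T t1 = Min {t' \<in> T. t1 < t'}" by (simp add: cyclic_succ_def)
    have le: "cyclic_succ T t1 \<le> t2" unfolding s1 using fin1 t * by (intro Min_le) auto
    have gt: "t1 < cyclic_succ T t1" unfolding s1 using Min_in[OF fin1(1)] t * by blast
    show False
    proof (cases "\<exists>t'\<in>T. t2 < t'")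
      case True
      then have "t2 < cyclic_succ T t2" using Min_in[OF fin1(2)] by (auto simp: cyclic_succ_def)
      then show False using le * by simp
    next
      case False
      then have "cyclic_succ T t2 = Min T" by (simp add: cyclic_succ_def)
      then have "cyclic_succ T t2 \<le> t1" using fin t by simp
      then show False using gt * by simp
    qed
  qed
  then show ?thesis unfolding inj_on_def by (metis linorder_neqE)
qed

section \<open>The projection of an involutive link\<close>

lemma smooth_curve_differentiable:
  "smooth_curve f \<Longrightarrow> f differentiable (at t)"
  unfolding smooth_curve_def differentiable_def has_vector_derivative_def by metis

text \<open>
  The link \<open>K\<close> is the representative whose projection is the given diagram \<open>D\<close>.
\<close>

locale involutive_projection =
  fixes \<nu> :: "real^3" and K :: olink and D :: diagram
  assumes norm_nu: "norm \<nu> = 1"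
    and involutive: "involutive_link \<nu> K"
    and poles: "(0, 1) \<notin> underlying_set K" "(0, -1) \<notin> underlying_set K"
    and generic: "generic_projection K"
    and D_def: "D = diagram_of K"
begin

abbreviation "n \<equiv> ncomp K"
abbreviation "R \<equiv> reflect \<nu>"

lemma ncurves: "ncurves D = n" and curve: "curve D c t = sgn (fst (strand K c t))"
  and over_iff: "((c, t), (c', t')) \<in> over D \<longleftrightarrow>
     (c, t) \<in> params n \<and> (c', t') \<in> params n \<and> curve D c t = curve D c' t' \<and>
     snd (strand K c t) > snd (strand K c' t')"
  by (auto simp: D_def diagram_of_def proj_sphere_def)

lemma link: "oriented_link K"
  using involutive by (simp add: involutive_link_def)

lemma strand:
  assumes "c < n"
  shows "strand K c differentiable (at t)" "strand K c (t + 1) = strand K c t"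
    "norm (strand K c t) = 1" "strand K c t \<in> underlying_set K"
proof -
  have "smooth_curve (strand K c)" "\<forall>t. strand K c (t + 1) = strand K c t" "range (strand K c) \<subseteq> sphere 0 1"
    using link assms by (auto simp: oriented_link_def)
  then show "strand K c differentiable (at t)" "strand K c (t + 1) = strand K c t" "norm (strand K c t) = 1"
    by (auto simp: smooth_curve_differentiable image_subset_iff)
  show "strand K c t \<in> underlying_set K" using assms by (auto simp: underlying_set_def)
qed

lemma strand_plus_int: "c < n \<Longrightarrow> strand K c (t + of_int k) = strand K c t"
proof (induction k rule: int_induct[of _ 0])
  case (step1 i)
  then show ?case using strand(2)[of c "t + of_int i"] by (simp add: add.assoc)
next
  case (step2 i)
  then show ?case using strand(2)[of c "t + of_int (i - 1)"] by (simp add: add.assoc)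
qed simp

lemma strand_frac: "c < n \<Longrightarrow> strand K c (frac t) = strand K c t"
  using strand_plus_int[of c "frac t" "\<lfloor>t\<rfloor>"] by (simp add: frac_def)

lemma params_frac: "c < n \<Longrightarrow> (c, frac t) \<in> params n"
  by (simp add: params_def frac_lt_1)

lemma strand_inj:
  assumes "c < n" "c' < n" "strand K c t = strand K c' t'"
  shows "c = c'" "frac t = frac t'"
proof -
  have "inj_on (\<lambda>(c, t). strand K c t) (params n)" using link by (simp add: oriented_link_def)
  moreover have "(\<lambda>(c, t). strand K c t) (c, frac t) = (\<lambda>(c, t). strand K c t) (c', frac t')"
    using assms by (simp add: strand_frac)
  ultimately have "(c, frac t) = (c', frac t')"
    by (rule inj_onD) (use assms params_frac in simp_all)
  then show "c = c'" "frac t = frac t'" by simp_all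
qed

lemma strand_continuous: "c < n \<Longrightarrow> continuous_on S (strand K c)"
  using strand(1) differentiable_imp_continuous_within by (meson continuous_at_imp_continuous_on)

lemma fst_strand_nonzero:
  assumes "c < n"
  shows "fst (strand K c t) \<noteq> 0"
proof
  assume z: "fst (strand K c t) = 0"
  obtain x h where xh: "strand K c t = (x, h)" by fastforce
  have "norm (strand K c t) = \<bar>h\<bar>" using z xh by (simp add: norm_Pair)
  then have "h = 1 \<or> h = -1" using strand(3)[OF assms, of t] by auto
  then show False using z xh poles strand(4)[OF assms, of t] by auto
qed

lemma curve_frac: "c < n \<Longrightarrow> curve D c (frac t) = curve D c t"
  by (simp add: curve strand_frac)

lemma curve_plus_int: "c < n \<Longrightarrow> curve D c (t + of_int k) = curve D c t"
  by (simp add: curve strand_plus_int)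

lemma curve_differentiable:
  assumes "c < n"
  shows "curve D c differentiable (at t)"
proof -
  have f: "(\<lambda>t. fst (strand K c t)) differentiable (at t)"
    using strand(1)[OF assms] unfolding differentiable_def by (metis has_derivative_fst)
  have "(\<lambda>t. norm (fst (strand K c t))) differentiable (at t)"
    using differentiable_compose[OF differentiable_norm_at[OF fst_strand_nonzero[OF assms]] f] .
  then have "(\<lambda>t. inverse (norm (fst (strand K c t)))) differentiable (at t)"
    by (rule differentiable_inverse) (use fst_strand_nonzero[OF assms] in simp)
  then have "(\<lambda>t. inverse (norm (fst (strand K c t))) *\<^sub>R fst (strand K c t)) differentiable (at t)"
    using f by (rule differentiable_scaleR)
  moreover have "curve D c = (\<lambda>t. inverse (norm (fst (strand K c t))) *\<^sub>R fst (strand K c t))"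
    by (auto simp: curve sgn_div_norm)
  ultimately show ?thesis by simp
qed

lemma curve_continuous: "c < n \<Longrightarrow> continuous_on S (curve D c)"
  using curve_differentiable differentiable_imp_continuous_within by (meson continuous_at_imp_continuous_on)

lemma tangent_derivative:
  "c < n \<Longrightarrow> (curve D c has_vector_derivative tangent D (c, t)) (at t)"
  using curve_differentiable vector_derivative_works by (auto simp: tangent_def)

lemma generic_facts:
  shows "x \<in> params n \<Longrightarrow> tangent D x \<noteq> 0" and "finite (crossings D)"
    and "\<lbrakk>x \<in> params n; y \<in> params n; z \<in> params n; pt D x = pt D y; pt D y = pt D z\<rbrakk> \<Longrightarrow> x = y \<or> y = z \<or> x = z"
    and "(x, y) \<in> over D \<Longrightarrow> pt D x \<bullet> cross3 (tangent D x) (tangent D y) \<noteq> 0"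
  using generic unfolding generic_projection_def Let_def D_def[symmetric] ncurves by auto

lemma overD:
  assumes "(x, y) \<in> over D"
  shows "x \<in> params n" "y \<in> params n" "pt D x = pt D y" "x \<noteq> y" "(y, x) \<notin> over D" "pt D x \<in> crossings D"
proof -
  obtain c t c' t' where xy: "x = (c, t)" "y = (c', t')" by fastforce
  show "x \<in> params n" "y \<in> params n" "pt D x = pt D y" "x \<noteq> y" "(y, x) \<notin> over D"
    using assms unfolding xy over_iff by (auto simp: pt_def)
  show "pt D x \<in> crossings D" using assms unfolding crossings_def by blast
qed

lemma over_under_param:
  assumes "(x, y) \<in> over D"
  shows "over_param D (pt D x) = x" "under_param D (pt D x) = y"
    "z \<in> params n \<Longrightarrow> pt D z = pt D x \<Longrightarrow> z = x \<or> z = y"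
proof -
  note xy = overD[OF assms]
  show only: "z = x \<or> z = y" if "z \<in> params n" "pt D z = pt D x" for z
    using generic_facts(3)[OF that(1) xy(1,2) that(2) xy(3)] xy(4) by blast
  show "over_param D (pt D x) = x"
    unfolding over_param_def
  proof (rule the_equality)
    show "pt D x = pt D x \<and> (\<exists>y. (x, y) \<in> over D)" using assms by blast
    fix z assume z: "pt D z = pt D x \<and> (\<exists>y. (z, y) \<in> over D)"
    then obtain w where w: "(z, w) \<in> over D" by blast
    note zw = overD[OF w]
    have "z = x \<or> z = y" using only zw z by blast
    moreover have "w = x \<or> w = y" using only[OF zw(2)] zw(3) z by simp
    ultimately show "z = x" using zw(4) w xy(5) by blast
  qed
  show "under_param D (pt D x) = y"
    unfolding under_param_def
  proof (rule the_equality)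
    show "pt D y = pt D x \<and> (\<exists>x. (x, y) \<in> over D)" using assms xy(3) by metis
    fix z assume z: "pt D z = pt D x \<and> (\<exists>x. (x, z) \<in> over D)"
    then obtain w where w: "(w, z) \<in> over D" by blast
    note zw = overD[OF w]
    have "z = x \<or> z = y" using only[OF zw(2)] z by blast
    moreover have "w = x \<or> w = y" using only[OF zw(1)] zw(3) z by simp
    ultimately show "z = y" using zw(4) w xy(5) by blast
  qed
qed

abbreviation "ov \<equiv> over_param D"
abbreviation "un \<equiv> under_param D"

lemma crossing:
  assumes "p \<in> crossings D"
  shows "(ov p, un p) \<in> over D" "pt D (ov p) = p" "pt D (un p) = p" "ov p \<in> params n" "un p \<in> params n"
    "ov p \<noteq> un p" "z \<in> params n \<Longrightarrow> pt D z = p \<Longrightarrow> z = ov p \<or> z = un p"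
proof -
  obtain x y where xy: "(x, y) \<in> over D" "p = pt D x" using assms by (auto simp: crossings_def)
  then have e: "ov p = x" "un p = y" using over_under_param by auto
  show "(ov p, un p) \<in> over D" "pt D (ov p) = p" "pt D (un p) = p" "ov p \<in> params n" "un p \<in> params n" "ov p \<noteq> un p"
    using overD[OF xy(1)] xy unfolding e by auto
  show "z \<in> params n \<Longrightarrow> pt D z = p \<Longrightarrow> z = ov p \<or> z = un p"
    using over_under_param(3)[OF xy(1)] xy(2) unfolding e by blast
qed

definition crossing_params :: "(nat \<times> real) set" where
  "crossing_params = {x \<in> params n. pt D x \<in> crossings D}"

lemma crossing_params_eq: "crossing_params = (\<Union>p\<in>crossings D. {ov p, un p})"
proof (intro equalityI subsetI)
  fix x assume "x \<in> crossing_params"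
  then have "x \<in> params n" "pt D x \<in> crossings D" by (auto simp: crossing_params_def)
  then show "x \<in> (\<Union>p\<in>crossings D. {ov p, un p})" using crossing(7)[of "pt D x" x] by blast
next
  fix x assume "x \<in> (\<Union>p\<in>crossings D. {ov p, un p})"
  then obtain p where "p \<in> crossings D" "x = ov p \<or> x = un p" by blast
  then show "x \<in> crossing_params" using crossing(2-5)[of p] by (auto simp: crossing_params_def)
qed

lemma finite_crossing_params: "finite crossing_params"
  unfolding crossing_params_eq using generic_facts(2) by simp

lemma sum_crossing_params:
  fixes f :: "nat \<times> real \<Rightarrow> nat"
  shows "(\<Sum>x\<in>crossing_params. f x) = (\<Sum>p\<in>crossings D. f (ov p) + f (un p))"
proof -
  have "(\<Sum>x\<in>crossing_params. f x) = (\<Sum>p\<in>crossings D. \<Sum>x\<in>{ov p, un p}. f x)"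
    unfolding crossing_params_eq
  proof (rule sum.UNION_disjoint)
    show "\<forall>p\<in>crossings D. \<forall>q\<in>crossings D. p \<noteq> q \<longrightarrow> {ov p, un p} \<inter> {ov q, un q} = {}"
    proof (intro ballI impI)
      fix p q assume pq: "p \<in> crossings D" "q \<in> crossings D" "p \<noteq> q"
      have "pt D x = p" if "x \<in> {ov p, un p}" for x using that crossing(2,3)[OF pq(1)] by auto
      moreover have "pt D x = q" if "x \<in> {ov q, un q}" for x using that crossing(2,3)[OF pq(2)] by auto
      ultimately show "{ov p, un p} \<inter> {ov q, un q} = {}" using pq(3) by (metis disjoint_iff)
    qed
  qed (use generic_facts(2) in auto)
  also have "\<dots> = (\<Sum>p\<in>crossings D. f (ov p) + f (un p))"
    using crossing(6) by (intro sum.cong) auto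
  finally show ?thesis .
qed

lemma curve_crossing_iff: "c < n \<Longrightarrow> curve D c t \<in> crossings D \<longleftrightarrow> (c, frac t) \<in> crossing_params"
  using params_frac[of c t] curve_frac[of c t] by (simp add: crossing_params_def pt_def)

text \<open>
  There are finitely many crossings and each has only two parameters, so the parameters of crossings are
  locally finite on the line.
\<close>

lemma crossing_free_neighbourhood:
  assumes c: "c < n"
  obtains \<delta> where "\<delta> > 0" "\<And>s. s \<noteq> t \<Longrightarrow> \<bar>s - t\<bar> < \<delta> \<Longrightarrow> curve D c s \<notin> crossings D"
proof -
  \<comment> \<open>All parameters of crossings at distance less than 1 from \<open>t\<close>, on any strand.\<close>
  define F where "F = (\<lambda>(x, k). snd x + real_of_int k) ` (crossing_params \<times> {\<lfloor>t\<rfloor> - 1 .. \<lfloor>t\<rfloor> + 1})"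
  have "finite F" unfolding F_def using finite_crossing_params by simp
  then obtain d where d: "d > 0" "\<forall>x\<in>F. x \<noteq> t \<longrightarrow> d \<le> dist t x" using finite_set_avoid by blast
  have "curve D c s \<notin> crossings D" if s: "s \<noteq> t" "\<bar>s - t\<bar> < min d 1" for s
  proof
    assume "curve D c s \<in> crossings D"
    then have "(c, frac s) \<in> crossing_params" using curve_crossing_iff[OF c] by simp
    moreover have "\<lfloor>s\<rfloor> \<in> {\<lfloor>t\<rfloor> - 1 .. \<lfloor>t\<rfloor> + 1}" using s(2) by (auto; linarith)
    moreover have "s = (\<lambda>(x, k). snd x + real_of_int k) ((c, frac s), \<lfloor>s\<rfloor>)" by (simp add: frac_def)
    ultimately have "s \<in> F" unfolding F_def by (metis (no_types, lifting) SigmaI image_eqI)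
    then show False using d s by (force simp: dist_real_def)
  qed
  then show thesis using that[of "min d 1"] d(1) by simp
qed

subsection \<open>Arcs\<close>

definition strands_off_crossings :: "(real^3) set" where
  "strands_off_crossings = (\<Union>c<n. range (curve D c)) - crossings D"

lemma arcs_eq: "arcs D = components strands_off_crossings"
  by (simp add: arcs_def strands_off_crossings_def ncurves)

lemma interval_in_arc:
  assumes c: "c < n" and uv: "u < v" and free: "\<And>s. u < s \<Longrightarrow> s < v \<Longrightarrow> curve D c s \<notin> crossings D"
  obtains A where "A \<in> arcs D" "curve D c ` {u<..<v} \<subseteq> A"
proof -
  have sub: "curve D c ` {u<..<v} \<subseteq> strands_off_crossings"
    using c free by (auto simp: strands_off_crossings_def)
  have conn: "connected (curve D c ` {u<..<v})"
    by (rule connected_continuous_image[OF curve_continuous[OF c]]) simp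
  have "strands_off_crossings \<noteq> {}" using sub uv dense[OF uv] by auto
  then show thesis
    using exists_component_superset[OF sub _ conn] that unfolding arcs_eq by blast
qed

lemma arc_out_unique:
  assumes "A \<in> arcs D" "\<forall>\<^sub>F s in at_right t. curve D c s \<in> A"
  shows "arc_out D (c, t) = A"
  unfolding arc_out_def
proof (rule the_equality)
  show "A \<in> arcs D \<and> (\<forall>\<^sub>F s in at_right (snd (c, t)). curve D (fst (c, t)) s \<in> A)" using assms by simp
  fix B assume B: "B \<in> arcs D \<and> (\<forall>\<^sub>F s in at_right (snd (c, t)). curve D (fst (c, t)) s \<in> B)"
  then have "\<forall>\<^sub>F s in at_right t. curve D c s \<in> A \<and> curve D c s \<in> B"
    using assms(2) by (simp add: eventually_conj)
  then obtain s where "curve D c s \<in> A \<and> curve D c s \<in> B"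
    using eventually_happens'[OF trivial_limit_at_right_real] by blast
  then have "B \<inter> A \<noteq> {}" by blast
  then show "B = A" using components_eq[of B strands_off_crossings A] B assms(1) unfolding arcs_eq by blast
qed

lemma arc_in_unique:
  assumes "A \<in> arcs D" "\<forall>\<^sub>F s in at_left t. curve D c s \<in> A"
  shows "arc_in D (c, t) = A"
  unfolding arc_in_def
proof (rule the_equality)
  show "A \<in> arcs D \<and> (\<forall>\<^sub>F s in at_left (snd (c, t)). curve D (fst (c, t)) s \<in> A)" using assms by simp
  fix B assume B: "B \<in> arcs D \<and> (\<forall>\<^sub>F s in at_left (snd (c, t)). curve D (fst (c, t)) s \<in> B)"
  then have "\<forall>\<^sub>F s in at_left t. curve D c s \<in> A \<and> curve D c s \<in> B"
    using assms(2) by (simp add: eventually_conj)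
  then obtain s where "curve D c s \<in> A \<and> curve D c s \<in> B"
    using eventually_happens'[OF trivial_limit_at_left_real] by blast
  then have "B \<inter> A \<noteq> {}" by blast
  then show "B = A" using components_eq[of B strands_off_crossings A] B assms(1) unfolding arcs_eq by blast
qed

lemma arc_at_ends:
  assumes "A \<in> arcs D" "curve D c ` {u<..<v} \<subseteq> A" "u < v"
  shows "arc_out D (c, u) = A" "arc_in D (c, v) = A"
proof -
  have "\<forall>\<^sub>F s in at_right u. curve D c s \<in> A"
    by (rule eventually_mono[OF eventually_at_right_real[OF assms(3)]]) (use assms(2) in auto)
  then show "arc_out D (c, u) = A" by (rule arc_out_unique[OF assms(1)])
  have "\<forall>\<^sub>F s in at_left v. curve D c s \<in> A"
    by (rule eventually_mono[OF eventually_at_left_real[OF assms(3)]]) (use assms(2) in auto)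
  then show "arc_in D (c, v) = A" by (rule arc_in_unique[OF assms(1)])
qed

lemma arc_out:
  assumes c: "c < n"
  shows "arc_out D (c, t) \<in> arcs D" "\<forall>\<^sub>F s in at_right t. curve D c s \<in> arc_out D (c, t)"
proof -
  obtain \<delta> where d: "\<delta> > 0" "\<And>s. s \<noteq> t \<Longrightarrow> \<bar>s - t\<bar> < \<delta> \<Longrightarrow> curve D c s \<notin> crossings D"
    using crossing_free_neighbourhood[OF c, of t] by blast
  have tv: "t < t + \<delta>" using d(1) by simp
  obtain A where A: "A \<in> arcs D" "curve D c ` {t<..<t + \<delta>} \<subseteq> A"
    by (rule interval_in_arc[OF c tv, of thesis]) (use d(2) in auto)
  have e: "arc_out D (c, t) = A" by (rule arc_at_ends(1)[OF A tv])
  show "arc_out D (c, t) \<in> arcs D" unfolding e by (rule A)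
  show "\<forall>\<^sub>F s in at_right t. curve D c s \<in> arc_out D (c, t)"
    unfolding e by (rule eventually_mono[OF eventually_at_right_real[OF tv]]) (use A(2) in auto)
qed

lemma arc_in:
  assumes c: "c < n"
  shows "arc_in D (c, t) \<in> arcs D" "\<forall>\<^sub>F s in at_left t. curve D c s \<in> arc_in D (c, t)"
proof -
  obtain \<delta> where d: "\<delta> > 0" "\<And>s. s \<noteq> t \<Longrightarrow> \<bar>s - t\<bar> < \<delta> \<Longrightarrow> curve D c s \<notin> crossings D"
    using crossing_free_neighbourhood[OF c, of t] by blast
  have tv: "t - \<delta> < t" using d(1) by simp
  obtain A where A: "A \<in> arcs D" "curve D c ` {t - \<delta><..<t} \<subseteq> A"
    by (rule interval_in_arc[OF c tv, of thesis]) (use d(2) in auto)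
  have e: "arc_in D (c, t) = A" by (rule arc_at_ends(2)[OF A tv])
  show "arc_in D (c, t) \<in> arcs D" unfolding e by (rule A)
  show "\<forall>\<^sub>F s in at_left t. curve D c s \<in> arc_in D (c, t)"
    unfolding e by (rule eventually_mono[OF eventually_at_left_real[OF tv]]) (use A(2) in auto)
qed

lemma arc_in_plus_one:
  assumes c: "c < n"
  shows "arc_in D (c, t + 1) = arc_in D (c, t)"
proof (rule arc_in_unique[OF arc_in(1)[OF c]])
  have "curve D c (s + 1) = curve D c s" for s using curve_plus_int[OF c, of s 1] by simp
  moreover have "at_left (t + 1) = filtermap (\<lambda>s. s + 1) (at_left t)"
    using filtermap_at_left_shift[of "-1" t] by simp
  ultimately show "\<forall>\<^sub>F s in at_left (t + 1). curve D c s \<in> arc_in D (c, t)"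
    using arc_in(2)[OF c, of t] by (simp add: eventually_filtermap)
qed

text \<open>
  A neighbourhood of a parameter \<open>t\<close> meets at most three arcs: those on the two sides and one through the
  point itself.  Finitely many such neighbourhoods cover a period.
\<close>

lemma finite_arcs: "finite (arcs D)"
proof -
  have "\<exists>F. finite F \<and> (\<forall>A\<in>arcs D. A \<inter> range (curve D c) \<noteq> {} \<longrightarrow> A \<in> F)" if c: "c < n" for c
  proof -
    have "\<exists>\<delta>>0. \<forall>s. s \<noteq> t \<longrightarrow> \<bar>s - t\<bar> < \<delta> \<longrightarrow> curve D c s \<notin> crossings D" for t
      using crossing_free_neighbourhood[OF c, of t] by metis
    then obtain \<delta> where d: "\<And>t. \<delta> t > 0" "\<And>t s. s \<noteq> t \<Longrightarrow> \<bar>s - t\<bar> < \<delta> t \<Longrightarrow> curve D c s \<notin> crossings D"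
      by metis
    have "{0..1} \<subseteq> (\<Union>t\<in>{0..1}. ball t (\<delta> t))" using d(1) by force
    then obtain T where T: "finite T" "{0..1} \<subseteq> (\<Union>t\<in>T. ball t (\<delta> t))"
      using compactE_image[of "{0..1::real}" "{0..1}" "\<lambda>t. ball t (\<delta> t)"] by (metis compact_Icc open_ball)
    define F where "F = (\<Union>t\<in>T. {A \<in> arcs D. curve D c t \<in> A} \<union> {arc_in D (c, t), arc_out D (c, t)})"
    have "finite {A \<in> arcs D. x \<in> A}" for x
    proof (rule finite_subset)
      show "{A \<in> arcs D. x \<in> A} \<subseteq> {THE A. A \<in> arcs D \<and> x \<in> A}"
      proof
        fix A assume A: "A \<in> {A \<in> arcs D. x \<in> A}"
        have "(THE A. A \<in> arcs D \<and> x \<in> A) = A"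
        proof (rule the_equality)
          show "A \<in> arcs D \<and> x \<in> A" using A by simp
          fix B assume "B \<in> arcs D \<and> x \<in> B"
          then show "B = A" using A components_eq[of B strands_off_crossings A] unfolding arcs_eq by blast
        qed
        then show "A \<in> {THE A. A \<in> arcs D \<and> x \<in> A}" by simp
      qed
    qed simp
    then have "finite F" using T(1) by (simp add: F_def)
    moreover have "A \<in> F" if A: "A \<in> arcs D" "A \<inter> range (curve D c) \<noteq> {}" for A
    proof -
      obtain s0 where "curve D c s0 \<in> A" using A(2) by blast
      then have s: "curve D c (frac s0) \<in> A" by (simp add: curve_frac[OF c])
      define s where "s = frac s0"
      have "s \<in> {0..1}" using frac_lt_1[of s0] by (simp add: s_def)
      then obtain t where t: "t \<in> T" "\<bar>s - t\<bar> < \<delta> t" using T(2) by (auto simp: dist_real_def)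
      consider "s = t" | "s < t" | "t < s" by linarith
      then have "A \<in> {A \<in> arcs D. curve D c t \<in> A} \<union> {arc_in D (c, t), arc_out D (c, t)}"
      proof cases
        case 1
        then show ?thesis using s A(1) by (simp add: s_def)
      next
        case 2
        have lt: "t - \<delta> t < t" using d(1)[of t] by simp
        obtain B where B: "B \<in> arcs D" "curve D c ` {t - \<delta> t<..<t} \<subseteq> B"
          by (rule interval_in_arc[OF c lt, of thesis]) (use d(2)[of _ t] in auto)
        have "curve D c s \<in> B" using B(2) 2 t(2) by auto
        then have "A = B" using s A(1) B(1) components_eq[of A strands_off_crossings B]
          unfolding arcs_eq s_def by blast
        then show ?thesis using arc_at_ends(2)[OF B lt] by simp
      next
        case 3
        have lt: "t < t + \<delta> t" using d(1)[of t] by simp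
        obtain B where B: "B \<in> arcs D" "curve D c ` {t<..<t + \<delta> t} \<subseteq> B"
          by (rule interval_in_arc[OF c lt, of thesis]) (use d(2)[of _ t] in auto)
        have "curve D c s \<in> B" using B(2) 3 t(2) by auto
        then have "A = B" using s A(1) B(1) components_eq[of A strands_off_crossings B]
          unfolding arcs_eq s_def by blast
        then show ?thesis using arc_at_ends(1)[OF B lt] by simp
      qed
      then show ?thesis unfolding F_def using t(1) by blast
    qed
    ultimately show ?thesis by blast
  qed
  then obtain F where F: "\<And>c. c < n \<Longrightarrow> finite (F c)" "\<And>c A. c < n \<Longrightarrow> A \<in> arcs D \<Longrightarrow> A \<inter> range (curve D c) \<noteq> {} \<Longrightarrow> A \<in> F c"
    by metis
  have "arcs D \<subseteq> (\<Union>c<n. F c)"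
  proof
    fix A assume A: "A \<in> arcs D"
    then obtain x where "x \<in> A" using in_components_nonempty unfolding arcs_eq by blast
    moreover have "A \<subseteq> strands_off_crossings" using A in_components_subset unfolding arcs_eq by blast
    ultimately have "\<exists>c<n. A \<inter> range (curve D c) \<noteq> {}" unfolding strands_off_crossings_def by blast
    then show "A \<in> (\<Union>c<n. F c)" using F(2) A by blast
  qed
  then show ?thesis using F(1) by (meson finite_UN_I finite_lessThan finite_subset lessThan_iff)
qed

text \<open>
  Along each strand, the parameters of crossings are ordered cyclically by their representatives in the
  period \<open>{0..<1}\<close>.
\<close>

definition next_param :: "nat \<times> real \<Rightarrow> nat \<times> real" where
  "next_param x = (fst x, cyclic_succ {t. (fst x, t) \<in> crossing_params} (snd x))"

lemma finite_crossing_times: "finite {t. (c, t) \<in> crossing_params}"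
proof -
  have "{t. (c, t) \<in> crossing_params} \<subseteq> snd ` crossing_params" by force
  then show ?thesis using finite_crossing_params finite_subset by blast
qed

lemma bij_next_param: "bij_betw next_param crossing_params crossing_params"
proof -
  have "inj_on next_param crossing_params"
  proof (rule inj_onI)
    fix x y assume xy: "x \<in> crossing_params" "y \<in> crossing_params" and eq: "next_param x = next_param y"
    then have f: "fst x = fst y" by (simp add: next_param_def)
    have "snd x = snd y"
      by (rule inj_onD[OF inj_on_cyclic_succ[OF finite_crossing_times[of "fst x"]]])
         (use eq xy f in \<open>simp_all add: next_param_def\<close>, metis prod.collapse)
    then show "x = y" using f by (simp add: prod_eq_iff)
  qed
  moreover have "next_param x \<in> crossing_params" if "x \<in> crossing_params" for x
    using cyclic_succ_in[OF finite_crossing_times[of "fst x"], of "snd x"] that by (simp add: next_param_def)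
  ultimately show ?thesis unfolding bij_betw_def
    using endo_inj_surj[OF finite_crossing_params, of next_param] by blast
qed

text \<open>
  No crossing lies between a parameter and its cyclic successor.  For the last one in the period, the
  interval extends beyond 1, and the periodicity of the curve brings its end back.
\<close>

lemma arc_out_eq_arc_in_next:
  assumes x: "x \<in> crossing_params"
  shows "arc_out D x = arc_in D (next_param x)"
proof -
  obtain c t where ct: "x = (c, t)" by fastforce
  define T where "T = {t. (c, t) \<in> crossing_params}"
  have c: "c < n" and t: "0 \<le> t" "t < 1" "t \<in> T"
    using x by (auto simp: ct crossing_params_def params_def T_def)
  have T01: "0 \<le> s \<and> s < 1" if "s \<in> T" for s using that by (auto simp: T_def crossing_params_def params_def)
  have finT: "finite T" unfolding T_def by (rule finite_crossing_times)
  have free: "curve D c s \<in> crossings D \<longleftrightarrow> frac s \<in> T" for s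
    using curve_crossing_iff[OF c] by (simp add: T_def)
  have next_eq: "next_param x = (c, cyclic_succ T t)" by (simp add: next_param_def ct T_def)
  show ?thesis
  proof (cases "\<exists>t'\<in>T. t < t'")
    case True
    define v where "v = Min {t' \<in> T. t < t'}"
    have fin: "finite {t' \<in> T. t < t'}" using finT by simp
    have v: "v \<in> T" "t < v" using Min_in[OF fin] True unfolding v_def by auto
    have "curve D c s \<notin> crossings D" if s: "t < s" "s < v" for s
    proof
      assume "curve D c s \<in> crossings D"
      moreover have "frac s = s" using s t(1) T01[OF v(1)] by (simp add: frac_eq)
      ultimately have "s \<in> {t' \<in> T. t < t'}" using s free by simp
      then have "v \<le> s" unfolding v_def by (rule Min_le[OF fin])
      then show False using s by simp
    qed
    then obtain A where A: "A \<in> arcs D" "curve D c ` {t<..<v} \<subseteq> A"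
      using interval_in_arc[OF c v(2)] by blast
    have "cyclic_succ T t = v" using True by (simp add: cyclic_succ_def v_def)
    then show ?thesis using arc_at_ends[OF A v(2)] next_eq by (simp add: ct)
  next
    case False
    define v where "v = Min T"
    have vT: "v \<in> T" using Min_in[OF finT] t(3) unfolding v_def by blast
    have lt: "t < v + 1" using t(2) T01[OF vT] by linarith
    have "curve D c s \<notin> crossings D" if s: "t < s" "s < v + 1" for s
    proof
      assume "curve D c s \<in> crossings D"
      then have fs: "frac s \<in> T" using free by simp
      show False
      proof (cases "s < 1")
        case True
        then have "frac s = s" using s t(1) by (simp add: frac_eq)
        then show False using fs False s by force
      next
        case ge: False
        have "s < 2" using s T01[OF vT] by simp
        then have "frac s = s - 1" using ge by (simp add: frac_unique_iff)
        then have "s - 1 < Min T" using s by (simp add: v_def)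
        then show False using fs \<open>frac s = s - 1\<close> finT by (metis Min_le not_le)
      qed
    qed
    then obtain A where A: "A \<in> arcs D" "curve D c ` {t<..<v + 1} \<subseteq> A"
      using interval_in_arc[OF c lt] by blast
    have "cyclic_succ T t = v" using False by (auto simp: cyclic_succ_def v_def)
    then show ?thesis using arc_at_ends[OF A lt] arc_in_plus_one[OF c] next_eq by (simp add: ct)
  qed
qed

text \<open>
  Since \<open>next_param\<close> is a permutation, as many arcs in \<open>C\<close> arrive at crossings as leave them.
\<close>

lemma even_arc_ends:
  "even (\<Sum>p\<in>crossings D. of_bool (arc_in D (ov p) \<in> C) + of_bool (arc_out D (ov p) \<in> C)
      + (of_bool (arc_in D (un p) \<in> C) + of_bool (arc_out D (un p) \<in> C)) :: nat)"
proof -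
  have "(\<Sum>x\<in>crossing_params. of_bool (arc_out D x \<in> C)) = (\<Sum>x\<in>crossing_params. of_bool (arc_in D (next_param x) \<in> C) :: nat)"
    by (rule sum.cong) (simp_all add: arc_out_eq_arc_in_next)
  also have "\<dots> = (\<Sum>x\<in>crossing_params. of_bool (arc_in D x \<in> C))"
    by (rule sum.reindex_bij_betw[OF bij_next_param])
  finally have "(\<Sum>x\<in>crossing_params. of_bool (arc_in D x \<in> C) + of_bool (arc_out D x \<in> C))
      = 2 * (\<Sum>x\<in>crossing_params. of_bool (arc_in D x \<in> C) :: nat)" by (simp add: sum.distrib)
  then show ?thesis unfolding sum_crossing_params by simp
qed

end

text \<open>
  Images of paths are paths; applied to an involution it transports classes in both directions.
\<close>

lemma rtrancl_map_prod:
  assumes "(x, y) \<in> G\<^sup>*"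
  shows "(f x, f y) \<in> (map_prod f f ` G)\<^sup>*"
  using assms
proof (induction rule: rtrancl_induct)
  case (step y z)
  then have "(f y, f z) \<in> map_prod f f ` G" by force
  with step.IH show ?case by (rule rtrancl_into_rtrancl)
qed simp

lemma quotient_map_prod:
  assumes ff: "\<And>x. f (f x) = x" and E: "f ` E = E"
  shows "E // (map_prod f f ` G)\<^sup>* = (\<lambda>C. f ` C) ` (E // G\<^sup>*)"
proof -
  have GG: "map_prod f f ` map_prod f f ` G = G"
  proof -
    have "map_prod f f (map_prod f f z) = z" for z by (cases z) (simp add: ff)
    then show ?thesis by (simp add: image_image)
  qed
  have iff: "(f x, f y) \<in> (map_prod f f ` G)\<^sup>* \<longleftrightarrow> (x, y) \<in> G\<^sup>*" for x y
    using rtrancl_map_prod[of x y G f] rtrancl_map_prod[of "f x" "f y" "map_prod f f ` G" f]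
    unfolding GG ff by blast
  have cls: "(map_prod f f ` G)\<^sup>* `` {f x} = f ` (G\<^sup>* `` {x})" for x
  proof (intro equalityI subsetI)
    fix y assume "y \<in> (map_prod f f ` G)\<^sup>* `` {f x}"
    then have "(f x, f (f y)) \<in> (map_prod f f ` G)\<^sup>*" by (simp add: ff)
    then have "f y \<in> G\<^sup>* `` {x}" unfolding iff by simp
    then have "f (f y) \<in> f ` (G\<^sup>* `` {x})" by (rule imageI)
    then show "y \<in> f ` (G\<^sup>* `` {x})" by (simp add: ff)
  next
    fix y assume "y \<in> f ` (G\<^sup>* `` {x})"
    then obtain z where "y = f z" "(x, z) \<in> G\<^sup>*" by blast
    then show "y \<in> (map_prod f f ` G)\<^sup>* `` {f x}" using iff by simp
  qed
  have q: "E // r = (\<lambda>x. r `` {x}) ` E" for r :: "('a \<times> 'a) set" by (auto simp: quotient_def)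
  have "E // (map_prod f f ` G)\<^sup>* = (\<lambda>x. (map_prod f f ` G)\<^sup>* `` {x}) ` f ` E" unfolding q E ..
  also have "\<dots> = (\<lambda>C. f ` C) ` (E // G\<^sup>*)" unfolding q image_image cls ..
  finally show ?thesis .
qed

context involutive_projection
begin

section \<open>Symmetry of the diagram\<close>

definition point :: "nat \<times> real \<Rightarrow> (real^3) \<times> real" where
  "point x = strand K (fst x) (snd x)"

lemma tau_eq: "tau \<nu> P = (R (fst P), - snd P)"
  by (simp add: tau_def split_beta)

lemma continuous_tau: "continuous_on S (tau \<nu>)"
proof -
  have "continuous_on (fst ` S) R" by (rule linear_continuous_on[OF linear_conv_bounded_linear[THEN iffD1, OF reflect_linear]])
  then have "continuous_on S (\<lambda>P. (R (fst P), - snd P))"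
    by (intro continuous_intros continuous_on_compose2[OF _ continuous_on_fst[OF continuous_on_id]]) auto
  then show ?thesis by (simp add: tau_eq[abs_def])
qed

lemma curve_tau:
  assumes "strand K c' u = tau \<nu> (strand K c s)"
  shows "curve D c' u = R (curve D c s)"
  using assms by (simp add: curve tau_eq sgn_div_norm reflect_scaleR norm_reflect[OF norm_nu])

lemma ex_mirror_param:
  assumes "x \<in> params n"
  shows "\<exists>y. y \<in> params n \<and> point y = tau \<nu> (point x)"
proof -
  have c: "fst x < n" using assms by (auto simp: params_def)
  have "tau \<nu> (point x) \<in> underlying_set K"
    using involutive strand(4)[OF c, of "snd x"] unfolding involutive_link_def point_def by blast
  then obtain c' s where "c' < n" "strand K c' s = tau \<nu> (point x)" by (auto simp: underlying_set_def)
  then have "(c', frac s) \<in> params n \<and> point (c', frac s) = tau \<nu> (point x)"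
    by (simp add: params_frac point_def strand_frac)
  then show ?thesis by blast
qed

definition mirror_param :: "nat \<times> real \<Rightarrow> nat \<times> real" where
  "mirror_param x = (SOME y. y \<in> params n \<and> point y = tau \<nu> (point x))"

lemma mirror_param:
  assumes "x \<in> params n"
  shows "mirror_param x \<in> params n" "point (mirror_param x) = tau \<nu> (point x)"
  using someI_ex[OF ex_mirror_param[OF assms]] by (simp_all add: mirror_param_def)

lemma pt_mirror_param:
  assumes "x \<in> params n"
  shows "pt D (mirror_param x) = R (pt D x)"
  unfolding pt_def by (rule curve_tau) (use mirror_param(2)[OF assms] in \<open>simp add: point_def\<close>)

text \<open>
  The involution negates the height, so over and under are exchanged.
\<close>

lemma over_mirror_param:
  assumes "(x, y) \<in> over D"
  shows "(mirror_param y, mirror_param x) \<in> over D"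
proof -
  note xy = overD[OF assms]
  have "snd (point x) > snd (point y)"
    using assms over_iff[of "fst x" "snd x" "fst y" "snd y"] by (simp add: point_def)
  then have "snd (point (mirror_param y)) > snd (point (mirror_param x))"
    using mirror_param(2)[OF xy(1)] mirror_param(2)[OF xy(2)] by (simp add: tau_eq)
  moreover have "pt D (mirror_param y) = pt D (mirror_param x)"
    using pt_mirror_param xy by simp
  ultimately show ?thesis
    using mirror_param(1)[OF xy(1)] mirror_param(1)[OF xy(2)]
      over_iff[of "fst (mirror_param y)" "snd (mirror_param y)" "fst (mirror_param x)" "snd (mirror_param x)"]
    by (simp add: point_def pt_def)
qed

lemma reflect_crossing:
  assumes p: "p \<in> crossings D"
  shows "R p \<in> crossings D" "ov (R p) = mirror_param (un p)" "un (R p) = mirror_param (ov p)"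
proof -
  have o: "(mirror_param (un p), mirror_param (ov p)) \<in> over D"
    by (rule over_mirror_param[OF crossing(1)[OF p]])
  have "pt D (mirror_param (un p)) = R p"
    using pt_mirror_param[OF crossing(5)[OF p]] crossing(3)[OF p] by simp
  then show "R p \<in> crossings D" "ov (R p) = mirror_param (un p)" "un (R p) = mirror_param (ov p)"
    using overD(6)[OF o] over_under_param(1,2)[OF o] by simp_all
qed

lemma R_R: "R (R x) = x"
  by (rule reflect_reflect[OF norm_nu])

lemma R_crossings: "R ` crossings D = crossings D"
proof (intro equalityI subsetI)
  fix p assume "p \<in> crossings D"
  then have "R (R p) \<in> R ` crossings D" using reflect_crossing(1) by blast
  then show "p \<in> R ` crossings D" by (simp add: R_R)
qed (use reflect_crossing(1) in auto)

lemma R_strands: "R ` strands_off_crossings = strands_off_crossings"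
proof -
  have sub: "R x \<in> (\<Union>c<n. range (curve D c))" if x: "x \<in> (\<Union>c<n. range (curve D c))" for x
  proof -
    obtain c s where c: "c < n" "x = curve D c s" using x by blast
    then have "x = pt D (c, frac s)" by (simp add: pt_def curve_frac)
    then have "R x = pt D (mirror_param (c, frac s))" using pt_mirror_param[OF params_frac[OF c(1)]] by simp
    moreover have "fst (mirror_param (c, frac s)) < n"
      using mirror_param(1)[OF params_frac[OF c(1)], of s] by (auto simp: params_def)
    ultimately show ?thesis unfolding pt_def by blast
  qed
  have "R x \<in> strands_off_crossings" if x: "x \<in> strands_off_crossings" for x
  proof -
    have "R x \<notin> crossings D"
    proof
      assume "R x \<in> crossings D"
      then have "R (R x) \<in> crossings D" by (rule reflect_crossing(1))
      then show False using x by (simp add: R_R strands_off_crossings_def)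
    qed
    then show ?thesis using x sub[of x] by (simp add: strands_off_crossings_def)
  qed
  then have 1: "R ` strands_off_crossings \<subseteq> strands_off_crossings" by blast
  moreover have "R ` R ` strands_off_crossings = strands_off_crossings"
    by (rule image_reflect_image_reflect[OF norm_nu])
  ultimately show ?thesis by (metis image_mono subset_antisym)
qed

abbreviation "reflect_set \<equiv> (\<lambda>A. R ` A)"

lemma reflect_arc: "A \<in> arcs D \<Longrightarrow> reflect_set A \<in> arcs D"
  unfolding arcs_eq
proof (rule components_involution[OF _ R_R R_strands])
  show "continuous_on UNIV R" by (rule linear_continuous_on[OF linear_conv_bounded_linear[THEN iffD1, OF reflect_linear]])
qed

lemma reflect_set_reflect_set: "reflect_set (reflect_set A) = A"
  by (rule image_reflect_image_reflect[OF norm_nu])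

lemma reflect_arcs: "reflect_set ` arcs D = arcs D"
proof (intro equalityI subsetI)
  fix A assume "A \<in> arcs D"
  then have "reflect_set (reflect_set A) \<in> reflect_set ` arcs D" using reflect_arc by blast
  then show "A \<in> reflect_set ` arcs D" unfolding reflect_set_reflect_set .
qed (use reflect_arc in auto)

text \<open>
  The part of the link with parameters at distance at least \<open>e\<close> from \<open>t'\<close> (modulo the period) is compact and
  does not contain the point at \<open>t'\<close>.  Hence points of the link near this one have parameters near \<open>t'\<close>.
\<close>

lemma local_lift:
  assumes c: "c < n" "c' < n" and t': "strand K c' t' = tau \<nu> (strand K c t)" and e: "0 < e" "e \<le> 1/4"
  shows "\<forall>\<^sub>F s in at t. \<exists>v. \<bar>v - t'\<bar> \<le> e \<and> strand K c' v = tau \<nu> (strand K c s)"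
proof -
  \<comment> \<open>The points of the link with parameters not near \<open>t'\<close> modulo the period.\<close>
  define Q where "Q = (\<Union>k<n. strand K k ` (if k = c' then {t' + e..t' + 1 - e} else {0..1}))"
  have "compact Q"
    unfolding Q_def by (intro compact_UN compact_continuous_image strand_continuous) auto
  then have openQ: "open (- Q)" using compact_imp_closed by blast
  have "strand K c' t' \<notin> Q"
  proof
    assume "strand K c' t' \<in> Q"
    then obtain k u where k: "k < n" "strand K k u = strand K c' t'"
      and u: "u \<in> (if k = c' then {t' + e..t' + 1 - e} else {0..1})" unfolding Q_def by auto
    have "k = c'" and f: "frac u = frac t'" using strand_inj[OF k(1) c(2) k(2)] by blast+
    then have u': "t' + e \<le> u" "u \<le> t' + 1 - e" using u by auto
    have "u - t' = of_int (\<lfloor>u\<rfloor> - \<lfloor>t'\<rfloor>)" using f by (simp add: frac_def)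
    moreover have "0 < u - t'" "u - t' < 1" using u' e by auto
    ultimately have "0 < \<lfloor>u\<rfloor> - \<lfloor>t'\<rfloor>" "\<lfloor>u\<rfloor> - \<lfloor>t'\<rfloor> < 1" by (metis of_int_0_less_iff, metis of_int_less_1_iff)
    then show False by simp
  qed
  then have "tau \<nu> (strand K c t) \<in> - Q" using t' by simp
  moreover have "((\<lambda>s. tau \<nu> (strand K c s)) \<longlongrightarrow> tau \<nu> (strand K c t)) (at t)"
  proof -
    have "continuous_on UNIV (\<lambda>s. tau \<nu> (strand K c s))"
      by (rule continuous_on_compose2[OF continuous_tau strand_continuous[OF c(1)] subset_UNIV])
    then show ?thesis by (simp add: continuous_on_def)
  qed
  ultimately have "\<forall>\<^sub>F s in at t. tau \<nu> (strand K c s) \<in> - Q"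
    using openQ topological_tendstoD by blast
  then show ?thesis
  proof (rule eventually_mono)
    fix s assume s: "tau \<nu> (strand K c s) \<in> - Q"
    have "tau \<nu> (strand K c s) \<in> underlying_set K"
      using involutive strand(4)[OF c(1), of s] unfolding involutive_link_def by blast
    then obtain k w where k: "k < n" "strand K k w = tau \<nu> (strand K c s)" by (auto simp: underlying_set_def)
    have kc: "k = c'"
    proof (rule ccontr)
      assume "k \<noteq> c'"
      then have "strand K k (frac w) \<in> Q"
        unfolding Q_def using k(1) frac_lt_1[of w] by (intro UN_I[of k]) auto
      then show False using s k by (simp add: strand_frac)
    qed
    \<comment> \<open>The representative of \<open>w\<close> modulo the period in the window that starts at \<open>t' - e\<close>.\<close>
    define v where "v = t' - e + frac (w - t' + e)"
    have "v = w + of_int (- \<lfloor>w - t' + e\<rfloor>)" by (simp add: v_def frac_def)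
    then have v: "strand K c' v = tau \<nu> (strand K c s)" using k kc strand_plus_int by metis
    have "t' - e \<le> v" "v < t' - e + 1" unfolding v_def using frac_lt_1[of "w - t' + e"] by simp_all
    moreover have "\<not> t' + e \<le> v"
    proof
      assume "t' + e \<le> v"
      then have "strand K c' v \<in> Q" unfolding Q_def using c(2) \<open>v < t' - e + 1\<close> by (intro UN_I[of c']) auto
      then show False using s v by simp
    qed
    ultimately have "\<bar>v - t'\<bar> \<le> e" by linarith
    then show "\<exists>v. \<bar>v - t'\<bar> \<le> e \<and> strand K c' v = tau \<nu> (strand K c s)" using v by blast
  qed
qed

text \<open>
  Within distance 1/4 a parameter of a given point of the link is unique, since the strands are embedded.
  This makes the lift well-defined, and \<open>local_lift\<close> makes it continuous at \<open>t\<close>.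
\<close>

lemma lift_reparametrisation:
  assumes c: "c < n" "c' < n" and t': "strand K c' t' = tau \<nu> (strand K c t)"
  obtains u where "(u \<longlongrightarrow> t') (at t)" "\<forall>\<^sub>F s in at t. strand K c' (u s) = tau \<nu> (strand K c s)"
proof -
  define u where "u s = (SOME v. \<bar>v - t'\<bar> \<le> 1/4 \<and> strand K c' v = tau \<nu> (strand K c s))" for s
  have u: "\<bar>u s - t'\<bar> \<le> 1/4 \<and> strand K c' (u s) = tau \<nu> (strand K c s)"
    if "\<bar>v - t'\<bar> \<le> 1/4 \<and> strand K c' v = tau \<nu> (strand K c s)" for s v
    unfolding u_def by (rule someI[where P = "\<lambda>v. \<bar>v - t'\<bar> \<le> 1/4 \<and> strand K c' v = tau \<nu> (strand K c s)", OF that])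
  have uniq: "u s = v" if v: "\<bar>v - t'\<bar> \<le> 1/4 \<and> strand K c' v = tau \<nu> (strand K c s)" for s v
  proof -
    have us: "\<bar>u s - t'\<bar> \<le> 1/4" "strand K c' (u s) = strand K c' v" using u[OF v] v by simp_all
    have "frac (u s) = frac v" by (rule strand_inj(2)[OF c(2) c(2) us(2)])
    then have eq: "u s - v = of_int (\<lfloor>u s\<rfloor> - \<lfloor>v\<rfloor>)" by (simp add: frac_def)
    have "\<bar>u s - v\<bar> < 1" using us(1) v by linarith
    then have "\<bar>real_of_int (\<lfloor>u s\<rfloor> - \<lfloor>v\<rfloor>)\<bar> < 1" unfolding eq .
    then have "\<lfloor>u s\<rfloor> - \<lfloor>v\<rfloor> = 0" by linarith
    then show ?thesis using eq by simp
  qed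
  have near: "\<forall>\<^sub>F s in at t. \<bar>u s - t'\<bar> \<le> e" if e: "0 < e" "e \<le> 1/4" for e
  proof (rule eventually_mono[OF local_lift[OF c t' e]])
    fix s assume "\<exists>v. \<bar>v - t'\<bar> \<le> e \<and> strand K c' v = tau \<nu> (strand K c s)"
    then obtain v where v: "\<bar>v - t'\<bar> \<le> e" "strand K c' v = tau \<nu> (strand K c s)" by blast
    then have "u s = v" using e by (intro uniq) simp
    then show "\<bar>u s - t'\<bar> \<le> e" using v by simp
  qed
  have "(u \<longlongrightarrow> t') (at t)"
  proof (rule tendstoI)
    fix e :: real assume "0 < e"
    then have "0 < min (e/2) (1/4)" "min (e/2) (1/4) \<le> 1/4" by simp_all
    from near[OF this] show "\<forall>\<^sub>F s in at t. dist (u s) t' < e"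
      by (rule eventually_mono) (use \<open>0 < e\<close> in \<open>simp add: dist_real_def\<close>)
  qed
  moreover have "\<forall>\<^sub>F s in at t. strand K c' (u s) = tau \<nu> (strand K c s)"
    by (rule eventually_mono[OF local_lift[OF c t', of "1/4"]]) (use u in auto)
  ultimately show thesis by (rule that)
qed

lemma arc_reflection:
  assumes "A \<in> arcs D" "B \<in> arcs D" and ne: "F \<noteq> bot"
    and A: "\<forall>\<^sub>F s in F. curve D c s \<in> A" and B: "\<forall>\<^sub>F s in F. curve D c' (u s) \<in> B"
    and eq: "\<forall>\<^sub>F s in F. curve D c' (u s) = R (curve D c s)"
  shows "reflect_set A = B"
proof -
  have "\<forall>\<^sub>F s in F. curve D c' (u s) \<in> reflect_set A \<inter> B"
    using A B eq by eventually_elim auto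
  then obtain s where "curve D c' (u s) \<in> reflect_set A \<inter> B" using eventually_happens'[OF ne] by blast
  then have "reflect_set A \<inter> B \<noteq> {}" by blast
  then show ?thesis
    using components_eq[of "reflect_set A" strands_off_crossings B] reflect_arc[OF assms(1)] assms(2)
    unfolding arcs_eq by blast
qed

text \<open>
  The number \<open>r\<close> is the derivative of the parameter of the image under \<open>\<tau>\<close> with respect to the parameter
  at \<open>x\<close>.  It is negative iff \<open>\<tau>\<close> reverses the orientation there, and then incoming and outgoing
  arcs are exchanged.
\<close>

lemma mirror_param_local:
  assumes x: "x \<in> params n"
  obtains r where "r \<noteq> 0" "R (tangent D x) = r *\<^sub>R tangent D (mirror_param x)"
    "r > 0 \<Longrightarrow> reflect_set (arc_in D x) = arc_in D (mirror_param x) \<and> reflect_set (arc_out D x) = arc_out D (mirror_param x)"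
    "r < 0 \<Longrightarrow> reflect_set (arc_in D x) = arc_out D (mirror_param x) \<and> reflect_set (arc_out D x) = arc_in D (mirror_param x)"
proof -
  obtain c t where x_eq: "x = (c, t)" by fastforce
  obtain c' t' where mirror_eq: "mirror_param (c, t) = (c', t')" by fastforce
  note ct = x_eq mirror_eq
  have c: "c < n" "c' < n" using x mirror_param(1)[OF x] unfolding ct by (auto simp: params_def)
  have t': "strand K c' t' = tau \<nu> (strand K c t)" using mirror_param(2)[OF x] unfolding ct point_def by simp
  obtain u where u: "(u \<longlongrightarrow> t') (at t)" "\<forall>\<^sub>F s in at t. strand K c' (u s) = tau \<nu> (strand K c s)"
    using lift_reparametrisation[OF c t'] by metis
  have eq: "\<forall>\<^sub>F s in at t. curve D c' (u s) = R (curve D c s)"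
    using u(2) by (rule eventually_mono) (rule curve_tau)
  have eq0: "curve D c' t' = R (curve D c t)" by (rule curve_tau[OF t'])
  have lin: "bounded_linear R" using reflect_linear linear_conv_bounded_linear by blast
  have g: "((\<lambda>s. R (curve D c s)) has_vector_derivative R (tangent D x)) (at t)"
    unfolding ct by (rule bounded_linear.has_vector_derivative[OF lin tangent_derivative[OF c(1)]])
  have f: "(curve D c' has_vector_derivative tangent D (mirror_param x)) (at t')"
    unfolding ct by (rule tangent_derivative[OF c(2)])
  have nz: "tangent D (mirror_param x) \<noteq> 0" "R (tangent D x) \<noteq> 0"
  proof -
    show "tangent D (mirror_param x) \<noteq> 0" by (rule generic_facts(1)[OF mirror_param(1)[OF x]])
    have "norm (R (tangent D x)) \<noteq> 0" unfolding norm_reflect[OF norm_nu] using generic_facts(1)[OF x] by simp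
    then show "R (tangent D x) \<noteq> 0" by auto
  qed
  obtain r where r: "r \<noteq> 0" "R (tangent D x) = r *\<^sub>R tangent D (mirror_param x)"
    "r > 0 \<Longrightarrow> filterlim u (at_right t') (at_right t) \<and> filterlim u (at_left t') (at_left t)"
    "r < 0 \<Longrightarrow> filterlim u (at_left t') (at_right t) \<and> filterlim u (at_right t') (at_left t)"
    using reparametrisation[OF f nz(1) g nz(2) u(1) eq eq0] by metis
  have eqR: "\<forall>\<^sub>F s in at_right t. curve D c' (u s) = R (curve D c s)"
    and eqL: "\<forall>\<^sub>F s in at_left t. curve D c' (u s) = R (curve D c s)"
    using filter_leD[OF at_le[OF subset_UNIV] eq] by auto
  note neR = trivial_limit_at_right_real[of t] and neL = trivial_limit_at_left_real[of t]
  show thesis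
  proof (rule that[OF r(1,2)])
    assume "r > 0"
    then have lim: "filterlim u (at_right t') (at_right t)" "filterlim u (at_left t') (at_left t)" using r(3) by blast+
    show "reflect_set (arc_in D x) = arc_in D (mirror_param x) \<and> reflect_set (arc_out D x) = arc_out D (mirror_param x)"
      unfolding ct
      using arc_reflection[OF arc_in(1)[OF c(1)] arc_in(1)[OF c(2)] neL arc_in(2)[OF c(1)] eventually_compose_filterlim[OF arc_in(2)[OF c(2)] lim(2)] eqL]
        arc_reflection[OF arc_out(1)[OF c(1)] arc_out(1)[OF c(2)] neR arc_out(2)[OF c(1)] eventually_compose_filterlim[OF arc_out(2)[OF c(2)] lim(1)] eqR]
      by (rule conjI)
  next
    assume "r < 0"
    then have lim: "filterlim u (at_left t') (at_right t)" "filterlim u (at_right t') (at_left t)" using r(4) by blast+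
    show "reflect_set (arc_in D x) = arc_out D (mirror_param x) \<and> reflect_set (arc_out D x) = arc_in D (mirror_param x)"
      unfolding ct
      using arc_reflection[OF arc_in(1)[OF c(1)] arc_out(1)[OF c(2)] neL arc_in(2)[OF c(1)] eventually_compose_filterlim[OF arc_out(2)[OF c(2)] lim(2)] eqL]
        arc_reflection[OF arc_out(1)[OF c(1)] arc_in(1)[OF c(2)] neR arc_out(2)[OF c(1)] eventually_compose_filterlim[OF arc_in(2)[OF c(2)] lim(1)] eqR]
      by (rule conjI)
  qed
qed

section \<open>Symmetry of the smoothings\<close>

text \<open>
  The order within a pair depends on which strand is the upper one, and only the symmetric relation is
  compatible with \<open>\<tau>\<close> and with the mirror.
\<close>

definition sym_joins :: "(real^3) set \<Rightarrow> real^3 \<Rightarrow> ((real^3) set \<times> (real^3) set) set" where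
  "sym_joins s p = joins D s p \<union> (joins D s p)\<inverse>"

lemma circles_eq: "circles D s = arcs D // (\<Union>p\<in>crossings D. sym_joins s p)\<^sup>*"
proof -
  have "(\<Union>p\<in>crossings D. sym_joins s p) = (\<Union>p\<in>crossings D. joins D s p) \<union> (\<Union>p\<in>crossings D. joins D s p)\<inverse>"
    by (auto simp: sym_joins_def)
  then show ?thesis by (simp add: circles_def)
qed

lemma R_in_iff: "R p \<in> R ` s \<longleftrightarrow> p \<in> s"
  using R_R by (metis image_iff)

text \<open>
  Let \<open>r\<close> and \<open>q\<close> be the numbers of \<open>mirror_param_local\<close> for the two strands.  The involution reverses the
  orientation of the sphere and exchanges over and under; these two effects on the sign of the crossing
  cancel, so that it is multiplied by the sign of \<open>r q\<close>.  If \<open>r q < 0\<close>, exactly one strand has its incoming and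
  outgoing arcs exchanged, which exchanges the oriented and the unoriented smoothing.
\<close>

lemma sym_joins_reflect:
  assumes p: "p \<in> crossings D"
  shows "sym_joins (R ` s) (R p) = map_prod reflect_set reflect_set ` sym_joins s p"
proof -
  define x y where xy: "x = ov p" "y = un p"
  define x' y' where xy': "x' = mirror_param x" "y' = mirror_param y"
  have params: "x \<in> params n" "y \<in> params n" using crossing(4,5)[OF p] by (simp_all add: xy)
  have oR: "ov (R p) = y'" "un (R p) = x'" using reflect_crossing[OF p] by (simp_all add: xy xy')
  obtain r where r: "r \<noteq> 0" "R (tangent D x) = r *\<^sub>R tangent D x'"
    "r > 0 \<Longrightarrow> reflect_set (arc_in D x) = arc_in D x' \<and> reflect_set (arc_out D x) = arc_out D x'"
    "r < 0 \<Longrightarrow> reflect_set (arc_in D x) = arc_out D x' \<and> reflect_set (arc_out D x) = arc_in D x'"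
    using mirror_param_local[OF params(1)] unfolding xy' by metis
  obtain q where q: "q \<noteq> 0" "R (tangent D y) = q *\<^sub>R tangent D y'"
    "q > 0 \<Longrightarrow> reflect_set (arc_in D y) = arc_in D y' \<and> reflect_set (arc_out D y) = arc_out D y'"
    "q < 0 \<Longrightarrow> reflect_set (arc_in D y) = arc_out D y' \<and> reflect_set (arc_out D y) = arc_in D y'"
    using mirror_param_local[OF params(2)] unfolding xy' by metis
  define T where "T = p \<bullet> cross3 (tangent D x) (tangent D y)"
  define T' where "T' = R p \<bullet> cross3 (tangent D y') (tangent D x')"
  have "T = - (R p \<bullet> cross3 (R (tangent D x)) (R (tangent D y)))"
    unfolding T_def by (simp add: reflect_triple[OF norm_nu])
  also have "\<dots> = - (r * q * (R p \<bullet> cross3 (tangent D x') (tangent D y')))"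
    unfolding r(2) q(2) by (simp add: cross_mult_left cross_mult_right)
  also have "\<dots> = r * q * T'"
    unfolding T'_def cross_skew[of "tangent D y'" "tangent D x'"] by simp
  finally have TT': "T = r * q * T'" .
  have T0: "T \<noteq> 0"
    using generic_facts(4)[OF crossing(1)[OF p]] crossing(2)[OF p] by (simp add: T_def xy)
  have pos: "positive D p \<longleftrightarrow> T > 0" "positive D (R p) \<longleftrightarrow> T' > 0"
    by (simp_all add: positive_def T_def T'_def xy[symmetric] oR)
  have mult_pos: "0 < a * b \<longleftrightarrow> (0 < a \<longleftrightarrow> 0 < b)" if "a \<noteq> 0" "b \<noteq> 0" for a b :: real
    using that by (auto simp: zero_less_mult_iff linorder_neq_iff)
  have sgn: "T > 0 \<longleftrightarrow> (r * q > 0 \<longleftrightarrow> T' > 0)"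
    using T0 mult_pos[of "r * q" T'] unfolding TT' by auto
  have rq: "r * q > 0 \<longleftrightarrow> (r > 0 \<longleftrightarrow> q > 0)" by (rule mult_pos[OF r(1) q(1)])
  have ori: "oriented_at D (R ` s) (R p) \<longleftrightarrow> (oriented_at D s p \<longleftrightarrow> (r > 0 \<longleftrightarrow> q > 0))"
    unfolding oriented_at_def R_in_iff pos sgn rq by blast
  have J: "joins D s p = (if oriented_at D s p then {(arc_in D x, arc_out D y), (arc_in D y, arc_out D x)}
      else {(arc_in D x, arc_in D y), (arc_out D x, arc_out D y)})"
    by (simp add: joins_def Let_def xy)
  have J': "joins D (R ` s) (R p) = (if oriented_at D (R ` s) (R p) then {(arc_in D y', arc_out D x'), (arc_in D x', arc_out D y')}
      else {(arc_in D y', arc_in D x'), (arc_out D y', arc_out D x')})"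
    by (simp add: joins_def Let_def oR)
  have r2: "r > 0 \<or> r < 0" and q2: "q > 0 \<or> q < 0" using r(1) q(1) by linarith+
  have conv: "{(a, b), (c, d)}\<inverse> = {(b, a), (d, c)}" for a b c d :: "(real^3) set" by auto
  have swap: "{a, b} \<union> {c, d} = {c, d} \<union> {b, a}" "{a, b} \<union> {c, d} = {b, a} \<union> {d, c}" "{a, b} \<union> {c, d} = {d, c} \<union> {a, b}"
    for a b c d :: "(real^3) set \<times> (real^3) set" by auto
  have cases: "sym_joins (R ` s) (R p) = map_prod reflect_set reflect_set ` sym_joins s p"
    if "(r > 0 \<longleftrightarrow> q > 0) = same"
      "reflect_set (arc_in D x) = (if r > 0 then arc_in D x' else arc_out D x')"
      "reflect_set (arc_out D x) = (if r > 0 then arc_out D x' else arc_in D x')"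
      "reflect_set (arc_in D y) = (if q > 0 then arc_in D y' else arc_out D y')"
      "reflect_set (arc_out D y) = (if q > 0 then arc_out D y' else arc_in D y')" for same
    unfolding sym_joins_def J J' ori image_Un
    by (cases "oriented_at D s p"; cases "r > 0"; cases "q > 0"; simp add: that conv; blast)
  show ?thesis
  proof (rule cases[OF refl])
    show "reflect_set (arc_in D x) = (if r > 0 then arc_in D x' else arc_out D x')"
      "reflect_set (arc_out D x) = (if r > 0 then arc_out D x' else arc_in D x')"
      using r2 r(3,4) by (cases "r > 0"; simp)+
    show "reflect_set (arc_in D y) = (if q > 0 then arc_in D y' else arc_out D y')"
      "reflect_set (arc_out D y) = (if q > 0 then arc_out D y' else arc_in D y')"
      using q2 q(3,4) by (cases "q > 0"; simp)+
  qed
qed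

lemma circles_reflect:
  shows "circles D (R ` s) = (\<lambda>C. reflect_set ` C) ` circles D s"
proof -
  have "(\<Union>p\<in>crossings D. sym_joins (R ` s) p) = (\<Union>p\<in>R ` crossings D. sym_joins (R ` s) p)"
    by (simp only: R_crossings)
  also have "\<dots> = (\<Union>p\<in>crossings D. sym_joins (R ` s) (R p))" by simp
  also have "\<dots> = (\<Union>p\<in>crossings D. map_prod reflect_set reflect_set ` sym_joins s p)"
    by (rule SUP_cong[OF refl]) (rule sym_joins_reflect)
  also have "\<dots> = map_prod reflect_set reflect_set ` (\<Union>p\<in>crossings D. sym_joins s p)" by (simp only: image_UN)
  finally show ?thesis
    unfolding circles_eq by (simp only: quotient_map_prod[OF reflect_set_reflect_set reflect_arcs])
qed

section \<open>The cube of smoothings\<close>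

text \<open>
  The ends are named so that \<open>a\<close> is joined to \<open>b\<close> by the 0-smoothing, which is the oriented smoothing
  precisely at positive crossings.
\<close>

definition "end_a p = arc_in D (ov p)"
definition "end_d p = arc_out D (ov p)"
definition "end_b p = (if positive D p then arc_out D (un p) else arc_in D (un p))"
definition "end_c p = (if positive D p then arc_in D (un p) else arc_out D (un p))"

lemma arcs_at_params: "x \<in> params n \<Longrightarrow> arc_in D x \<in> arcs D \<and> arc_out D x \<in> arcs D"
  using arc_in(1)[of "fst x" "snd x"] arc_out(1)[of "fst x" "snd x"] by (auto simp: params_def)

sublocale cube: resolution "arcs D" "crossings D" end_a end_b end_c end_d
proof
  show "finite (arcs D)" by (rule finite_arcs)
  show "finite (crossings D)" by (rule generic_facts(2))
  fix p assume p: "p \<in> crossings D"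
  show "end_a p \<in> arcs D" "end_b p \<in> arcs D" "end_c p \<in> arcs D" "end_d p \<in> arcs D"
    using arcs_at_params[OF crossing(4)[OF p]] arcs_at_params[OF crossing(5)[OF p]]
    by (simp_all add: end_a_def end_b_def end_c_def end_d_def)
next
  fix C
  have "(\<Sum>p\<in>crossings D. of_bool (end_a p \<in> C) + of_bool (end_b p \<in> C) + of_bool (end_c p \<in> C) + of_bool (end_d p \<in> C) :: nat)
    = (\<Sum>p\<in>crossings D. of_bool (arc_in D (ov p) \<in> C) + of_bool (arc_out D (ov p) \<in> C)
      + (of_bool (arc_in D (un p) \<in> C) + of_bool (arc_out D (un p) \<in> C)))"
    by (rule sum.cong) (simp_all add: end_a_def end_b_def end_c_def end_d_def)
  then show "even (\<Sum>p\<in>crossings D. of_bool (end_a p \<in> C) + of_bool (end_b p \<in> C) + of_bool (end_c p \<in> C) + of_bool (end_d p \<in> C) :: nat)"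
    using even_arc_ends[of C] by simp
qed

lemma circles_cube: "circles D s = cube.circ s"
proof -
  have "cube.pairs s p \<union> (cube.pairs s p)\<inverse> = sym_joins s p" for p
    unfolding cube.pairs_def sym_joins_def joins_def Let_def oriented_at_def end_a_def end_b_def end_c_def end_d_def
    by (cases "p \<in> s"; cases "positive D p"; simp; blast)
  then have "(\<Union>p\<in>crossings D. sym_joins s p) = (\<Union>p\<in>crossings D. cube.pairs s p) \<union> (\<Union>p\<in>crossings D. cube.pairs s p)\<inverse>"
    by blast
  then show ?thesis by (simp add: circles_eq cube.circ_def cube.eqv_def cl_def)
qed

lemma gens_eq: "gens D = Sigma (Pow (crossings D)) (\<lambda>s. Pow (circles D s))"
  by (auto simp: gens_def)

lemma finite_gens: "finite (gens D)"
  unfolding gens_eq circles_cube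
  by (intro finite_SigmaI) (simp_all add: generic_facts(2) cube.finite_circ)

lemma khovanov_edge_eq:
  "khovanov_edge D (s, P) (s', P') \<longleftrightarrow>
     (\<exists>p\<in>crossings D. p \<notin> s \<and> s' = insert p s) \<and> kedge (circles D s) (circles D s') P P'"
  by (simp add: khovanov_edge_def kedge_def Let_def)

lemma khovanov_edge_cube: "khovanov_edge D = cube.state_edge"
proof (intro ext)
  fix g h
  show "khovanov_edge D g h = cube.state_edge g h"
    by (cases g; cases h) (simp add: khovanov_edge_eq cube.state_edge_def circles_cube)
qed

lemma khovanov_d_square_zero: "khovanov_d D (khovanov_d D f) = 0"
proof
  fix h
  show "khovanov_d D (khovanov_d D f) h = 0 h"
  proof (cases "h \<in> gens D")
    case False
    then show ?thesis by (simp add: khovanov_d_def linear_extension_def)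
  next
    case True
    let ?e = "\<lambda>g h. of_bool (khovanov_edge D g h) :: bit"
    have "khovanov_d D (khovanov_d D f) h = (\<Sum>m\<in>gens D. ?e m h * (\<Sum>g\<in>gens D. ?e g m * f g))"
      using True by (simp add: khovanov_d_def linear_extension_def)
    also have "\<dots> = (\<Sum>m\<in>gens D. \<Sum>g\<in>gens D. f g * (?e g m * ?e m h))"
      by (simp add: sum_distrib_left mult_ac)
    also have "\<dots> = (\<Sum>g\<in>gens D. \<Sum>m\<in>gens D. f g * (?e g m * ?e m h))" by (rule sum.swap)
    also have "\<dots> = (\<Sum>g\<in>gens D. f g * (\<Sum>m\<in>gens D. ?e g m * ?e m h))" by (simp add: sum_distrib_left)
    also have "\<dots> = 0"
    proof (rule sum.neutral, rule ballI)
      fix g assume g: "g \<in> gens D"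
      have "(\<Sum>m\<in>gens D. ?e g m * ?e m h) = 0"
        using cube.state_edge_square_zero[of "fst g" "snd g" "fst h" "snd h"] g True
        unfolding khovanov_edge_cube gens_eq circles_cube by auto
      then show "f g * (\<Sum>m\<in>gens D. ?e g m * ?e m h) = 0" by simp
    qed
    finally show ?thesis by simp
  qed
qed

lemma khovanov_edge_deg_j:
  assumes "g \<in> gens D" "h \<in> gens D" "khovanov_edge D g h"
  shows "deg_j D h = deg_j D g"
proof -
  obtain s P s' P' where gh: "g = (s, P)" "h = (s', P')" by fastforce
  obtain p where p: "p \<in> crossings D" "p \<notin> s" "s' = insert p s"
    and k: "kedge (circles D s) (circles D s') P P'"
    using assms(3) unfolding gh khovanov_edge_eq by blast
  have s: "s \<subseteq> crossings D" "P \<subseteq> circles D s" "P' \<subseteq> circles D s'" using assms(1,2) by (auto simp: gens_def gh)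
  have "finite s" using s(1) generic_facts(2) finite_subset by blast
  then have "card s' = card s + 1" using p by simp
  moreover have "int (card P) - int (card (circles D s - P)) = int (card P') - int (card (circles D s' - P')) + 1"
    by (rule kedge_degree[OF _ _ s(2,3) k]) (simp_all add: circles_cube cube.finite_circ)
  ultimately show ?thesis by (simp add: deg_j_def gh)
qed

lemma tau_gen_eq: "tau_gen \<nu> (s, P) = (R ` s, (\<lambda>C. reflect_set ` C) ` P)"
  by (simp add: tau_gen_def)

lemma reflect_circle_involutive: "reflect_set ` reflect_set ` C = C"
  by (simp add: image_image R_R)

lemma inj_reflect_circle: "inj (\<lambda>C. reflect_set ` C)"
  by (rule injI) (metis reflect_circle_involutive)

lemma tau_gen_tau_gen: "tau_gen \<nu> (tau_gen \<nu> g) = g"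
  by (cases g) (simp add: tau_gen_eq image_image R_R)

lemma tau_gen_in_gens:
  assumes "g \<in> gens D"
  shows "tau_gen \<nu> g \<in> gens D"
proof -
  obtain s P where g: "g = (s, P)" by fastforce
  have "R ` s \<subseteq> R ` crossings D" "(\<lambda>C. reflect_set ` C) ` P \<subseteq> (\<lambda>C. reflect_set ` C) ` circles D s"
    using assms by (auto simp: g gens_def)
  then show ?thesis by (simp add: g tau_gen_eq gens_def R_crossings circles_reflect)
qed

lemma tau_gen_deg_j:
  assumes "g \<in> gens D"
  shows "deg_j D (tau_gen \<nu> g) = deg_j D g"
proof -
  obtain s P where g: "g = (s, P)" by fastforce
  have "card (R ` s) = card s" by (rule card_image) (metis R_R inj_onI)
  moreover have "card ((\<lambda>C. reflect_set ` C) ` Q) = card Q" for Q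
    by (rule card_image) (rule inj_on_subset[OF inj_reflect_circle subset_UNIV])
  moreover have "circles D (R ` s) - (\<lambda>C. reflect_set ` C) ` P = (\<lambda>C. reflect_set ` C) ` (circles D s - P)"
    unfolding circles_reflect by (rule image_set_diff[OF inj_reflect_circle, symmetric])
  ultimately show ?thesis by (simp add: g tau_gen_eq deg_j_def)
qed

lemma kedge_image:
  assumes f: "inj f"
  shows "kedge (f ` S) (f ` S') (f ` P) (f ` P') \<longleftrightarrow> kedge S S' P P'"
proof -
  have mem: "f x \<in> f ` A \<longleftrightarrow> x \<in> A" for x A by (rule inj_image_mem_iff[OF f])
  have inter: "f ` A \<inter> f ` B = f ` (A \<inter> B)" for A B by (rule image_Int[OF f, symmetric])
  have diff: "f ` A - f ` B = f ` (A - B)" for A B by (rule image_set_diff[OF f, symmetric])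
  have eq: "f ` A = f ` B \<longleftrightarrow> A = B" for A B by (rule inj_image_eq_iff[OF f])
  have cards: "kedge S S' P P' \<longleftrightarrow> kedge T T' Q Q'"
    if "T = f ` S" "T' = f ` S'" "Q = f ` P" "Q' = f ` P'" for T T' Q Q'
  proof -
    have diffs: "T - T' = f ` (S - S')" "T' - T = f ` (S' - S)" unfolding that by (rule diff)+
    have I: "P \<inter> (S \<inter> S') = P' \<inter> (S \<inter> S') \<longleftrightarrow> Q \<inter> (T \<inter> T') = Q' \<inter> (T \<inter> T')"
      unfolding that inter eq ..
    have merge: "kedge S S' P P' \<longleftrightarrow> kedge T T' Q Q'" if *: "A \<noteq> B" "S - S' = {A, B}" "S' - S = {M}" for A B M
    proof -
      have t: "f A \<noteq> f B" "T - T' = {f A, f B}" "T' - T = {f M}" using * f diffs by (simp_all add: inj_eq)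
      show ?thesis unfolding kedge_merge[OF *] kedge_merge[OF t] I unfolding \<open>Q = f ` P\<close> \<open>Q' = f ` P'\<close> mem ..
    qed
    have split: "kedge S S' P P' \<longleftrightarrow> kedge T T' Q Q'" if *: "A \<noteq> B" "S' - S = {A, B}" "S - S' = {M}" for A B M
    proof -
      have t: "f A \<noteq> f B" "T' - T = {f A, f B}" "T - T' = {f M}" using * f diffs by (simp_all add: inj_eq)
      show ?thesis unfolding kedge_split[OF *] kedge_split[OF t] I unfolding \<open>Q = f ` P\<close> \<open>Q' = f ` P'\<close> mem ..
    qed
    have doubleton: "\<exists>A B. A \<noteq> B \<and> U = {A, B}" if "f ` U = {a, b}" "a \<noteq> b" for U a b
    proof -
      have "a \<in> f ` U" "b \<in> f ` U" using that(1) by simp_all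
      then obtain A B where AB: "a = f A" "b = f B" "A \<in> U" "B \<in> U" by blast
      then have "f ` U = f ` {A, B}" using that(1) by simp
      then have U: "U = {A, B}" unfolding eq .
      have "A \<noteq> B" using AB(1,2) that(2) by auto
      then show ?thesis using U by (intro exI conjI)
    qed
    have singleton: "\<exists>M. U = {M}" if "f ` U = {m}" for U m
    proof -
      have "m \<in> f ` U" using that by simp
      then obtain M where M: "m = f M" by blast
      then have "f ` U = f ` {M}" using that by simp
      then show ?thesis unfolding eq by (rule exI)
    qed
    show ?thesis
    proof
      assume k: "kedge S S' P P'"
      then show "kedge T T' Q Q'"
        by (cases rule: kedge_cases) (use k merge split in simp_all)
    next
      assume k: "kedge T T' Q Q'"
      then show "kedge S S' P P'"
      proof (cases rule: kedge_cases)
        case 1: (merge a b m)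
        obtain A B where "A \<noteq> B" "S - S' = {A, B}" using doubleton[of "S - S'" a b] 1 diffs by auto
        moreover obtain M where "S' - S = {M}" using singleton[of "S' - S" m] 1 diffs by auto
        ultimately show ?thesis using merge k by simp
      next
        case 2: (split a b m)
        obtain A B where "A \<noteq> B" "S' - S = {A, B}" using doubleton[of "S' - S" a b] 2 diffs by auto
        moreover obtain M where "S - S' = {M}" using singleton[of "S - S'" m] 2 diffs by auto
        ultimately show ?thesis using split k by simp
      qed
    qed
  qed
  show ?thesis by (rule cards[OF refl refl refl refl, symmetric])
qed

lemma khovanov_edge_tau:
  "khovanov_edge D (tau_gen \<nu> g) (tau_gen \<nu> h) \<longleftrightarrow> khovanov_edge D g h"
proof -
  obtain s P s' P' where gh: "g = (s, P)" "h = (s', P')" by fastforce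
  have inj: "inj R" by (rule injI) (metis R_R)
  have "(\<exists>p\<in>crossings D. p \<notin> R ` s \<and> R ` s' = insert p (R ` s)) \<longleftrightarrow>
      (\<exists>p\<in>R ` crossings D. p \<notin> R ` s \<and> R ` s' = insert p (R ` s))" by (simp only: R_crossings)
  also have "\<dots> \<longleftrightarrow> (\<exists>p\<in>crossings D. R p \<notin> R ` s \<and> R ` s' = R ` insert p s)" by simp
  also have "\<dots> \<longleftrightarrow> (\<exists>p\<in>crossings D. p \<notin> s \<and> s' = insert p s)"
    unfolding R_in_iff inj_image_eq_iff[OF inj] ..
  finally show ?thesis
    unfolding gh tau_gen_eq khovanov_edge_eq circles_reflect kedge_image[OF inj_reflect_circle] by simp
qed

lemma tau_chain_eq: 
  assumes "f \<in> supported (gens D)"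
  shows "tau_chain \<nu> D f = (\<lambda>h. f (tau_gen \<nu> h))"
proof
  fix h
  show "tau_chain \<nu> D f h = f (tau_gen \<nu> h)"
  proof (cases "h \<in> gens D")
    case True
    have "(\<Sum>g\<in>gens D. of_bool (h = tau_gen \<nu> g) * f g) = (\<Sum>g\<in>gens D. if g = tau_gen \<nu> h then f g else 0)"
      by (rule sum.cong) (auto simp: tau_gen_tau_gen)
    then show ?thesis
      using True tau_gen_in_gens[OF True] finite_gens by (simp add: tau_chain_def linear_extension_def)
  next
    case False
    then have "tau_gen \<nu> h \<notin> gens D" using tau_gen_in_gens[of "tau_gen \<nu> h"] by (auto simp: tau_gen_tau_gen)
    then show ?thesis using False supportedD[OF assms] by (simp add: tau_chain_def linear_extension_def)
  qed
qed

lemma khovanov_d_tau: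
  assumes "f \<in> supported (gens D)"
  shows "khovanov_d D (\<lambda>h. f (tau_gen \<nu> h)) = (\<lambda>h. khovanov_d D f (tau_gen \<nu> h))"
proof
  fix h
  have in_iff: "tau_gen \<nu> h \<in> gens D \<longleftrightarrow> h \<in> gens D"
    using tau_gen_in_gens[of h] tau_gen_in_gens[of "tau_gen \<nu> h"] by (auto simp: tau_gen_tau_gen)
  have "(\<Sum>g\<in>gens D. of_bool (khovanov_edge D g h) * f (tau_gen \<nu> g))
      = (\<Sum>g\<in>gens D. of_bool (khovanov_edge D g (tau_gen \<nu> h)) * f g)"
  proof (rule sum.reindex_bij_witness[of _ "tau_gen \<nu>" "tau_gen \<nu>"])
    fix g
    show "of_bool (khovanov_edge D (tau_gen \<nu> g) (tau_gen \<nu> h)) * f (tau_gen \<nu> g) = of_bool (khovanov_edge D g h) * f (tau_gen \<nu> g)"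
      by (simp only: khovanov_edge_tau)
  qed (simp_all add: tau_gen_tau_gen tau_gen_in_gens)
  then show "khovanov_d D (\<lambda>h. f (tau_gen \<nu> h)) h = khovanov_d D f (tau_gen \<nu> h)"
    by (simp add: khovanov_d_def linear_extension_def in_iff)
qed

lemma khovanov_d_supported: "khovanov_d D f \<in> supported (gens D)"
  by (simp add: khovanov_d_def linear_extension_def supported_iff)

lemma khovanov_d_add: "khovanov_d D (\<lambda>h. f h + g h) = (\<lambda>h. khovanov_d D f h + khovanov_d D g h)"
  by (auto simp: fun_eq_iff khovanov_d_def linear_extension_def distrib_left sum.distrib)

text \<open>
  Expanding \<open>(d + id + \<tau>)\<^sup>2\<close> leaves \<open>d\<^sup>2 + (d \<tau> + \<tau> d) + id + \<tau>\<^sup>2\<close> modulo two.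
\<close>

lemma total_d_square_zero:
  assumes f: "f \<in> supported (gens D)"
  shows "total_d \<nu> D (total_d \<nu> D f) = 0"
proof -
  let ?d = "khovanov_d D" and ?t = "\<lambda>f h. f (tau_gen \<nu> h)"
  have in_iff: "tau_gen \<nu> h \<in> gens D \<longleftrightarrow> h \<in> gens D" for h
    using tau_gen_in_gens[of h] tau_gen_in_gens[of "tau_gen \<nu> h"] by (auto simp: tau_gen_tau_gen)
  have total: "total_d \<nu> D g = (\<lambda>h. ?d g h + (g h + ?t g h))" if "g \<in> supported (gens D)" for g
    using tau_chain_eq[OF that] by (simp add: total_d_def d_tau_def)
  have tf: "?t f \<in> supported (gens D)" using supportedD[OF f] in_iff by (simp add: supported_iff)
  have "(\<lambda>h. ?d f h + (f h + ?t f h)) \<in> supported (gens D)"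
    using supportedD[OF khovanov_d_supported, of _ f] supportedD[OF f] supportedD[OF tf] by (simp add: supported_iff)
  then have "total_d \<nu> D (total_d \<nu> D f) = (\<lambda>h. ?d (\<lambda>h. ?d f h + (f h + ?t f h)) h
      + ((?d f h + (f h + ?t f h)) + (?d f (tau_gen \<nu> h) + (f (tau_gen \<nu> h) + f h))))"
    unfolding total[OF f] by (simp add: total tau_gen_tau_gen)
  also have "\<dots> = (\<lambda>h. (?d f h + ?d (?t f) h) + ((?d f h + (f h + ?t f h)) + (?d f (tau_gen \<nu> h) + (f (tau_gen \<nu> h) + f h))))"
    using khovanov_d_square_zero[of f] by (simp add: khovanov_d_add)
  also have "\<dots> = 0"
  proof
    fix h
    have "(x + y) + ((x + (z + w)) + (y + (w + z))) = 0" for x y z w :: bit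
      by (cases x; cases y; cases z; cases w) simp_all
    then show "(?d f h + ?d (?t f) h) + ((?d f h + (f h + ?t f h)) + (?d f (tau_gen \<nu> h) + (f (tau_gen \<nu> h) + f h))) = 0 h"
      unfolding khovanov_d_tau[OF f] by simp
  qed
  finally show ?thesis .
qed

end

section \<open>The involutive mirror\<close>

context involutive_projection
begin

abbreviation "mirror \<equiv> change_crossings D"

lemma crossings_mirror: "crossings mirror = crossings D"
proof -
  have "pt mirror x = pt D x" for x by (simp add: pt_def change_crossings_def)
  moreover have "over mirror = (over D)\<inverse>" by (simp add: change_crossings_def)
  ultimately have "p \<in> crossings mirror \<longleftrightarrow> (\<exists>x y. p = pt D x \<and> (y, x) \<in> over D)" for p
    by (simp add: crossings_def)
  moreover have "(\<exists>x y. p = pt D x \<and> (y, x) \<in> over D) \<longleftrightarrow> p \<in> crossings D" for p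
  proof
    assume "\<exists>x y. p = pt D x \<and> (y, x) \<in> over D"
    then obtain x y where "p = pt D x" "(y, x) \<in> over D" by blast
    then show "p \<in> crossings D" using overD(3,6)[of y x] by simp
  next
    assume p: "p \<in> crossings D"
    show "\<exists>x y. p = pt D x \<and> (y, x) \<in> over D"
      using crossing(1,3)[OF p] by metis
  qed
  ultimately show ?thesis by blast
qed

lemma params_mirror: "over_param mirror p = un p" "under_param mirror p = ov p"
  by (simp_all add: over_param_def under_param_def change_crossings_def pt_def)

lemma tangent_mirror: "tangent mirror x = tangent D x"
  by (simp add: tangent_def change_crossings_def)

lemma arcs_mirror: "arcs mirror = arcs D"
  unfolding arcs_def crossings_mirror by (simp add: change_crossings_def)

lemma arc_in_mirror: "arc_in mirror x = arc_in D x" and arc_out_mirror: "arc_out mirror x = arc_out D x"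
  by (simp_all add: arc_in_def arc_out_def arcs_mirror) (simp_all add: change_crossings_def)

text \<open>
  Exchanging over and under exchanges two columns of a determinant; it is nonzero because crossings are
  transverse.
\<close>

lemma positive_mirror:
  assumes "p \<in> crossings D"
  shows "positive mirror p \<longleftrightarrow> \<not> positive D p"
proof -
  have "p \<bullet> cross3 (tangent D (un p)) (tangent D (ov p)) = - (p \<bullet> cross3 (tangent D (ov p)) (tangent D (un p)))"
    unfolding cross_skew[of "tangent D (un p)"] by simp
  moreover have "p \<bullet> cross3 (tangent D (ov p)) (tangent D (un p)) \<noteq> 0"
    using generic_facts(4)[OF crossing(1)[OF assms]] crossing(2)[OF assms] by simp
  ultimately show ?thesis
    unfolding positive_def params_mirror tangent_mirror by linarith
qed

text \<open>
  The 1-smoothing at a crossing is the 0-smoothing at its mirror image.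
\<close>

lemma oriented_at_mirror:
  assumes "p \<in> crossings D"
  shows "oriented_at mirror s p \<longleftrightarrow> oriented_at D (crossings D - s) p"
  using assms positive_mirror[OF assms] by (auto simp: oriented_at_def)

lemma circles_mirror: "circles mirror s = circles D (crossings D - s)"
proof -
  have J: "joins mirror s p \<union> (joins mirror s p)\<inverse> = sym_joins (crossings D - s) p" if "p \<in> crossings D" for p
    unfolding joins_def[of mirror] sym_joins_def joins_def[of D] Let_def oriented_at_mirror[OF that]
      arc_in_mirror arc_out_mirror params_mirror
    by (cases "oriented_at D (crossings D - s) p") (simp; blast)+
  have "(\<Union>p\<in>crossings D. joins mirror s p) \<union> (\<Union>p\<in>crossings D. joins mirror s p)\<inverse>
      = (\<Union>p\<in>crossings D. joins mirror s p \<union> (joins mirror s p)\<inverse>)" by auto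
  also have "\<dots> = (\<Union>p\<in>crossings D. sym_joins (crossings D - s) p)"
    by (rule SUP_cong[OF refl J])
  finally show ?thesis
    unfolding circles_def[of mirror] Let_def circles_eq arcs_mirror crossings_mirror by simp
qed

text \<open>
  By \<open>circles_mirror\<close> the two generators live on the same curves, with opposite labels.
\<close>

definition complement :: "gen \<Rightarrow> gen" where
  "complement = (\<lambda>(s, P). (crossings D - s, circles D (crossings D - s) - P))"

lemma complement_in_gens:
  assumes "g \<in> gens mirror"
  shows "complement g \<in> gens D"
  using assms by (auto simp: gens_def complement_def)

lemma bij_complement: "bij_betw complement (gens mirror) (gens D)"
proof (rule bij_betw_byWitness[where f' = "\<lambda>(s, P). (crossings D - s, circles D s - P)"])
  show "\<forall>g\<in>gens mirror. (\<lambda>(s, P). (crossings D - s, circles D s - P)) (complement g) = g"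
    by (auto simp: gens_def complement_def crossings_mirror circles_mirror double_diff)
  show "\<forall>g\<in>gens D. complement ((\<lambda>(s, P). (crossings D - s, circles D s - P)) g) = g"
    by (auto simp: gens_def complement_def double_diff)
  show "complement ` gens mirror \<subseteq> gens D" using complement_in_gens by blast
  show "(\<lambda>(s, P). (crossings D - s, circles D s - P)) ` gens D \<subseteq> gens mirror"
    by (auto simp: gens_def crossings_mirror circles_mirror double_diff)
qed

lemma n_mirror: "n_plus mirror = n_minus D" "n_minus mirror = n_plus D"
proof -
  have "{p \<in> crossings mirror. positive mirror p} = {p \<in> crossings D. \<not> positive D p}"
    "{p \<in> crossings mirror. \<not> positive mirror p} = {p \<in> crossings D. positive D p}"
    using positive_mirror by (auto simp: crossings_mirror)
  then show "n_plus mirror = n_minus D" "n_minus mirror = n_plus D"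
    by (simp_all add: n_plus_def n_minus_def)
qed

lemma n_plus_n_minus: "card (crossings D) = n_plus D + n_minus D"
proof -
  have "crossings D = {p \<in> crossings D. positive D p} \<union> {p \<in> crossings D. \<not> positive D p}" by blast
  then show ?thesis unfolding n_plus_def n_minus_def
    using generic_facts(2) card_Un_disjoint[of "{p \<in> crossings D. positive D p}" "{p \<in> crossings D. \<not> positive D p}"]
    by (metis (mono_tags, lifting) disjoint_iff finite_Un mem_Collect_eq)
qed

lemma deg_complement:
  assumes "g \<in> gens mirror"
  shows "deg_i D (complement g) = - deg_i mirror g" "deg_j D (complement g) = - deg_j mirror g"
proof -
  obtain s P where g: "g = (s, P)" by fastforce
  have s: "s \<subseteq> crossings D" "P \<subseteq> circles D (crossings D - s)"
    using assms by (auto simp: g gens_def crossings_mirror circles_mirror)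
  have "int (card (crossings D - s)) = int (n_plus D) + int (n_minus D) - int (card s)"
    using n_plus_n_minus card_Diff_subset[OF finite_subset[OF s(1) generic_facts(2)] s(1)]
      card_mono[OF generic_facts(2) s(1)] by simp
  moreover have "circles D (crossings D - s) - (circles D (crossings D - s) - P) = P" using s(2) by blast
  ultimately show "deg_i D (complement g) = - deg_i mirror g" "deg_j D (complement g) = - deg_j mirror g"
    by (simp_all add: g complement_def deg_i_def deg_j_def n_mirror circles_mirror)
qed

text \<open>
  The condition says that the reflection carries one strand to the other one with reversed orientation;
  as the reflection is an involution, the roles of the strands can be exchanged.
\<close>

lemma reverses_mirror: "reverses \<nu> mirror p \<longleftrightarrow> reverses \<nu> D p"
proof -
  \<comment> \<open>Apply the reflection to both sides and divide by \<open>- r\<close>.\<close>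
  have flip: "\<exists>r>0. R w = (- r) *\<^sub>R v" if "r > 0" "R v = (- r) *\<^sub>R w" for r v w
  proof -
    have "v = (- r) *\<^sub>R R w" using that(2) R_R[of v] by (simp only: reflect_scaleR)
    then have "R w = (- (1 / r)) *\<^sub>R v" using that(1) by simp
    then show ?thesis using that(1) by (intro exI[of _ "1 / r"]) simp
  qed
  show ?thesis
    unfolding reverses_def params_mirror tangent_mirror using flip by metis
qed

lemma local_weight_mirror:
  assumes "p \<in> crossings D"
  shows "local_weight \<nu> D (crossings D - s) p = - local_weight \<nu> mirror s p"
  unfolding local_weight_def Let_def reverses_mirror oriented_at_mirror[OF assms] positive_mirror[OF assms]
  by simp

lemma weight_complement: "weight \<nu> D (fst (complement g)) = - weight \<nu> mirror (fst g)"
  by (cases g) (simp add: weight_def complement_def crossings_mirror local_weight_mirror sum_negf)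

lemma weight_half_integer: "2 * weight \<nu> D' s \<in> \<int>"
proof -
  have "2 * local_weight \<nu> D' s p \<in> \<int>" for p by (simp add: local_weight_def Let_def)
  then show ?thesis unfolding weight_def sum_distrib_left by (intro Ints_sum)
qed

lemma khovanov_edge_mirror:
  assumes g: "g \<in> gens mirror" and h: "h \<in> gens mirror"
  shows "khovanov_edge mirror g h \<longleftrightarrow> khovanov_edge D (complement h) (complement g)"
proof -
  obtain s P s' P' where gh: "g = (s, P)" "h = (s', P')" by fastforce
  have s: "s \<subseteq> crossings D" "P \<subseteq> circles D (crossings D - s)" "s' \<subseteq> crossings D" "P' \<subseteq> circles D (crossings D - s')"
    using g h by (auto simp: gh gens_def crossings_mirror circles_mirror)
  have "(\<exists>p\<in>crossings D. p \<notin> s \<and> s' = insert p s) \<longleftrightarrow>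
      (\<exists>p\<in>crossings D. p \<notin> crossings D - s' \<and> crossings D - s = insert p (crossings D - s'))"
  proof (rule bex_cong[OF refl])
    fix p assume p: "p \<in> crossings D"
    show "(p \<notin> s \<and> s' = insert p s) = (p \<notin> crossings D - s' \<and> crossings D - s = insert p (crossings D - s'))"
    proof
      assume "p \<notin> s \<and> s' = insert p s"
      then show "p \<notin> crossings D - s' \<and> crossings D - s = insert p (crossings D - s')" using p by auto
    next
      assume *: "p \<notin> crossings D - s' \<and> crossings D - s = insert p (crossings D - s')"
      then have "crossings D - (crossings D - s) = crossings D - insert p (crossings D - s')" by simp
      then have "s = s' - {p}" using s(1,3) by auto
      then show "p \<notin> s \<and> s' = insert p s" using * p by auto
    qed
  qed
  then show ?thesis
    using kedge_complement[OF s(2,4)]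
    by (simp add: gh khovanov_edge_eq complement_def)
       (simp add: khovanov_edge_def kedge_def crossings_mirror circles_mirror Let_def)
qed

lemma complement_tau: "complement (tau_gen \<nu> g) = tau_gen \<nu> (complement g)"
proof -
  obtain s P where g: "g = (s, P)" by fastforce
  have inj: "inj R" by (rule injI) (metis R_R)
  have "crossings D - R ` s = R ` (crossings D - s)"
    unfolding image_set_diff[OF inj] R_crossings ..
  then show ?thesis
    by (simp add: g complement_def tau_gen_eq circles_reflect image_set_diff[OF inj_reflect_circle])
qed

lemma tau_gen_in_gens_mirror:
  assumes "g \<in> gens mirror"
  shows "tau_gen \<nu> g \<in> gens mirror"
proof -
  have "tau_gen \<nu> (complement g) \<in> gens D" by (rule tau_gen_in_gens[OF complement_in_gens[OF assms]])
  obtain s P where g: "g = (s, P)" by fastforce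
  have s: "s \<subseteq> crossings D" "P \<subseteq> circles D (crossings D - s)"
    using assms by (auto simp: g gens_def crossings_mirror circles_mirror)
  have inj: "inj R" by (rule injI) (metis R_R)
  have "crossings D - R ` s = R ` (crossings D - s)"
    unfolding image_set_diff[OF inj] R_crossings ..
  moreover have "R ` s \<subseteq> crossings D" using image_mono[OF s(1), of R] by (simp only: R_crossings)
  ultimately show ?thesis
    using image_mono[OF s(2), of "\<lambda>C. reflect_set ` C"]
    by (simp add: g tau_gen_eq gens_def crossings_mirror circles_mirror circles_reflect)
qed

lemma Kh_tau_mirror:
  assumes "2 * k \<in> \<int>"
  shows "linearly_isomorphic (Kh_tau \<nu> mirror i j k) (Kh_tau \<nu> D (- i) (- j) (- k))"
  by (rule Kh_tau_dual_isomorphic[OF finite_gens bij_complement deg_complement(1) deg_complement(2) weight_complement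
        weight_half_integer khovanov_edge_mirror complement_tau tau_gen_in_gens_mirror tau_gen_tau_gen
        khovanov_edge_deg_j tau_gen_deg_j total_d_square_zero assms])

end

theorem proposition1p4:
  fixes \<nu> :: "real^3" and L L' :: olink and D :: diagram and i j :: int and k :: rat
  assumes "norm \<nu> = 1"
    and "involutive_mirror \<nu> L L' D"
    and "2 * k \<in> \<int>"
  shows "linearly_isomorphic (Kh_tau \<nu> (change_crossings D) i j k) (Kh_tau \<nu> D (- i) (- j) (- k))"
proof -
  obtain K where K: "involutive_link \<nu> K" "(0, 1) \<notin> underlying_set K" "(0, -1) \<notin> underlying_set K"
      "generic_projection K" "D = diagram_of K"
    using assms(2) unfolding involutive_mirror_def involutive_diagram_def by metis
  interpret involutive_projection \<nu> K D
    by unfold_locales (fact assms(1) K)+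
  show ?thesis by (rule Kh_tau_mirror[OF assms(3)])
qed

end
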